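(* Assume the regression setting described in the context, with fixed $\rho\in(-1,1)$ and $\sigma_\varepsilon^2>0$. Let $n\to\infty$ and let $p=p_n$ satisfy $p\to\infty$ and $p/n\to c\in(0,\infty)$. Assume $\sum_{j=1}^\infty\beta_j^2<\infty$. Then $$\frac{\|\mathbb{X}'Y\|_2^2-n^2\kappa_{2,p}-pn(\kappa_{1,p}+\sigma_\varepsilon^2)}{n^{3/2}}\xrightarrow{d}\mathcal N(0,s^2),$$ where $$s^2=4\kappa_2^2+4(\kappa_1+\sigma_\varepsilon^2)(2\kappa_2c+\kappa_3)+2c(\kappa_1+\sigma_\varepsilon^2)^2\Big(c+\frac{1+\rho^2}{1-\rho^2}\Big).$$
   Context: Let $(\beta_j)_{j\ge1}$ be a fixed real sequence, $\rho\in(-1,1)$ and $\sigma_\varepsilon^2>0$ fixed. For each $n$ and $p=p_n$, let $\mathbb X=(X_1,\dots,X_n)'\in\mathbb R^{n\times p}$ have i.i.d. rows $X_i\sim\mathcal N_p(0,\Sigma)$ with $\Sigma=(\rho^{|i-j|})_{i,j=1}^p$ (with $\Sigma=I_p$ when $\rho=0$), let $\varepsilon\sim\mathcal N(0,\sigma_\varepsilon^2I_n)$ be independent of $\mathbb X$, let $\beta=(\beta_1,\dots,\beta_p)'$ and $Y=\mathbb X\beta+\varepsilon$. Define $\kappa_{1,p}=\sum_{k,l=1}^p\beta_k\beta_l\rho^{|k-l|}$, $\kappa_{2,p}=\sum_{k=1}^p\big(\sum_{l=1}^p\beta_l\rho^{|k-l|}\big)^2$, $\kappa_{3,p}=\sum_{k,l,j,j'=1}^p\beta_j\beta_{j'}\rho^{|k-j|}\rho^{|l-j'|}\rho^{|k-l|}$,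 and $\kappa_i=\lim_{p\to\infty}\kappa_{i,p}$ ($i=1,2,3$), which exist and are finite when $\sum_j\beta_j^2<\infty$. $\|\cdot\|_2$ is the Euclidean norm. *)

theory Defs
  imports "HOL-Probability.Probability"
begin

text \<open>rho^|k-l| for natural indices k, l (with 0^0 = 1, so Sigma = I when rho = 0).\<close>
definition rpow :: "real \<Rightarrow> nat \<Rightarrow> nat \<Rightarrow> real" where
  "rpow \<rho> k l = \<rho> ^ (if k \<le> l then l - k else k - l)"

text \<open>Indices are 0-based: beta j (j = 0,1,...) stands for the paper's beta_(j+1).\<close>
definition kappa1p :: "real \<Rightarrow> (nat \<Rightarrow> real) \<Rightarrow> nat \<Rightarrow> real" where
  "kappa1p \<rho> \<beta> p = (\<Sum>k<p. \<Sum>l<p. \<beta> k * \<beta> l * rpow \<rho> k l)"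

definition kappa2p :: "real \<Rightarrow> (nat \<Rightarrow> real) \<Rightarrow> nat \<Rightarrow> real" where
  "kappa2p \<rho> \<beta> p = (\<Sum>k<p. (\<Sum>l<p. \<beta> l * rpow \<rho> k l)\<^sup>2)"

definition kappa3p :: "real \<Rightarrow> (nat \<Rightarrow> real) \<Rightarrow> nat \<Rightarrow> real" where
  "kappa3p \<rho> \<beta> p = (\<Sum>k<p. \<Sum>l<p. \<Sum>j<p. \<Sum>j'<p.
      \<beta> j * \<beta> j' * rpow \<rho> k j * rpow \<rho> l j' * rpow \<rho> k l)"

definition normal_var :: "real \<Rightarrow> real measure" where
  "normal_var v = (if v = 0 then return borel 0 else density lborel (normal_density 0 (sqrt v)))"

text \<open>Multivariate normal N(0, C) for the random vector (Z j)_{j \<in> I}, I finite: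
  every linear combination is centered normal with variance a' C a (Cramer--Wold definition).\<close>
definition centered_mvnormal ::
  "'a measure \<Rightarrow> (nat \<Rightarrow> 'a \<Rightarrow> real) \<Rightarrow> nat set \<Rightarrow> (nat \<Rightarrow> nat \<Rightarrow> real) \<Rightarrow> bool" where
  "centered_mvnormal M Z I C \<longleftrightarrow>
     (\<forall>j\<in>I. Z j \<in> borel_measurable M) \<and>
     (\<forall>a :: nat \<Rightarrow> real.
        distr M borel (\<lambda>\<omega>. \<Sum>j\<in>I. a j * Z j \<omega>) =
        normal_var (\<Sum>j\<in>I. \<Sum>k\<in>I. a j * a k * C j k))"

end

theory Submission
  imports Defs
begin

text \<open>
  Write \<open>b = \<Sigma>\<beta>\<close>, \<open>\<tau>\<^sup>2 = \<kappa>\<^sub>1 + \<sigma>\<^sup>2\<close>. Conditionally on \<open>Y\<close>, the vector \<open>X'Y\<close> is Gaussian with mean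
  \<open>b |Y|\<^sup>2 / \<tau>\<^sup>2\<close> and covariance \<open>|Y|\<^sup>2 (\<Sigma> - b b\<^sup>T / \<tau>\<^sup>2)\<close>, so it has the law of \<open>b Q + \<tau> \<surd>Q G\<close> with
  \<open>Q\<close> chi-squared with \<open>n\<close> degrees of freedom and an independent \<open>G\<close> distributed as
  \<open>N(0, \<Sigma> - b b\<^sup>T / \<tau>\<^sup>2)\<close>; this is checked by comparing
  joint characteristic functions. Up to an error that is small in \<open>L\<^sup>1\<close>, the normalised statistic is
  \<open>(2 \<kappa>\<^sub>2 + \<tau>\<^sup>2 p/n) (Q - n) / \<surd>n + \<tau>\<^sup>2 (|Z|\<^sup>2 - p) / \<surd>n + 2 \<tau> b\<cdot>G\<close> with \<open>Z\<close> distributed as \<open>N(0, \<Sigma>)\<close>.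
  For such quadratic forms \<open>T\<close> in Gaussian variables, integration by parts (Stein's identity) gives
  \<open>E[T exp(itT)] = it E[H exp(itT)]\<close> with \<open>H\<close> quadratic and concentrated around the variance \<open>v\<close> of \<open>T\<close>.
  Hence the characteristic function nearly solves \<open>\<phi>' = - v t \<phi>\<close> and is close to \<open>exp(- v t\<^sup>2 / 2)\<close>;
  Levy's continuity theorem concludes.
\<close>

section \<open>Joint characteristic functions\<close>

text \<open>The statistic is a quartic in the Gaussian data, and the coordinates of
  \<open>X'Y\<close> are all tied together by the common \<open>Y\<close>. Since only laws are
  compared, no conditional distribution is ever constructed: the data and the model with
  \<open>Q\<close> and \<open>G\<close> both lead to the same \<open>n\<close>-th power of a
  one-dimensional Gaussian integral, which never has to be evaluated. The matrix \<Sigma> is not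
  diagonalised either; an explicit triangular factor realises the Gaussian vector, and the error
  estimates rest on absolute row sums, which are bounded uniformly in \<open>p\<close>. They hold
  for fixed \<open>n\<close> and \<open>p\<close>, with an overall factor \<open>1 / sqrt n\<close>.
  The variance is assembled from 2 (2 \<kappa>2 + \<tau>^2 p/n)^2 for \<open>Q\<close>, 2 \<tau>^4
  tr(\<Sigma>^2)/n for the squared norm and 4 \<tau>^2 \<kappa>3 - 4 \<kappa>2^2 for the linear
  term. Expanding the square gives 8 \<kappa>2^2, and the negative term reduces it to the 4
  \<kappa>2^2 of the theorem.\<close>

text \<open>Dividing by the common total mass \<open>c\<close> (the case \<open>t = 0\<close> of
  \<open>eq\<close>) turns the weights into probability densities, and Levy's uniqueness theorem
  applies to the images of the reweighted measures. A zero mass makes both sides vanish.\<close>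

lemma weighted_char_uniqueness:
  fixes f g :: "'a \<Rightarrow> real" and f' g' :: "'b \<Rightarrow> real"
  assumes "prob_space M" "prob_space M'"
    and [measurable]: "f \<in> borel_measurable M" "g \<in> borel_measurable M"
      "f' \<in> borel_measurable M'" "g' \<in> borel_measurable M'"
    and g: "\<And>x. 0 \<le> g x" "\<And>x. g x \<le> C" and g': "\<And>x. 0 \<le> g' x" "\<And>x. g' x \<le> C"
    and eq: "\<And>t. (CLINT x|M. complex_of_real (g x) * iexp (t * f x)) =
                 (CLINT x|M'. complex_of_real (g' x) * iexp (t * f' x))"
    and [measurable]: "B \<in> sets borel"
  shows "(LINT x|M. g x * indicator B (f x)) = (LINT x|M'. g' x * indicator B (f' x))"
proof -
  interpret M: prob_space M by fact
  interpret M': prob_space M' by fact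
  have ig: "integrable M g" using g by (intro M.integrable_const_bound[where B=C]) auto
  have ig': "integrable M' g'" using g' by (intro M'.integrable_const_bound[where B=C]) auto
  define c where "c = (LINT x|M. g x)"
  have "complex_of_real (LINT x|M. g x) = complex_of_real (LINT x|M'. g' x)"
    using eq[of 0] by simp
  hence c': "c = (LINT x|M'. g' x)" unfolding c_def of_real_eq_iff .
  have c0: "c \<ge> 0" unfolding c_def using g by simp
  show ?thesis
  proof (cases "c = 0")
    case True
    have "AE x in M. g x = 0" using True ig g integral_nonneg_eq_0_iff_AE[of M g] by (auto simp: c_def)
    hence 1: "(LINT x|M. g x * indicator B (f x)) = (LINT x|M. 0)" by (intro integral_cong_AE) auto
    have "AE x in M'. g' x = 0" using True ig' g' integral_nonneg_eq_0_iff_AE[of M' g'] c' by auto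
    hence 2: "(LINT x|M'. g' x * indicator B (f' x)) = (LINT x|M'. 0)" by (intro integral_cong_AE) auto
    from 1 2 show ?thesis by simp
  next
    case False
    hence c: "c > 0" using c0 by simp
    have main: "real_distribution (distr (density N (\<lambda>x. ennreal (G x / c))) borel F)
        \<and> (\<forall>t. char (distr (density N (\<lambda>x. ennreal (G x / c))) borel F) t =
             (CLINT x|N. complex_of_real (G x) * iexp (t * F x)) / c)
        \<and> measure (distr (density N (\<lambda>x. ennreal (G x / c))) borel F) B = (LINT x|N. G x * indicator B (F x)) / c"
      if "prob_space N" and m[measurable]: "F \<in> borel_measurable N" "G \<in> borel_measurable N"
        and G: "\<And>x. 0 \<le> G x" and iG: "integrable N G" and cG: "c = (LINT x|N. G x)"
      for N :: "'c measure" and F G :: "'c \<Rightarrow> real"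
    proof -
      interpret N: prob_space N by fact
      let ?D = "density N (\<lambda>x. ennreal (G x / c))"
      have "emeasure ?D (space ?D) = (\<integral>\<^sup>+x. ennreal (G x / c) \<partial>N)"
        by (simp add: emeasure_density cong: nn_integral_cong)
      also have "\<dots> = ennreal (LINT x|N. G x / c)" using iG G c by (intro nn_integral_eq_integral) auto
      also have "\<dots> = 1" using cG c by simp
      finally interpret D: prob_space ?D by (intro prob_spaceI)
      have 1: "real_distribution (distr ?D borel F)"
        by (intro D.real_distribution_distr) simp
      have 2: "char (distr ?D borel F) t = (CLINT x|N. complex_of_real (G x) * iexp (t * F x)) / c" for t
      proof -
        have "char (distr ?D borel F) t = (CLINT x|?D. iexp (t * F x))"
          unfolding char_def by (subst integral_distr) auto
        also have "\<dots> = (CLINT x|N. (G x / c) *\<^sub>R iexp (t * F x))"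
          using G c by (subst integral_density) auto
        also have "\<dots> = (CLINT x|N. complex_of_real (G x) * iexp (t * F x) / c)"
          by (intro Bochner_Integration.integral_cong refl) (simp add: scaleR_conv_of_real)
        finally show ?thesis by simp
      qed
      have "measure (distr ?D borel F) B = (LINT x|(distr ?D borel F). indicator B x)"
        by simp
      also have "\<dots> = (LINT x|?D. indicator B (F x))"
        by (subst integral_distr) auto
      also have "\<dots> = (LINT x|N. (G x / c) *\<^sub>R indicator B (F x))"
        using G c by (subst integral_density) auto
      also have "\<dots> = (LINT x|N. G x * indicator B (F x)) / c" by simp
      finally show ?thesis using 1 2 by auto
    qed
    note R = main[OF assms(1) assms(3,4) g(1) ig c_def]
      and R' = main[OF assms(2) assms(5,6) g'(1) ig' c']
    have "distr (density M (\<lambda>x. ennreal (g x / c))) borel f = distr (density M' (\<lambda>x. ennreal (g' x / c))) borel f'"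
    proof (intro Levy_uniqueness)
      show "char (distr (density M (\<lambda>x. ennreal (g x / c))) borel f) = char (distr (density M' (\<lambda>x. ennreal (g' x / c))) borel f')"
        by (rule ext) (simp only: R R' eq)
    qed (use R R' in blast)+
    thus ?thesis using R R' c by (metis divide_cancel_right False)
  qed
qed

text \<open>The complex weight is recovered from the nonnegative weights \<open>1\<close>, \<open>1 + cos\<close> and \<open>1 + sin\<close>, so that
  one-dimensional uniqueness applies.\<close>

lemma weighted_char_uniqueness_iexp:
  fixes f g r :: "'a \<Rightarrow> real" and f' g' r' :: "'b \<Rightarrow> real"
  assumes "prob_space M" "prob_space M'"
    and [measurable]: "f \<in> borel_measurable M" "g \<in> borel_measurable M" "r \<in> borel_measurable M"
      "f' \<in> borel_measurable M'" "g' \<in> borel_measurable M'" "r' \<in> borel_measurable M'"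
    and g: "\<And>x. 0 \<le> g x" "\<And>x. g x \<le> 1" and g': "\<And>x. 0 \<le> g' x" "\<And>x. g' x \<le> 1"
    and eq: "\<And>t s. (CLINT x|M. complex_of_real (g x) * iexp (t * f x + s * r x)) =
                 (CLINT x|M'. complex_of_real (g' x) * iexp (t * f' x + s * r' x))"
    and [measurable]: "B \<in> sets borel"
  shows "(CLINT x|M. complex_of_real (g x * indicator B (f x)) * iexp (r x)) =
         (CLINT x|M'. complex_of_real (g' x * indicator B (f' x)) * iexp (r' x))"
proof -
  interpret M: prob_space M by fact
  interpret M': prob_space M' by fact
  \<comment> \<open>Euler's formulas write the weights \<open>1 + cos\<close> and
    \<open>1 + sin\<close> through \<open>eq\<close> at \<open>s = 0\<close>, \<open>1\<close> and
    \<open>-1\<close>.\<close>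
  have ex: "complex_of_real (G * (1 + cos R)) * iexp (F) =
      of_real G * iexp (F + 0 * R) + (of_real G * iexp (F + 1 * R) + of_real G * iexp (F + (-1) * R)) / 2"
     "complex_of_real (G * (1 + sin R)) * iexp (F) =
      of_real G * iexp (F + 0 * R) + (of_real G * iexp (F + 1 * R) - of_real G * iexp (F + (-1) * R)) / (2 * \<i>)" for F G R
    by (simp_all add: complex_eq_iff Re_exp Im_exp cos_add sin_add cos_diff sin_diff Re_divide Im_divide power2_eq_square
          del: of_real_add of_real_mult, simp_all add: field_simps)
  have exI: "(CLINT x|N. complex_of_real (G x * (1 + cos (R x))) * iexp (t * F x)) =
       (CLINT x|N. complex_of_real (G x) * iexp (t * F x + 0 * R x)) + ((CLINT x|N. complex_of_real (G x) * iexp (t * F x + 1 * R x))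
       + (CLINT x|N. complex_of_real (G x) * iexp (t * F x + (-1) * R x))) / 2" (is ?c)
     "(CLINT x|N. complex_of_real (G x * (1 + sin (R x))) * iexp (t * F x)) =
       (CLINT x|N. complex_of_real (G x) * iexp (t * F x + 0 * R x)) + ((CLINT x|N. complex_of_real (G x) * iexp (t * F x + 1 * R x))
       - (CLINT x|N. complex_of_real (G x) * iexp (t * F x + (-1) * R x))) / (2 * \<i>)" (is ?s)
    if "prob_space N" and [measurable]: "F \<in> borel_measurable N" "G \<in> borel_measurable N" "R \<in> borel_measurable N"
      and G: "\<And>x. 0 \<le> G x" "\<And>x. G x \<le> 1"
    for N :: "'c measure" and F G R t
  proof -
    interpret N: prob_space N by fact
    have int: "integrable N (\<lambda>x. complex_of_real (G x) * iexp (t * F x + s * R x))" for s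
      using G by (intro N.integrable_const_bound[where B=1]) (auto simp: norm_mult)
    show ?c unfolding ex
      using int[of 0] int[of 1] int[of "-1"]
      by (simp only: integral_divide_zero integral_divide Bochner_Integration.integral_add integrable_divide Bochner_Integration.integrable_add)
    show ?s unfolding ex
      using int[of 0] int[of 1] int[of "-1"]
      by (simp only: integral_divide_zero Bochner_Integration.integral_add Bochner_Integration.integral_diff
          integrable_divide Bochner_Integration.integrable_add Bochner_Integration.integrable_diff)
  qed
  have b: "G * (1 + cos R) \<ge> 0" "G * (1 + cos R) \<le> 2" "G * (1 + sin R) \<ge> 0" "G * (1 + sin R) \<le> 2"
    if "0 \<le> G" "G \<le> 1" for G R :: real
  proof -
    have c: "0 \<le> 1 + cos R" "1 + cos R \<le> 2" "0 \<le> 1 + sin R" "1 + sin R \<le> 2"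
      using cos_ge_minus_one[of R] cos_le_one[of R] sin_ge_minus_one[of R] sin_le_one[of R] by linarith+
    show "G * (1 + cos R) \<ge> 0" "G * (1 + sin R) \<ge> 0" using that c by auto
    show "G * (1 + cos R) \<le> 2" using mult_mono[of G 1 "1 + cos R" 2] that c by simp
    show "G * (1 + sin R) \<le> 2" using mult_mono[of G 1 "1 + sin R" 2] that c by simp
  qed
  have e0: "(CLINT x|M. complex_of_real (g x) * iexp (t * f x)) =
                 (CLINT x|M'. complex_of_real (g' x) * iexp (t * f' x))" for t
    using eq[of t 0] by simp
  have 1: "(LINT x|M. g x * indicator B (f x)) = (LINT x|M'. g' x * indicator B (f' x))"
    using g g' e0 by (intro weighted_char_uniqueness[where C=1]) (auto intro: assms)
  have 2: "(LINT x|M. g x * (1 + cos (r x)) * indicator B (f x)) = (LINT x|M'. g' x * (1 + cos (r' x)) * indicator B (f' x))"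
  proof (intro weighted_char_uniqueness[where C=2])
    show "(CLINT x|M. complex_of_real (g x * (1 + cos (r x))) * iexp (t * f x)) =
         (CLINT x|M'. complex_of_real (g' x * (1 + cos (r' x))) * iexp (t * f' x))" for t
      unfolding exI[OF assms(1) assms(3,4,5) g] exI[OF assms(2) assms(6,7,8) g'] by (simp only: eq)
  qed (use g g' b assms in auto)
  have 3: "(LINT x|M. g x * (1 + sin (r x)) * indicator B (f x)) = (LINT x|M'. g' x * (1 + sin (r' x)) * indicator B (f' x))"
  proof (intro weighted_char_uniqueness[where C=2])
    show "(CLINT x|M. complex_of_real (g x * (1 + sin (r x))) * iexp (t * f x)) =
         (CLINT x|M'. complex_of_real (g' x * (1 + sin (r' x))) * iexp (t * f' x))" for t
      unfolding exI[OF assms(1) assms(3,4,5) g] exI[OF assms(2) assms(6,7,8) g'] by (simp only: eq)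
  qed (use g g' b assms in auto)
  \<comment> \<open>\<open>iexp R\<close> is \<open>(1 + cos R) - 1\<close> plus \<i> times
    \<open>(1 + sin R) - 1\<close>, so three real identities combine to the complex one.\<close>
  have split: "(CLINT x|N. complex_of_real (G x * indicator B (F x)) * iexp (R x)) =
      (of_real (LINT x|N. G x * (1 + cos (R x)) * indicator B (F x)) - of_real (LINT x|N. G x * indicator B (F x)))
      + \<i> * (of_real (LINT x|N. G x * (1 + sin (R x)) * indicator B (F x)) - of_real (LINT x|N. G x * indicator B (F x)))"
    if "prob_space N" and [measurable]: "F \<in> borel_measurable N" "G \<in> borel_measurable N" "R \<in> borel_measurable N"
      and G: "\<And>x. 0 \<le> G x" "\<And>x. G x \<le> 1"
    for N :: "'c measure" and F G R
  proof -
    interpret N: prob_space N by fact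
    have i1: "integrable N (\<lambda>x. G x * indicator B (F x))" "integrable N (\<lambda>x. G x * cos (R x) * indicator B (F x))"
        "integrable N (\<lambda>x. G x * sin (R x) * indicator B (F x))"
      using G by (intro N.integrable_const_bound[where B=1]; auto simp: abs_mult indicator_def intro!: mult_le_one AE_I2)+
    have "(CLINT x|N. complex_of_real (G x * indicator B (F x)) * iexp (R x)) =
      (CLINT x|N. of_real (G x * cos (R x) * indicator B (F x)) + \<i> * of_real (G x * sin (R x) * indicator B (F x)))"
      by (intro Bochner_Integration.integral_cong refl) (simp add: cis_conv_exp[symmetric] complex_eq_iff)
    also have "\<dots> = of_real (LINT x|N. G x * cos (R x) * indicator B (F x)) + \<i> * of_real (LINT x|N. G x * sin (R x) * indicator B (F x))"
      using i1 by (subst Bochner_Integration.integral_add) (auto intro!: integrable_mult_right integrable_of_real simp del: of_real_mult)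
    finally show ?thesis using i1 by (simp add: ring_distribs)
  qed
  show ?thesis
    unfolding split[OF assms(1) assms(3,4,5) g] split[OF assms(2) assms(6,7,8) g'] by (simp only: 1 2 3)
qed

text \<open>The exponentials are replaced by indicators one coordinate at a time.\<close>

lemma joint_char_uniqueness_indicators:
  fixes f :: "nat \<Rightarrow> 'a \<Rightarrow> real" and f' :: "nat \<Rightarrow> 'b \<Rightarrow> real"
  assumes "prob_space M" "prob_space M'"
    and m[measurable]: "\<And>j. j < p \<Longrightarrow> f j \<in> borel_measurable M" "\<And>j. j < p \<Longrightarrow> f' j \<in> borel_measurable M'"
    and eq: "\<And>\<theta>. (CLINT x|M. iexp (\<Sum>j<p. \<theta> j * f j x)) = (CLINT x|M'. iexp (\<Sum>j<p. \<theta> j * f' j x))"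
    and B[measurable]: "\<And>j. B j \<in> sets borel"
    and k: "k \<le> p"
  shows "(CLINT x|M. complex_of_real (\<Prod>j<k. indicator (B j) (f j x)) * iexp (\<Sum>j=k..<p. \<theta> j * f j x)) =
         (CLINT x|M'. complex_of_real (\<Prod>j<k. indicator (B j) (f' j x)) * iexp (\<Sum>j=k..<p. \<theta> j * f' j x))"
  using k
proof (induction k arbitrary: \<theta>)
  case 0
  then show ?case using eq[of \<theta>] by (simp add: lessThan_atLeast0)
next
  case (Suc k)
  have m1[measurable]: "\<And>j. j \<in> {..<k} \<Longrightarrow> f j \<in> borel_measurable M" "\<And>j. j \<in> {..<k} \<Longrightarrow> f' j \<in> borel_measurable M'"
    "\<And>j. j \<in> {Suc k..<p} \<Longrightarrow> f j \<in> borel_measurable M" "\<And>j. j \<in> {Suc k..<p} \<Longrightarrow> f' j \<in> borel_measurable M'"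
    "f k \<in> borel_measurable M" "f' k \<in> borel_measurable M'"
    using m Suc.prems by auto
  \<comment> \<open>Putting \<open>t\<close> at coordinate \<open>k\<close> and scaling the later
    ones by \<open>s\<close> extracts, from the induction hypothesis for all \<theta>, the
    two-parameter family that the one-step lemma asks for.\<close>
  have sp: "(\<Sum>j=k..<p. ((\<lambda>j. s * \<theta> j)(k := t)) j * F j) = t * F k + s * (\<Sum>j=Suc k..<p. \<theta> j * F j)"
    for s t :: real and F :: "nat \<Rightarrow> real"
    using Suc.prems by (subst sum.atLeast_Suc_lessThan) (auto simp: sum_distrib_left mult.assoc intro!: sum.cong)
  have *: "(CLINT x|M. complex_of_real (\<Prod>j<k. indicator (B j) (f j x)) * iexp (t * f k x + s * (\<Sum>j=Suc k..<p. \<theta> j * f j x))) =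
      (CLINT x|M'. complex_of_real (\<Prod>j<k. indicator (B j) (f' j x)) * iexp (t * f' k x + s * (\<Sum>j=Suc k..<p. \<theta> j * f' j x)))"
    for s t
    using Suc.IH[of "(\<lambda>j. s * \<theta> j)(k := t)"] Suc.prems unfolding sp by simp
  have "(CLINT x|M. complex_of_real ((\<Prod>j<k. indicator (B j) (f j x)) * indicator (B k) (f k x)) * iexp (\<Sum>j=Suc k..<p. \<theta> j * f j x)) =
        (CLINT x|M'. complex_of_real ((\<Prod>j<k. indicator (B j) (f' j x)) * indicator (B k) (f' k x)) * iexp (\<Sum>j=Suc k..<p. \<theta> j * f' j x))"
    by (intro weighted_char_uniqueness_iexp * assms(1,2))
      (auto intro!: prod_nonneg prod_le_1)
  then show ?case by simp
qed

text \<open>With all exponentials turned into indicators the two laws agree on boxes with Borel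
  sides, an intersection-stable generator of the product \<sigma>-algebra.\<close>

lemma joint_char_uniqueness:
  fixes f :: "nat \<Rightarrow> 'a \<Rightarrow> real" and f' :: "nat \<Rightarrow> 'b \<Rightarrow> real"
  assumes "prob_space M" "prob_space M'"
    and m[measurable]: "\<And>j. j < p \<Longrightarrow> f j \<in> borel_measurable M" "\<And>j. j < p \<Longrightarrow> f' j \<in> borel_measurable M'"
    and eq: "\<And>\<theta>. (CLINT x|M. iexp (\<Sum>j<p. \<theta> j * f j x)) = (CLINT x|M'. iexp (\<Sum>j<p. \<theta> j * f' j x))"
  shows "distr M (Pi\<^sub>M {..<p} (\<lambda>_. borel)) (\<lambda>x. \<lambda>j\<in>{..<p}. f j x) =
         distr M' (Pi\<^sub>M {..<p} (\<lambda>_. borel)) (\<lambda>x. \<lambda>j\<in>{..<p}. f' j x)" (is "?D = ?D'")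
proof -
  interpret M: prob_space M by fact
  interpret M': prob_space M' by fact
  have mv[measurable]: "(\<lambda>x. \<lambda>j\<in>{..<p}. f j x) \<in> measurable M (Pi\<^sub>M {..<p} (\<lambda>_. borel))"
      "(\<lambda>x. \<lambda>j\<in>{..<p}. f' j x) \<in> measurable M' (Pi\<^sub>M {..<p} (\<lambda>_. borel))"
    by (intro measurable_restrict; simp)+
  interpret D: prob_space ?D by (rule M.prob_space_distr) simp
  interpret D': prob_space ?D' by (rule M'.prob_space_distr) simp
  show ?thesis
  proof (rule measure_eqI_PiM_finite[where I="{..<p}" and M="\<lambda>_. borel"])
    show "emeasure ?D (PiE {..<p} A) = emeasure ?D' (PiE {..<p} A)" if A: "\<And>i. i \<in> {..<p} \<Longrightarrow> A i \<in> sets borel" for A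
    proof -
      \<comment> \<open>\<open>A\<close> is Borel only at indices below \<open>p\<close>, while the
        indicator lemma takes a Borel set at every index.\<close>
      define B where "B i = (if i < p then A i else {})" for i
      have [measurable]: "B i \<in> sets borel" for i using A by (auto simp: B_def)
      have AB: "PiE {..<p} A = PiE {..<p} B" by (intro PiE_cong) (simp add: B_def)
      have S[measurable]: "PiE {..<p} A \<in> sets (Pi\<^sub>M {..<p} (\<lambda>_. borel))" unfolding AB by (intro sets_PiM_I_finite) auto
      have main: "complex_of_real (measure (distr N (Pi\<^sub>M {..<p} (\<lambda>_. borel)) (\<lambda>x. \<lambda>j\<in>{..<p}. F j x)) (PiE {..<p} A)) =
         (CLINT x|N. complex_of_real (\<Prod>j<p. indicator (B j) (F j x)))"
        if "prob_space N" and [measurable]: "\<And>j. j < p \<Longrightarrow> F j \<in> borel_measurable N" for N :: "'c measure" and F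
      proof -
        interpret N: prob_space N by fact
        have [measurable]: "(\<lambda>x. \<lambda>j\<in>{..<p}. F j x) \<in> measurable N (Pi\<^sub>M {..<p} (\<lambda>_. borel))"
          by (intro measurable_restrict) simp
        have "measure (distr N (Pi\<^sub>M {..<p} (\<lambda>_. borel)) (\<lambda>x. \<lambda>j\<in>{..<p}. F j x)) (PiE {..<p} A) =
          (LINT x|(distr N (Pi\<^sub>M {..<p} (\<lambda>_. borel)) (\<lambda>x. \<lambda>j\<in>{..<p}. F j x)). indicator (PiE {..<p} A) x)"
          using sets.sets_into_space[OF S] by (simp add: Int_absorb2)
        also have "\<dots> = (LINT x|N. indicator (PiE {..<p} A) (\<lambda>j\<in>{..<p}. F j x))"
          by (subst integral_distr) auto
        also have "\<dots> = (LINT x|N. (\<Prod>j<p. indicator (B j) (F j x)))"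
        proof (intro Bochner_Integration.integral_cong refl)
          fix x
          show "indicator (PiE {..<p} A) (\<lambda>j\<in>{..<p}. F j x) = (\<Prod>j<p. indicator (B j) (F j x) :: real)"
            by (auto simp: indicator_def PiE_iff B_def prod_zero_iff)
        qed
        finally show ?thesis by (simp only: integral_complex_of_real)
      qed
      have "complex_of_real (measure ?D (PiE {..<p} A)) = complex_of_real (measure ?D' (PiE {..<p} A))"
        using joint_char_uniqueness_indicators[OF assms(1,2) m eq, where B=B and k=p and \<theta>="\<lambda>_. 0"]
        by (simp only: main[OF assms(1) m(1)] main[OF assms(2) m(2)]) simp
      then show ?thesis by (simp add: D.emeasure_eq_measure D'.emeasure_eq_measure)
    qed
    show "range (\<lambda>_::nat. \<Pi>\<^sub>E i\<in>{..<p}. (UNIV::real set)) \<subseteq> prod_algebra {..<p} (\<lambda>_. borel)"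
      by (auto intro!: prod_algebraI_finite)
  qed (auto simp: space_PiM D.emeasure_eq_measure)
qed

section \<open>Stein's identity for standard Gaussian vectors\<close>

abbreviation std_gauss :: "'i set \<Rightarrow> ('i \<Rightarrow> real) measure" where
  "std_gauss I \<equiv> Pi\<^sub>M I (\<lambda>_. std_normal_distribution)"

lemma prob_space_std_normal: "prob_space std_normal_distribution"
  using real_dist_normal_dist by (simp add: real_distribution_def)

lemma prob_space_std_gauss: "prob_space (std_gauss I)"
  by (intro prob_space_PiM prob_space_std_normal)

text \<open>Completing the square in \<open>\<bar>x\<bar> / 2 - r\<close>. Half of the Gaussian
  exponent is spent on the exponential; the remaining \<open>exp (- x\<^sup>2 / 4)\<close> still
  integrates and still kills boundary terms.\<close>

lemma exp_abs_times_gauss_le: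
  fixes r x :: real
  shows "exp (r * \<bar>x\<bar>) * std_normal_density x \<le> exp (r\<^sup>2) * exp (- x\<^sup>2 / 4)"
proof -
  have "0 \<le> (\<bar>x\<bar> / 2 - r)\<^sup>2" by simp
  hence "r * \<bar>x\<bar> - x\<^sup>2 / 2 \<le> r\<^sup>2 - x\<^sup>2 / 4" by (simp add: power2_diff power_divide mult.commute[of r])
  hence "exp (r * \<bar>x\<bar>) * exp (- x\<^sup>2 / 2) \<le> exp (r\<^sup>2) * exp (- x\<^sup>2 / 4)"
    by (simp add: exp_add[symmetric])
  moreover have "std_normal_density x \<le> exp (- x\<^sup>2 / 2)"
  proof -
    have "1 \<le> sqrt (2 * pi)" using pi_gt3 by (intro real_le_rsqrt) auto
    hence "1 / sqrt (2 * pi) \<le> 1" by simp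
    thus ?thesis unfolding std_normal_density_def by (intro mult_left_le_one_le) auto
  qed
  ultimately show ?thesis by (meson exp_ge_zero mult_left_mono order_trans)
qed

lemma integrable_exp_abs_std_normal:
  "integrable std_normal_distribution (\<lambda>x. exp (r * \<bar>x\<bar>))"
proof -
  \<comment> \<open>Variance \<open>2\<close> makes the density a constant times
    \<open>exp (- x\<^sup>2 / 4)\<close>.\<close>
  have "integrable lborel (\<lambda>x. normal_density 0 (sqrt 2) x)"
    by simp
  hence "integrable lborel (\<lambda>x. (exp (r\<^sup>2) * sqrt (2 * pi * 2)) * normal_density 0 (sqrt 2) x)"
    by (rule integrable_mult_right)
  hence "integrable lborel (\<lambda>x. exp (r\<^sup>2) * exp (- x\<^sup>2 / 4))"
    by (simp add: normal_density_def mult.assoc)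
  hence "integrable lborel (\<lambda>x. std_normal_density x *\<^sub>R exp (r * \<bar>x\<bar>))"
  proof (rule Bochner_Integration.integrable_bound)
    show "AE x in lborel. norm (std_normal_density x *\<^sub>R exp (r * \<bar>x\<bar>)) \<le> norm (exp (r\<^sup>2) * exp (- x\<^sup>2 / 4))"
      using exp_abs_times_gauss_le[of r] by (auto simp: mult.commute)
  qed auto
  thus ?thesis by (subst integrable_density) auto
qed


text \<open>The density satisfies \<phi>' = - x \<phi>, so the product \<open>F\<close> of density
  and \<open>f\<close> has as derivative the difference of the two integrands, and the growth bound
  makes \<open>F\<close> vanish at both infinities.\<close>

lemma stein_identity:
  fixes f f' :: "real \<Rightarrow> 'a::euclidean_space"
  assumes der: "\<And>x. (f has_vector_derivative f' x) (at x)" and cont: "\<And>x. isCont f' x"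
    and bf: "\<And>x. norm (f x) \<le> c * exp (r * \<bar>x\<bar>)" and bf': "\<And>x. norm (f' x) \<le> c' * exp (r' * \<bar>x\<bar>)"
  shows "(LINT x|std_normal_distribution. x *\<^sub>R f x) = (LINT x|std_normal_distribution. f' x)"
proof -
  let ?N = std_normal_distribution and ?\<phi> = std_normal_density
  have cf: "continuous_on UNIV f"
    using der has_vector_derivative_continuous continuous_at_imp_continuous_on by blast
  have cf': "continuous_on UNIV f'" using cont continuous_at_imp_continuous_on by blast
  have [measurable]: "f \<in> borel_measurable borel" "f' \<in> borel_measurable borel"
    using cf cf' borel_measurable_continuous_onI by blast+
  have c: "c \<ge> 0" "c' \<ge> 0"
    using order_trans[OF norm_ge_zero bf[of 0]] order_trans[OF norm_ge_zero bf'[of 0]] by auto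
  have i1: "integrable ?N (\<lambda>x. x *\<^sub>R f x)"
  proof (rule Bochner_Integration.integrable_bound[OF integrable_mult_right[OF integrable_exp_abs_std_normal]])
    show "AE x in ?N. norm (x *\<^sub>R f x) \<le> norm (c * exp ((r + 1) * \<bar>x\<bar>))"
    proof (rule AE_I2)
      fix x :: real
      have "\<bar>x\<bar> \<le> exp \<bar>x\<bar>" using exp_ge_add_one_self[of "\<bar>x\<bar>"] by linarith
      hence "\<bar>x\<bar> * norm (f x) \<le> exp \<bar>x\<bar> * (c * exp (r * \<bar>x\<bar>))" using bf c by (intro mult_mono) auto
      thus "norm (x *\<^sub>R f x) \<le> norm (c * exp ((r + 1) * \<bar>x\<bar>))"
        using c by (simp add: exp_add ring_distribs mult_ac)
    qed
  qed auto
  have i2: "integrable ?N f'"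
    by (rule Bochner_Integration.integrable_bound[OF integrable_mult_right[OF integrable_exp_abs_std_normal, of c' r']])
       (use bf' c in auto)
  have j1: "integrable lborel (\<lambda>x. ?\<phi> x *\<^sub>R (x *\<^sub>R f x))" using i1 by (subst (asm) integrable_density) auto
  have j2: "integrable lborel (\<lambda>x. ?\<phi> x *\<^sub>R f' x)" using i2 by (subst (asm) integrable_density) auto
  define F where "F x = ?\<phi> x *\<^sub>R f x" for x
  define F' where "F' x = ?\<phi> x *\<^sub>R f' x - ?\<phi> x *\<^sub>R (x *\<^sub>R f x)" for x
  have d\<phi>: "(?\<phi> has_real_derivative - x * ?\<phi> x) (at x)" for x
  proof -
    define C where "C = 1 / sqrt (2 * pi)"
    show ?thesis unfolding std_normal_density_def C_def[symmetric] by (auto intro!: derivative_eq_intros)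
  qed
  have dF: "(F has_vector_derivative F' x) (at x)" for x
    unfolding F_def F'_def
    by (rule derivative_eq_intros der d\<phi>[THEN has_field_derivative_at_within] refl)+ simp
  have cF: "isCont F' x" for x
    unfolding F'_def std_normal_density_def
    using cf cont by (intro continuous_intros) (auto simp: continuous_on_eq_continuous_at)
  have iF: "integrable lborel F'" unfolding F'_def using j1 j2 by simp
  have bF: "norm (F x) \<le> c * exp (r\<^sup>2) * exp (- x\<^sup>2 / 4)" for x
  proof -
    have "norm (F x) \<le> ?\<phi> x * (c * exp (r * \<bar>x\<bar>))" unfolding F_def using bf by (simp add: mult_left_mono)
    also have "\<dots> \<le> c * (exp (r\<^sup>2) * exp (- x\<^sup>2 / 4))"
      using exp_abs_times_gauss_le[of r x] c by (simp add: mult.commute mult.left_commute mult_left_mono)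
    finally show ?thesis by (simp add: mult.assoc)
  qed
  \<comment> \<open>Stated for any filter along which \<open>x\<^sup>2\<close> tends to infinity, so
    that one argument serves both ends of the line.\<close>
  have lim: "(F \<longlongrightarrow> 0) G" if "filterlim (\<lambda>x::real. x\<^sup>2) at_top G" for G
  proof (rule Lim_null_comparison)
    show "\<forall>\<^sub>F x in G. norm (F x) \<le> c * exp (r\<^sup>2) * exp (- x\<^sup>2 / 4)" using bF by auto
    have "filterlim (\<lambda>x::real. - x\<^sup>2 / 4) at_bot G"
      using filterlim_tendsto_pos_mult_at_top[OF tendsto_const[of "1/4"] _ that]
      by (simp add: filterlim_uminus_at_bot mult.commute)
    hence "((\<lambda>x::real. exp (- x\<^sup>2 / 4)) \<longlongrightarrow> 0) G" by (rule filterlim_compose[OF exp_at_bot])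
    thus "((\<lambda>x. c * exp (r\<^sup>2) * exp (- x\<^sup>2 / 4)) \<longlongrightarrow> 0) G" by (rule tendsto_mult_right_zero)
  qed
  have t1: "filterlim (\<lambda>x::real. x\<^sup>2) at_top at_top"
    by (intro filterlim_pow_at_top filterlim_ident) auto
  have t2: "filterlim (\<lambda>x::real. x\<^sup>2) at_top at_bot"
    by (rule filterlim_pow_at_bot_even) (auto intro: filterlim_ident)
  have "(LBINT x=-\<infinity>..\<infinity>. F' x) = 0 - 0"
  proof (rule interval_integral_FTC_integrable)
    show "((F \<circ> real_of_ereal) \<longlongrightarrow> 0) (at_right (-\<infinity>))" using lim[OF t2] by (simp add: ereal_tendsto_simps)
    show "((F \<circ> real_of_ereal) \<longlongrightarrow> 0) (at_left \<infinity>)" using lim[OF t1] by (simp add: ereal_tendsto_simps)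
    show "set_integrable lborel (einterval (- \<infinity>) \<infinity>) F'" using iF by (simp add: set_integrable_def)
  qed (use dF cF in auto)
  hence "(LINT x|lborel. F' x) = 0"
    by (simp add: interval_lebesgue_integral_def set_lebesgue_integral_def)
  hence "(LINT x|lborel. ?\<phi> x *\<^sub>R f' x) = (LINT x|lborel. ?\<phi> x *\<^sub>R (x *\<^sub>R f x))"
    unfolding F'_def using j1 j2 by simp
  thus ?thesis by (simp add: integral_density)
qed

section \<open>Functions of at most exponential growth\<close>

text \<open>A class of test functions stable under the algebra used below, each member being
  integrable. The exponential of the l1 norm factorises over coordinates, so integrability reduces
  to dimension one and freezing some coordinates keeps a bound of the same type.\<close>

definition exp_growth :: "'i set \<Rightarrow> (('i \<Rightarrow> real) \<Rightarrow> 'a::real_normed_vector) \<Rightarrow> bool" where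
  "exp_growth I f \<longleftrightarrow> f \<in> borel_measurable (std_gauss I) \<and>
     (\<exists>c r. \<forall>x. norm (f x) \<le> c * exp (r * (\<Sum>i\<in>I. \<bar>x i\<bar>)))"

lemma exp_growth_measurable[measurable_dest]: "exp_growth I f \<Longrightarrow> f \<in> borel_measurable (std_gauss I)"
  by (simp add: exp_growth_def)

lemma exp_growthE:
  assumes "exp_growth I f"
  obtains c r where "c \<ge> 0" "r \<ge> 0" "\<And>x. norm (f x) \<le> c * exp (r * (\<Sum>i\<in>I. \<bar>x i\<bar>))"
proof -
  obtain c r where b: "\<And>x. norm (f x) \<le> c * exp (r * (\<Sum>i\<in>I. \<bar>x i\<bar>))"
    using assms by (auto simp: exp_growth_def)
  have "norm (f x) \<le> \<bar>c\<bar> * exp (\<bar>r\<bar> * (\<Sum>i\<in>I. \<bar>x i\<bar>))" for x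
  proof -
    have "r * (\<Sum>i\<in>I. \<bar>x i\<bar>) \<le> \<bar>r\<bar> * (\<Sum>i\<in>I. \<bar>x i\<bar>)" by (intro mult_right_mono) (auto intro: sum_nonneg)
    hence "c * exp (r * (\<Sum>i\<in>I. \<bar>x i\<bar>)) \<le> \<bar>c\<bar> * exp (\<bar>r\<bar> * (\<Sum>i\<in>I. \<bar>x i\<bar>))" by (intro mult_mono) auto
    with b[of x] show ?thesis by linarith
  qed
  thus ?thesis using that[of "\<bar>c\<bar>" "\<bar>r\<bar>"] by auto
qed

lemma exp_growth_const[simp, intro]: "exp_growth I (\<lambda>_. c)"
  unfolding exp_growth_def by (intro conjI exI[of _ "norm c"] exI[of _ 0]) auto

lemma exp_growth_add[intro]:
  fixes f g :: "_ \<Rightarrow> 'a::{real_normed_vector, second_countable_topology}"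
  assumes "exp_growth I f" "exp_growth I g"
  shows "exp_growth I (\<lambda>x. f x + g x)"
proof -
  note [measurable] = assms[THEN exp_growth_measurable]
  obtain c r where 1: "c \<ge> 0" "r \<ge> 0" "\<And>x. norm (f x) \<le> c * exp (r * (\<Sum>i\<in>I. \<bar>x i\<bar>))" using exp_growthE[OF assms(1)] by metis
  obtain d s where 2: "d \<ge> 0" "s \<ge> 0" "\<And>x. norm (g x) \<le> d * exp (s * (\<Sum>i\<in>I. \<bar>x i\<bar>))" using exp_growthE[OF assms(2)] by metis
  have "norm (f x + g x) \<le> (c + d) * exp ((r + s) * (\<Sum>i\<in>I. \<bar>x i\<bar>))" for x
  proof -
    have S: "0 \<le> (\<Sum>i\<in>I. \<bar>x i\<bar>)" by (simp add: sum_nonneg)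
    have "c * exp (r * (\<Sum>i\<in>I. \<bar>x i\<bar>)) \<le> c * exp ((r + s) * (\<Sum>i\<in>I. \<bar>x i\<bar>))"
         "d * exp (s * (\<Sum>i\<in>I. \<bar>x i\<bar>)) \<le> d * exp ((r + s) * (\<Sum>i\<in>I. \<bar>x i\<bar>))"
      using 1 2 S by (auto intro!: mult_left_mono simp: distrib_right)
    thus ?thesis using 1(3)[of x] 2(3)[of x] norm_triangle_ineq[of "f x" "g x"] by (simp add: distrib_right)
  qed
  thus ?thesis unfolding exp_growth_def by auto
qed

lemma exp_growth_scaleR[intro]:
  fixes g :: "_ \<Rightarrow> 'a::{real_normed_vector, second_countable_topology}"
  assumes "exp_growth I f" "exp_growth I g"
  shows "exp_growth I (\<lambda>x. f x *\<^sub>R g x)"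
proof -
  note [measurable] = assms[THEN exp_growth_measurable]
  obtain c r where 1: "c \<ge> 0" "r \<ge> 0" "\<And>x. norm (f x) \<le> c * exp (r * (\<Sum>i\<in>I. \<bar>x i\<bar>))" using exp_growthE[OF assms(1)] by metis
  obtain d s where 2: "d \<ge> 0" "s \<ge> 0" "\<And>x. norm (g x) \<le> d * exp (s * (\<Sum>i\<in>I. \<bar>x i\<bar>))" using exp_growthE[OF assms(2)] by metis
  have "norm (f x *\<^sub>R g x) \<le> (c * d) * exp ((r + s) * (\<Sum>i\<in>I. \<bar>x i\<bar>))" for x
    using mult_mono[OF 1(3)[of x] 2(3)[of x]] 1(1) by (simp add: exp_add ring_distribs mult_ac)
  thus ?thesis unfolding exp_growth_def by auto
qed

lemma exp_growth_mult[intro]: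
  fixes f g :: "_ \<Rightarrow> 'a::{real_normed_field, second_countable_topology}"
  assumes "exp_growth I f" "exp_growth I g"
  shows "exp_growth I (\<lambda>x. f x * g x)"
proof -
  note [measurable] = assms[THEN exp_growth_measurable]
  obtain c r where 1: "c \<ge> 0" "r \<ge> 0" "\<And>x. norm (f x) \<le> c * exp (r * (\<Sum>i\<in>I. \<bar>x i\<bar>))" using exp_growthE[OF assms(1)] by metis
  obtain d s where 2: "d \<ge> 0" "s \<ge> 0" "\<And>x. norm (g x) \<le> d * exp (s * (\<Sum>i\<in>I. \<bar>x i\<bar>))" using exp_growthE[OF assms(2)] by metis
  have "norm (f x * g x) \<le> (c * d) * exp ((r + s) * (\<Sum>i\<in>I. \<bar>x i\<bar>))" for x
    using mult_mono[OF 1(3)[of x] 2(3)[of x]] 1(1) by (simp add: exp_add ring_distribs mult_ac norm_mult)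
  thus ?thesis unfolding exp_growth_def by auto
qed

lemma exp_growth_diff[intro]:
  fixes f g :: "_ \<Rightarrow> 'a::{real_normed_vector, second_countable_topology}"
  assumes "exp_growth I f" "exp_growth I g"
  shows "exp_growth I (\<lambda>x. f x - g x)"
  using exp_growth_add[OF assms(1) exp_growth_scaleR[OF exp_growth_const[of I "-1"] assms(2)]] by simp

lemma exp_growth_sum[intro]:
  fixes f :: "'k \<Rightarrow> _ \<Rightarrow> 'a::{real_normed_vector, second_countable_topology}"
  assumes "\<And>k. k \<in> K \<Longrightarrow> exp_growth I (f k)"
  shows "exp_growth I (\<lambda>x. \<Sum>k\<in>K. f k x)"
  using assms by (induction K rule: infinite_finite_induct) auto

lemma exp_growth_power[intro]:
  fixes f :: "_ \<Rightarrow> real"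
  shows "exp_growth I f \<Longrightarrow> exp_growth I (\<lambda>x. f x ^ n)"
  by (induction n) auto

lemma exp_growth_abs[intro]:
  fixes f :: "_ \<Rightarrow> real"
  shows "exp_growth I f \<Longrightarrow> exp_growth I (\<lambda>x. \<bar>f x\<bar>)"
  unfolding exp_growth_def by auto

lemma exp_growth_component[intro]:
  assumes "finite I" "i \<in> I" shows "exp_growth I (\<lambda>x. x i)"
proof -
  have "\<bar>x i\<bar> \<le> 1 * exp (1 * (\<Sum>i\<in>I. \<bar>x i\<bar>))" for x :: "_ \<Rightarrow> real"
  proof -
    have "\<bar>x i\<bar> \<le> (\<Sum>i\<in>I. \<bar>x i\<bar>)" using assms by (intro member_le_sum) auto
    also have "\<dots> \<le> exp (\<Sum>i\<in>I. \<bar>x i\<bar>)"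
      using exp_ge_add_one_self[of "\<Sum>i\<in>I. \<bar>x i\<bar>"] by (rule order_trans[rotated]) simp
    finally show ?thesis by simp
  qed
  thus ?thesis unfolding exp_growth_def using assms by (intro conjI exI[of _ 1]) auto
qed

lemma exp_growth_iexp[intro]:
  assumes [measurable]: "f \<in> borel_measurable (std_gauss I)"
  shows "exp_growth I (\<lambda>x. iexp (f x))"
  unfolding exp_growth_def by (intro conjI exI[of _ 1] exI[of _ 0]) auto

lemma exp_growth_complex_of_real[intro]:
  "exp_growth I f \<Longrightarrow> exp_growth I (\<lambda>x. complex_of_real (f x))"
  unfolding exp_growth_def by auto

lemma exp_growth_integrable:
  fixes f :: "_ \<Rightarrow> 'a::{banach, second_countable_topology}"
  assumes "finite I" "exp_growth I f"
  shows "integrable (std_gauss I) f"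
proof -
  note [measurable] = assms(2)[THEN exp_growth_measurable]
  obtain c r where b: "c \<ge> 0" "r \<ge> 0" "\<And>x. norm (f x) \<le> c * exp (r * (\<Sum>i\<in>I. \<bar>x i\<bar>))" using exp_growthE[OF assms(2)] by metis
  interpret product_sigma_finite "\<lambda>_. std_normal_distribution"
    unfolding product_sigma_finite_def by (intro allI prob_space_imp_sigma_finite prob_space_std_normal)
  have "integrable (std_gauss I) (\<lambda>x. \<Prod>i\<in>I. exp (r * \<bar>x i\<bar>))"
    using assms by (intro product_integrable_prod integrable_exp_abs_std_normal)
  hence "integrable (std_gauss I) (\<lambda>x. c * exp (r * (\<Sum>i\<in>I. \<bar>x i\<bar>)))"
    using assms(1) by (simp add: exp_sum[symmetric] sum_distrib_left)
  thus ?thesis by (rule Bochner_Integration.integrable_bound) (use b in auto)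
qed

lemma stein_identity_component:
  fixes F DF :: "('i \<Rightarrow> real) \<Rightarrow> 'a::euclidean_space"
  assumes I: "finite I" "k \<in> I" and F: "exp_growth I F" and DF: "exp_growth I DF"
    and der: "\<And>x s. ((\<lambda>s. F (x(k := s))) has_vector_derivative DF (x(k := s))) (at s)"
    and cont: "\<And>x s. isCont (\<lambda>s. DF (x(k := s))) s"
  shows "(LINT x|std_gauss I. x k *\<^sub>R F x) = (LINT x|std_gauss I. DF x)"
proof -
  interpret product_sigma_finite "\<lambda>_. std_normal_distribution"
    unfolding product_sigma_finite_def by (intro allI prob_space_imp_sigma_finite prob_space_std_normal)
  define J where "J = I - {k}"
  have J: "finite J" "k \<notin> J" "I = insert k J" using I by (auto simp: J_def)
  have i1: "integrable (std_gauss (insert k J)) (\<lambda>x. x k *\<^sub>R F x)"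
    using I F J by (intro exp_growth_integrable) auto
  have i2: "integrable (std_gauss (insert k J)) DF"
    using I DF J by (intro exp_growth_integrable) auto
  obtain c r where b: "c \<ge> 0" "r \<ge> 0" "\<And>x. norm (F x) \<le> c * exp (r * (\<Sum>i\<in>I. \<bar>x i\<bar>))" using exp_growthE[OF F] by metis
  obtain d s where b': "d \<ge> 0" "s \<ge> 0" "\<And>x. norm (DF x) \<le> d * exp (s * (\<Sum>i\<in>I. \<bar>x i\<bar>))" using exp_growthE[OF DF] by metis
  have S: "(\<Sum>i\<in>I. \<bar>(x(k := y)) i\<bar>) = \<bar>y\<bar> + (\<Sum>i\<in>J. \<bar>x i\<bar>)" for x :: "'i \<Rightarrow> real" and y
  proof -
    have "(\<Sum>i\<in>J. \<bar>(x(k := y)) i\<bar>) = (\<Sum>i\<in>J. \<bar>x i\<bar>)" using J by (intro sum.cong) auto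
    thus ?thesis using J by (simp del: fun_upd_apply) simp
  qed
  have in1: "(LINT y|std_normal_distribution. y *\<^sub>R F (x(k := y))) = (LINT y|std_normal_distribution. DF (x(k := y)))" for x
  proof (rule stein_identity[where c="c * exp (r * (\<Sum>i\<in>J. \<bar>x i\<bar>))" and r=r and c'="d * exp (s * (\<Sum>i\<in>J. \<bar>x i\<bar>))" and r'=s])
    show "norm (F (x(k := y))) \<le> c * exp (r * (\<Sum>i\<in>J. \<bar>x i\<bar>)) * exp (r * \<bar>y\<bar>)" for y
      using b(3)[of "x(k := y)"] unfolding S by (simp add: distrib_left exp_add mult_ac)
    show "norm (DF (x(k := y))) \<le> d * exp (s * (\<Sum>i\<in>J. \<bar>x i\<bar>)) * exp (s * \<bar>y\<bar>)" for y
      using b'(3)[of "x(k := y)"] unfolding S by (simp add: distrib_left exp_add mult_ac)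
  qed (use der cont in auto)
  show ?thesis
    unfolding J(3) product_integral_insert[OF J(1,2) i1] product_integral_insert[OF J(1,2) i2]
    using in1 by simp
qed

lemma norm_integral_le:
  fixes f :: "_ \<Rightarrow> 'a::{banach, second_countable_topology}"
  assumes "integrable M g" "\<And>x. norm (f x) \<le> g x"
  shows "norm (LINT x|M. f x) \<le> (LINT x|M. g x)"
proof -
  have "(LINT x|M. norm (f x)) \<le> (LINT x|M. g x)"
    by (intro integral_mono' assms) (auto intro: order_trans[OF norm_ge_zero assms(2)])
  thus ?thesis using integral_norm_bound[of M f] by linarith
qed

text \<open>Differentiation under the integral through |e^{ix} - 1 - ix| \<le> x^2 / 2: the second
  moment of \<open>T\<close> bounds the remainder by a multiple of
  \<open>(s - t)\<^sup>2\<close>.\<close>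

lemma has_vector_derivative_expectation_iexp:
  assumes "prob_space M" and [measurable]: "T \<in> borel_measurable M" and T2: "integrable M (\<lambda>x. (T x)\<^sup>2)"
    and T1: "integrable M T"
  shows "((\<lambda>t. CLINT x|M. iexp (t * T x)) has_vector_derivative (CLINT x|M. \<i> * T x * iexp (t * T x))) (at t)"
proof -
  interpret prob_space M by fact
  let ?\<phi> = "\<lambda>t. CLINT x|M. iexp (t * T x)" and ?D = "CLINT x|M. \<i> * T x * iexp (t * T x)"
  define K where "K = (LINT x|M. (T x)\<^sup>2) / 2"
  have i0: "integrable M (\<lambda>x. iexp (s * T x))" for s by (intro integrable_const_bound[where B=1]) auto
  have i1: "integrable M (\<lambda>x. \<i> * T x * iexp (t * T x))"
    by (rule Bochner_Integration.integrable_bound[OF T1]) (auto simp: norm_mult)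
  have bd: "norm (?\<phi> s - ?\<phi> t - (s - t) *\<^sub>R ?D) \<le> K * (s - t)\<^sup>2" for s
  proof -
    have "?\<phi> s - ?\<phi> t - (s - t) *\<^sub>R ?D =
      (CLINT x|M. iexp (s * T x) - iexp (t * T x) - (s - t) *\<^sub>R (\<i> * T x * iexp (t * T x)))"
      by (simp only: Bochner_Integration.integral_diff Bochner_Integration.integrable_diff i0 i1
            integral_scaleR_right integrable_scaleR_right)
    also have "norm \<dots> \<le> (LINT x|M. ((s - t) * T x)\<^sup>2 / 2)"
    proof (rule norm_integral_le)
      show "norm (iexp (s * T x) - iexp (t * T x) - (s - t) *\<^sub>R (\<i> * T x * iexp (t * T x))) \<le> ((s - t) * T x)\<^sup>2 / 2" for x
      proof -
        have "iexp (s * T x) - iexp (t * T x) - (s - t) *\<^sub>R (\<i> * T x * iexp (t * T x))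
           = iexp (t * T x) * (iexp ((s - t) * T x) - (\<Sum>k\<le>1. (\<i> * ((s - t) * T x)) ^ k / fact k))"
        proof -
          have e: "iexp (s * T x) = iexp (t * T x) * iexp ((s - t) * T x)"
            unfolding exp_add[symmetric] by (intro arg_cong[where f=exp]) (simp add: algebra_simps)
          have "(\<Sum>k\<le>1. (\<i> * ((s - t) * T x)) ^ k / fact k) = 1 + \<i> * ((s - t) * T x)" by simp
          thus ?thesis unfolding e by (simp only: scaleR_conv_of_real of_real_mult) (simp add: ring_distribs)
        qed
        also have "norm \<dots> = norm (iexp ((s - t) * T x) - (\<Sum>k\<le>1. (\<i> * ((s - t) * T x)) ^ k / fact k))"
          by (simp add: norm_mult)
        also have "\<dots> \<le> \<bar>(s - t) * T x\<bar> ^ Suc 1 / fact (Suc 1)" by (rule iexp_approx1)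
        finally show ?thesis by (simp add: power2_eq_square)
      qed
    qed (simp add: T2 power_mult_distrib)
    also have "\<dots> = K * (s - t)\<^sup>2" by (simp add: power_mult_distrib K_def)
    finally show ?thesis .
  qed
  have K: "K \<ge> 0" by (simp add: K_def)
  show ?thesis unfolding has_vector_derivative_def has_derivative_iff_norm
  proof safe
    show "bounded_linear (\<lambda>x. x *\<^sub>R ?D)" by (rule bounded_linear_scaleR_left)
    show "((\<lambda>y. norm (?\<phi> y - ?\<phi> t - (y - t) *\<^sub>R ?D) / norm (y - t)) \<longlongrightarrow> 0) (at t)"
    proof (rule Lim_null_comparison)
      show "\<forall>\<^sub>F y in at t. norm (norm (?\<phi> y - ?\<phi> t - (y - t) *\<^sub>R ?D) / norm (y - t)) \<le> K * \<bar>y - t\<bar>"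
      proof (intro always_eventually allI)
        fix y
        show "norm (norm (?\<phi> y - ?\<phi> t - (y - t) *\<^sub>R ?D) / norm (y - t)) \<le> K * \<bar>y - t\<bar>"
        proof (cases "y = t")
          case False
          have "norm (?\<phi> y - ?\<phi> t - (y - t) *\<^sub>R ?D) \<le> (K * \<bar>y - t\<bar>) * \<bar>y - t\<bar>"
            using bd[of y] by (simp add: mult.assoc power2_eq_square flip: abs_mult)
          thus ?thesis using False by (simp add: divide_le_eq)
        qed simp
      qed
      show "((\<lambda>y. K * \<bar>y - t\<bar>) \<longlongrightarrow> 0) (at t)"
        by (auto intro!: tendsto_eq_intros)
    qed
  qed
qed

section \<open>Quadratic forms of Gaussian vectors\<close>

lemma expectation_abs_le_sqrt:
  fixes X :: "'a \<Rightarrow> real"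
  assumes "prob_space M" "integrable M X" "integrable M (\<lambda>x. (X x)\<^sup>2)"
  shows "(LINT x|M. \<bar>X x\<bar>) \<le> sqrt (LINT x|M. (X x)\<^sup>2)"
proof -
  interpret prob_space M by fact
  have "0 \<le> (LINT x|M. (\<bar>X x\<bar> - (LINT x|M. \<bar>X x\<bar>))\<^sup>2)" by simp
  also have "\<dots> = (LINT x|M. (X x)\<^sup>2) - (LINT x|M. \<bar>X x\<bar>)\<^sup>2"
    using assms by (simp add: variance_eq)
  finally show ?thesis by (intro real_le_rsqrt) simp
qed

lemmas exp_growth_intros = exp_growth_const exp_growth_component exp_growth_sum exp_growth_add exp_growth_diff
  exp_growth_mult exp_growth_power exp_growth_abs exp_growth_iexp exp_growth_complex_of_real exp_growth_scaleR

lemma sum_scaleR_delta: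
  fixes A :: "'a::real_vector"
  assumes "finite J" "j \<in> J"
  shows "(\<Sum>j'\<in>J. f j' *\<^sub>R (if j' = j then A else 0)) = f j *\<^sub>R A"
proof -
  have "(\<Sum>j'\<in>J. f j' *\<^sub>R (if j' = j then A else 0)) = (\<Sum>j'\<in>J. if j' = j then f j *\<^sub>R A else 0)"
    by (intro sum.cong) auto
  thus ?thesis using assms by simp
qed

section \<open>Gaussian vectors as linear images of independent standard normals\<close>

text \<open>The vector \<open>Z\<close> has covariance \<open>C\<close>, the product of
  \<open>L\<close> and its transpose. Fixing a factor \<open>L\<close> lets Stein's identity be
  applied in the independent coordinates \<open>y\<close> and then restated for \<open>Z\<close>.
  The factor will be the identity matrix in one instance and the autoregressive factor in the
  other.\<close>

locale gauss_vector =
  fixes I :: "'i set" and J :: "'j set" and L :: "'j \<Rightarrow> 'i \<Rightarrow> real"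
  assumes fin: "finite I" "finite J"
begin

definition Z :: "'j \<Rightarrow> ('i \<Rightarrow> real) \<Rightarrow> real" where "Z j y = (\<Sum>k\<in>I. L j k * y k)"
definition C :: "'j \<Rightarrow> 'j \<Rightarrow> real" where "C j j' = (\<Sum>k\<in>I. L j k * L j' k)"

abbreviation P where "P \<equiv> std_gauss I"

lemma C_commute: "C j j' = C j' j"
  by (simp add: C_def mult.commute)

lemma Z_derivative[derivative_intros]:
  assumes "k \<in> I"
  shows "((\<lambda>s. Z j (x(k := s))) has_real_derivative L j k) (at s within S)"
proof -
  have "((\<lambda>s. \<Sum>i\<in>I. L j i * (x(k := s)) i) has_real_derivative (\<Sum>i\<in>I. if i = k then L j k else 0)) (at s within S)"
    by (intro DERIV_sum) (auto intro!: derivative_eq_intros)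
  thus ?thesis using assms fin by (simp add: Z_def del: fun_upd_apply)
qed

lemma Z_isCont[continuous_intros]: "isCont (\<lambda>s. Z j (x(k := s))) s"
proof -
  have "isCont (\<lambda>s. (x(k := s)) i) s" for i by (cases "i = k") auto
  thus ?thesis unfolding Z_def by (intro continuous_intros)
qed

lemma Z_exp_growth[intro]: "exp_growth I (Z j)"
  unfolding Z_def by (intro exp_growth_intros fin)

lemmas growth = exp_growth_intros Z_exp_growth

lemma Z_measurable[measurable]: "Z j \<in> borel_measurable P"
  using Z_exp_growth by (rule exp_growth_measurable)

text \<open>\<open>D j'\<close> plays the partial derivative of \<open>F\<close> in
  \<open>Z j'\<close>, and \<open>der\<close> is the chain rule. Summing the coordinate identities
  against \<open>L j k\<close> contracts the two factors \<open>L\<close> to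
  \<open>C\<close>.\<close>

lemma stein_identity_Z:
  fixes F :: "('i \<Rightarrow> real) \<Rightarrow> 'a::euclidean_space"
  assumes F: "exp_growth I F" and D: "\<And>j'. j' \<in> J \<Longrightarrow> exp_growth I (D j')"
    and der: "\<And>x s k. k \<in> I \<Longrightarrow>
       ((\<lambda>s. F (x(k := s))) has_vector_derivative (\<Sum>j'\<in>J. L j' k *\<^sub>R D j' (x(k := s)))) (at s)"
    and cont: "\<And>x s k j'. k \<in> I \<Longrightarrow> j' \<in> J \<Longrightarrow> isCont (\<lambda>s. D j' (x(k := s))) s"
  shows "(LINT x|P. Z j x *\<^sub>R F x) = (\<Sum>j'\<in>J. C j j' *\<^sub>R (LINT x|P. D j' x))"
proof -
  have iD: "integrable P (D j')" if "j' \<in> J" for j' using exp_growth_integrable fin D that by blast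
  have iF: "integrable P (\<lambda>x. x k *\<^sub>R F x)" if "k \<in> I" for k
    using that fin F by (intro exp_growth_integrable) auto
  have "(LINT x|P. Z j x *\<^sub>R F x) = (LINT x|P. (\<Sum>k\<in>I. L j k *\<^sub>R (x k *\<^sub>R F x)))"
    by (simp add: Z_def scaleR_sum_left)
  also have "\<dots> = (\<Sum>k\<in>I. L j k *\<^sub>R (LINT x|P. x k *\<^sub>R F x))"
    by (subst Bochner_Integration.integral_sum) (auto intro!: iF sum.cong simp del: scaleR_scaleR)
  also have "\<dots> = (\<Sum>k\<in>I. L j k *\<^sub>R (\<Sum>j'\<in>J. L j' k *\<^sub>R (LINT x|P. D j' x)))"
  proof (intro sum.cong refl)
    fix k assume k: "k \<in> I"
    have "(LINT x|P. x k *\<^sub>R F x) = (LINT x|P. (\<Sum>j'\<in>J. L j' k *\<^sub>R D j' x))"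
      using k fin F D der cont
      by (intro stein_identity_component) (auto intro!: continuous_intros exp_growth_intros)
    also have "\<dots> = (\<Sum>j'\<in>J. L j' k *\<^sub>R (LINT x|P. D j' x))"
      using iD by (subst Bochner_Integration.integral_sum) auto
    finally show "L j k *\<^sub>R (LINT x|P. x k *\<^sub>R F x) = L j k *\<^sub>R (\<Sum>j'\<in>J. L j' k *\<^sub>R (LINT x|P. D j' x))" by simp
  qed
  also have "\<dots> = (\<Sum>j'\<in>J. C j j' *\<^sub>R (LINT x|P. D j' x))"
    unfolding C_def scaleR_sum_left scaleR_sum_right by (subst sum.swap) simp
  finally show ?thesis .
qed

lemma expectation_ZZ:
  assumes "j' \<in> J" shows "(LINT x|P. Z j x * Z j' x) = C j j'"
proof -
  interpret prob_space P by (rule prob_space_std_gauss)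
  have eq: "(\<Sum>i\<in>J. L i k * (if i = j' then 1 else 0)) = L j' k" for k
    using assms fin by (simp add: if_distrib[of "\<lambda>x. _ * x"] cong: if_cong)
  have "(LINT x|P. Z j x *\<^sub>R Z j' x) = (\<Sum>i\<in>J. C j i *\<^sub>R (LINT x|P. (if i = j' then 1 else 0)))"
  proof (rule stein_identity_Z)
    fix k x s assume "k \<in> I"
    thus "((\<lambda>s. Z j' (x(k := s))) has_vector_derivative (\<Sum>i\<in>J. L i k *\<^sub>R (if i = j' then 1 else 0))) (at s)"
      unfolding real_scaleR_def eq has_real_derivative_iff_has_vector_derivative[symmetric]
      by (rule Z_derivative)
  qed auto
  also have "\<dots> = C j j'" using assms fin by (simp add: prob_space if_distrib[of "\<lambda>x. _ * x"] cong: if_cong)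
  finally show ?thesis by simp
qed

lemma expectation_linear_sq:
  "(LINT x|P. (\<Sum>j\<in>J. e j * Z j x)\<^sup>2) = (\<Sum>j\<in>J. \<Sum>j'\<in>J. e j * e j' * C j j')"
proof -
  have int: "integrable P (\<lambda>x. e j * e j' * (Z j x * Z j' x))" for j j'
    by (intro exp_growth_integrable fin growth)
  have "(LINT x|P. (\<Sum>j\<in>J. e j * Z j x)\<^sup>2) = (LINT x|P. (\<Sum>j\<in>J. \<Sum>j'\<in>J. e j * e j' * (Z j x * Z j' x)))"
    unfolding power2_eq_square sum_product by (simp add: mult_ac)
  also have "\<dots> = (\<Sum>j\<in>J. \<Sum>j'\<in>J. e j * e j' * (LINT x|P. Z j x * Z j' x))"
    using int by (simp add: Bochner_Integration.integral_sum)
  finally show ?thesis by (simp add: expectation_ZZ)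
qed

section \<open>Variance of centred quadratic forms\<close>

definition quad :: "('j \<Rightarrow> 'j \<Rightarrow> real) \<Rightarrow> ('i \<Rightarrow> real) \<Rightarrow> real" where
  "quad B y = (\<Sum>j\<in>J. \<Sum>j'\<in>J. B j j' * (Z j y * Z j' y - C j j'))"

lemma quad_exp_growth[intro]: "exp_growth I (quad B)"
  unfolding quad_def by (intro growth)

lemma expectation_quad: "(LINT x|P. quad B x) = 0"
proof -
  interpret prob_space P by (rule prob_space_std_gauss)
  have int: "integrable P (\<lambda>x. Z j x * Z j' x)" for j j'
    by (intro exp_growth_integrable fin growth)
  show ?thesis unfolding quad_def
    using int by (simp add: Bochner_Integration.integral_sum expectation_ZZ prob_space)
qed

lemma quad_derivative:
  assumes "k \<in> I" and B: "\<And>i j. B i j = B j i"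
  shows "((\<lambda>s. quad B (x(k := s))) has_real_derivative (\<Sum>j\<in>J. L j k * (2 * (\<Sum>j'\<in>J. B j j' * Z j' (x(k := s)))))) (at s)"
proof -
  have "((\<lambda>s. quad B (x(k := s))) has_real_derivative
     (\<Sum>j\<in>J. \<Sum>j'\<in>J. B j j' * (L j k * Z j' (x(k := s)) + L j' k * Z j (x(k := s))))) (at s)"
    unfolding quad_def using assms(1) by (auto intro!: derivative_eq_intros DERIV_sum)
  also have "(\<Sum>j\<in>J. \<Sum>j'\<in>J. B j j' * (L j k * Z j' (x(k := s)) + L j' k * Z j (x(k := s))))
    = (\<Sum>j\<in>J. \<Sum>j'\<in>J. B j j' * (L j k * Z j' (x(k := s)))) + (\<Sum>j\<in>J. \<Sum>j'\<in>J. B j j' * (L j' k * Z j (x(k := s))))"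
    by (simp add: distrib_left sum.distrib)
  also have "(\<Sum>j\<in>J. \<Sum>j'\<in>J. B j j' * (L j' k * Z j (x(k := s)))) = (\<Sum>j\<in>J. \<Sum>j'\<in>J. B j j' * (L j k * Z j' (x(k := s))))"
    by (subst sum.swap) (subst B, simp)
  also have "(\<Sum>j\<in>J. \<Sum>j'\<in>J. B j j' * (L j k * Z j' (x(k := s)))) + (\<Sum>j\<in>J. \<Sum>j'\<in>J. B j j' * (L j k * Z j' (x(k := s))))
     = (\<Sum>j\<in>J. L j k * (2 * (\<Sum>j'\<in>J. B j j' * Z j' (x(k := s)))))"
    by (simp add: sum_distrib_left sum.distrib[symmetric] mult_ac)
  finally show ?thesis .
qed

lemma quad_isCont[continuous_intros]: "isCont (\<lambda>s. quad B (x(k := s))) s"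
  unfolding quad_def by (intro continuous_intros)

text \<open>With W = B Z, \<open>quad B\<close> is the sum of the \<open>Z j * W j\<close> minus a
  constant, and Stein's identity applies to \<open>Z j\<close> times \<open>W j * quad B\<close>.
  The derivative in \<open>Z j'\<close> is \<open>B j j' * quad B + 2 * W j * W j'\<close>; its
  first term has mean zero, and the second yields the value, which is 2 tr(B C B C).\<close>

lemma expectation_quad_sq:
  assumes B: "\<And>i j. B i j = B j i"
  shows "(LINT x|P. (quad B x)\<^sup>2) =
     2 * (\<Sum>j\<in>J. \<Sum>j'\<in>J. C j j' * (\<Sum>i\<in>J. \<Sum>i'\<in>J. B j i * B j' i' * C i i'))"
proof -
  define W where "W j y = (\<Sum>j'\<in>J. B j j' * Z j' y)" for j y
  have Wg[intro]: "exp_growth I (W j)" for j unfolding W_def by (intro growth)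
  have Wc[continuous_intros]: "isCont (\<lambda>s. W j (x(k := s))) s" for j k x s
    unfolding W_def by (intro continuous_intros)
  have Wd: "((\<lambda>s. W j (x(k := s))) has_real_derivative (\<Sum>j'\<in>J. B j j' * L j' k)) (at s)" if "k \<in> I" for j k x s
    unfolding W_def using that by (auto intro!: derivative_eq_intros DERIV_sum)
  have int: "integrable P f" if "exp_growth I f" for f :: "_ \<Rightarrow> real" using exp_growth_integrable fin that by blast
  have one: "(LINT x|P. Z j x *\<^sub>R (W j x * quad B x)) = (\<Sum>j'\<in>J. C j j' *\<^sub>R (LINT x|P. B j j' * quad B x + W j x * (2 * W j' x)))" for j
  proof (rule stein_identity_Z)
    fix k x s assume k: "k \<in> I"
    have "((\<lambda>s. W j (x(k := s)) * quad B (x(k := s))) has_real_derivative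
       (\<Sum>j'\<in>J. B j j' * L j' k) * quad B (x(k := s)) + W j (x(k := s)) * (\<Sum>j\<in>J. L j k * (2 * W j (x(k := s))))) (at s)"
      unfolding W_def[symmetric] using DERIV_mult[OF Wd[OF k] quad_derivative[where B=B, OF k B]]
      by (simp add: W_def[symmetric] mult_ac add_ac)
    thus "((\<lambda>s. W j (x(k := s)) * quad B (x(k := s))) has_vector_derivative
       (\<Sum>j'\<in>J. L j' k *\<^sub>R (B j j' * quad B (x(k := s)) + W j (x(k := s)) * (2 * W j' (x(k := s)))))) (at s)"
      unfolding has_real_derivative_iff_has_vector_derivative
      by (simp add: sum_distrib_left sum_distrib_right sum.distrib[symmetric] algebra_simps del: fun_upd_apply)
  qed (auto intro!: continuous_intros growth quad_exp_growth Wg simp del: fun_upd_apply)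
  have WW: "(LINT x|P. W j x * W j' x) = (\<Sum>i\<in>J. \<Sum>i'\<in>J. B j i * B j' i' * C i i')" for j j'
  proof -
    have i: "integrable P (\<lambda>x. B j i * B j' i' * (Z i x * Z i' x))" for i i' by (intro int growth)
    have "(LINT x|P. W j x * W j' x) = (LINT x|P. (\<Sum>i\<in>J. \<Sum>i'\<in>J. B j i * B j' i' * (Z i x * Z i' x)))"
      unfolding W_def sum_product by (simp add: mult_ac)
    thus ?thesis using i by (simp add: Bochner_Integration.integral_sum expectation_ZZ)
  qed
  have two: "(LINT x|P. B j j' * quad B x + W j x * (2 * W j' x)) = 2 * (\<Sum>i\<in>J. \<Sum>i'\<in>J. B j i * B j' i' * C i i')" for j j'
  proof -
    have "integrable P (\<lambda>x. B j j' * quad B x)" "integrable P (\<lambda>x. 2 * (W j x * W j' x))"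
      by (intro int growth quad_exp_growth Wg)+
    hence "(LINT x|P. B j j' * quad B x + 2 * (W j x * W j' x)) = B j j' * (LINT x|P. quad B x) + 2 * (LINT x|P. W j x * W j' x)"
      by simp
    moreover have "W j x * (2 * W j' x) = 2 * (W j x * W j' x)" for x by simp
    ultimately show ?thesis by (simp only: expectation_quad WW mult_zero_right add_0)
  qed
  define c where "c = (\<Sum>j\<in>J. \<Sum>j'\<in>J. B j j' * C j j')"
  have q: "quad B x = (\<Sum>j\<in>J. Z j x * W j x) - c" for x
    unfolding quad_def W_def c_def by (simp add: right_diff_distrib sum_subtractf sum_distrib_left mult_ac)
  have "(LINT x|P. (quad B x)\<^sup>2) = (LINT x|P. (\<Sum>j\<in>J. Z j x * (W j x * quad B x)) - c * quad B x)"
  proof (intro Bochner_Integration.integral_cong refl)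
    fix x
    have "(quad B x)\<^sup>2 = ((\<Sum>j\<in>J. Z j x * W j x) - c) * quad B x" unfolding power2_eq_square q[symmetric] ..
    thus "(quad B x)\<^sup>2 = (\<Sum>j\<in>J. Z j x * (W j x * quad B x)) - c * quad B x"
      by (simp add: left_diff_distrib sum_distrib_right mult.assoc)
  qed
  also have "\<dots> = (\<Sum>j\<in>J. LINT x|P. Z j x * (W j x * quad B x)) - c * (LINT x|P. quad B x)"
  proof -
    have "integrable P (\<lambda>x. Z j x * (W j x * quad B x))" for j by (intro int growth quad_exp_growth Wg)
    moreover have "integrable P (quad B)" by (intro int quad_exp_growth)
    ultimately show ?thesis by (simp add: Bochner_Integration.integral_sum)
  qed
  also have "\<dots> = 2 * (\<Sum>j\<in>J. \<Sum>j'\<in>J. C j j' * (\<Sum>i\<in>J. \<Sum>i'\<in>J. B j i * B j' i' * C i i'))"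
    using one unfolding real_scaleR_def two by (simp add: expectation_quad sum_distrib_left mult.left_commute)
  finally show ?thesis .
qed

section \<open>Characteristic function of a squared norm plus a linear term\<close>

definition form :: "real \<Rightarrow> ('j \<Rightarrow> real) \<Rightarrow> ('i \<Rightarrow> real) \<Rightarrow> real" where
  "form a d y = a * ((\<Sum>j\<in>J. (Z j y)\<^sup>2) - (\<Sum>j\<in>J. C j j)) + (\<Sum>j\<in>J. d j * Z j y)"

lemma form_exp_growth[intro]: "exp_growth I (form a d)"
  unfolding form_def by (intro growth)

lemma form_derivative:
  assumes "k \<in> I"
  shows "((\<lambda>s. form a d (x(k := s))) has_real_derivative (\<Sum>j\<in>J. L j k * (2 * a * Z j (x(k := s)) + d j))) (at s)"
proof -
  have "((\<lambda>s. form a d (x(k := s))) has_real_derivative a * (\<Sum>j\<in>J. 2 * Z j (x(k := s)) * L j k) + (\<Sum>j\<in>J. d j * L j k)) (at s)"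
    unfolding form_def using assms by (auto intro!: derivative_eq_intros DERIV_sum simp: mult_ac)
  also have "a * (\<Sum>j\<in>J. 2 * Z j (x(k := s)) * L j k) + (\<Sum>j\<in>J. d j * L j k) =
      (\<Sum>j\<in>J. L j k * (2 * a * Z j (x(k := s)) + d j))"
    unfolding sum_distrib_left sum.distrib[symmetric]
    by (intro sum.cong refl) (simp add: algebra_simps del: fun_upd_apply)
  finally show ?thesis .
qed

lemma form_isCont[continuous_intros]: "isCont (\<lambda>s. form a d (x(k := s))) s"
  unfolding form_def by (intro continuous_intros)

text \<open>The random variable \<open>H\<close> of the introduction, for the quadratic form \<open>form a d\<close>.\<close>

definition energy :: "real \<Rightarrow> ('j \<Rightarrow> real) \<Rightarrow> ('i \<Rightarrow> real) \<Rightarrow> real" where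
  "energy a d y = (\<Sum>j\<in>J. \<Sum>j'\<in>J. C j j' * ((a * Z j y + d j) * (2 * a * Z j' y + d j')))"

lemma energy_exp_growth[intro]: "exp_growth I (energy a d)"
  unfolding energy_def by (intro growth)

text \<open>\<open>form\<close> is the sum of the terms
  \<open>Z j * (a * Z j + d j) - a * C j j\<close>. In Stein's identity for \<open>Z j\<close>,
  differentiating the factor \<open>a * Z j + d j\<close> gives \<open>a * C j j\<close> times the
  exponential and cancels the centring; differentiating the exponential gives \<i> t times the
  summands of \<open>energy\<close>.\<close>

lemma expectation_form_iexp:
  "(CLINT x|P. form a d x * iexp (t * form a d x)) = \<i> * t * (CLINT x|P. energy a d x * iexp (t * form a d x))"
proof -
  interpret prob_space P by (rule prob_space_std_gauss)
  let ?T = "form a d"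
  have [measurable]: "?T \<in> borel_measurable P" by (rule exp_growth_measurable) auto
  define e where "e x = iexp (t * ?T x)" for x
  have e_growth[intro]: "exp_growth I e" unfolding e_def by (intro exp_growth_iexp) simp
  have ec: "isCont (\<lambda>s. e (x(k := s))) s" for x k s unfolding e_def by (intro continuous_intros)
  have ed: "((\<lambda>s. e (x(k := s))) has_vector_derivative
      (\<i> * t * of_real (\<Sum>j\<in>J. L j k * (2 * a * Z j (x(k := s)) + d j))) * e (x(k := s))) (at s)" if "k \<in> I" for x k s
  proof -
    have "((\<lambda>s. t * ?T (x(k := s))) has_vector_derivative t * (\<Sum>j\<in>J. L j k * (2 * a * Z j (x(k := s)) + d j))) (at s)"
      unfolding has_real_derivative_iff_has_vector_derivative[symmetric]
      by (intro DERIV_cmult form_derivative that)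
    from vector_diff_chain_at[OF this has_vector_derivative_iexp]
    show ?thesis unfolding e_def comp_def by (simp add: scaleR_conv_of_real mult_ac)
  qed
  have int: "integrable P f" if "exp_growth I f" for f :: "_ \<Rightarrow> complex" using exp_growth_integrable fin that by blast
  define D where "D j j' x = (if j' = j then of_real a * e x else 0) +
      \<i> * t * of_real ((a * Z j x + d j) * (2 * a * Z j' x + d j')) * e x" for j j' x
  have Dg[intro]: "exp_growth I (D j j')" for j j' unfolding D_def
    by (cases "j' = j") (simp_all only: if_True if_False simp_thms, (intro growth e_growth)+)
  have one: "(CLINT x|P. Z j x *\<^sub>R ((a * Z j x + d j) *\<^sub>R e x)) = (\<Sum>j'\<in>J. C j j' *\<^sub>R (CLINT x|P. D j j' x))" if j: "j \<in> J" for j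
  proof (rule stein_identity_Z)
    fix k :: 'i and x :: "'i \<Rightarrow> real" and s :: real assume k: "k \<in> I"
    let ?x = "x(k := s)"
    have 1: "((\<lambda>s. a * Z j (x(k := s)) + d j) has_real_derivative a * L j k) (at s)"
      using k by (auto intro!: derivative_eq_intros)
    have "((\<lambda>s. (a * Z j (x(k := s)) + d j) *\<^sub>R e (x(k := s))) has_vector_derivative
       (a * Z j ?x + d j) *\<^sub>R ((\<i> * t * of_real (\<Sum>j\<in>J. L j k * (2 * a * Z j ?x + d j))) * e ?x) + (a * L j k) *\<^sub>R e ?x) (at s)"
      by (rule has_vector_derivative_scaleR[OF 1 ed[OF k]])
    also have "(a * Z j ?x + d j) *\<^sub>R ((\<i> * t * of_real (\<Sum>j\<in>J. L j k * (2 * a * Z j ?x + d j))) * e ?x) + (a * L j k) *\<^sub>R e ?x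
      = (\<Sum>j'\<in>J. L j' k *\<^sub>R D j j' ?x)"
    proof -
      have "(\<Sum>j'\<in>J. L j' k *\<^sub>R D j j' ?x) = (\<Sum>j'\<in>J. L j' k *\<^sub>R (if j' = j then of_real a * e ?x else 0)) +
         (\<Sum>j'\<in>J. L j' k *\<^sub>R (\<i> * t * of_real ((a * Z j ?x + d j) * (2 * a * Z j' ?x + d j')) * e ?x))"
        unfolding D_def by (simp add: scaleR_add_right sum.distrib del: fun_upd_apply)
      also have "(\<Sum>j'\<in>J. L j' k *\<^sub>R (if j' = j then of_real a * e ?x else 0)) = (a * L j k) *\<^sub>R e ?x"
        unfolding sum_scaleR_delta[OF fin(2) j] by (simp add: scaleR_conv_of_real mult_ac del: fun_upd_apply)
      also have "(\<Sum>j'\<in>J. L j' k *\<^sub>R (\<i> * t * of_real ((a * Z j ?x + d j) * (2 * a * Z j' ?x + d j')) * e ?x))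
        = (a * Z j ?x + d j) *\<^sub>R ((\<i> * t * of_real (\<Sum>j\<in>J. L j k * (2 * a * Z j ?x + d j))) * e ?x)"
        by (simp add: sum_distrib_left sum_distrib_right scaleR_conv_of_real mult_ac del: fun_upd_apply of_real_add)
      finally show ?thesis by (simp only: add.commute)
    qed
    finally show "((\<lambda>s. (a * Z j (x(k := s)) + d j) *\<^sub>R e (x(k := s))) has_vector_derivative (\<Sum>j'\<in>J. L j' k *\<^sub>R D j j' ?x)) (at s)" .
  next
    show "isCont (\<lambda>s. D j j' (x(k := s))) s" for j' k x s
      unfolding D_def by (cases "j' = j") (auto intro!: continuous_intros ec simp del: fun_upd_apply)
  qed (auto intro!: growth e_growth)
  define E where "E = (CLINT x|P. e x)"
  define H where "H j j' = (CLINT x|P. of_real ((a * Z j x + d j) * (2 * a * Z j' x + d j')) * e x)" for j j'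
  have two: "(CLINT x|P. D j j' x) = (if j' = j then of_real a * E else 0) + \<i> * t * H j j'" for j j'
  proof -
    have i1: "integrable P e" "integrable P (\<lambda>x. of_real ((a * Z j x + d j) * (2 * a * Z j' x + d j')) * e x)"
      by (intro int growth e_growth)+
    have i2: "integrable P (\<lambda>x. (if j' = j then of_real a * e x else 0))"
      using i1(1) by (cases "j' = j") (simp_all only: if_True if_False refl integrable_mult_right integrable_zero simp_thms)
    have i3: "integrable P (\<lambda>x. \<i> * t * (of_real ((a * Z j x + d j) * (2 * a * Z j' x + d j')) * e x))"
      by (rule integrable_mult_right[OF i1(2)])
    have "(CLINT x|P. D j j' x) = (CLINT x|P. (if j' = j then of_real a * e x else 0)) +
        (CLINT x|P. \<i> * t * (of_real ((a * Z j x + d j) * (2 * a * Z j' x + d j')) * e x))"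
      unfolding D_def mult.assoc using Bochner_Integration.integral_add[OF i2 i3] by (simp only: mult.assoc)
    thus ?thesis unfolding H_def E_def by (cases "j' = j") (simp_all only: integral_mult_right_zero if_True if_False simp_thms, simp_all)
  qed
  have "(CLINT x|P. form a d x * e x) = (CLINT x|P. (\<Sum>j\<in>J. Z j x *\<^sub>R ((a * Z j x + d j) *\<^sub>R e x) - of_real (a * C j j) * e x))"
  proof (intro Bochner_Integration.integral_cong refl)
    fix x
    have "form a d x = (\<Sum>j\<in>J. Z j x * (a * Z j x + d j) - a * C j j)"
      unfolding form_def by (simp add: sum_distrib_left sum.distrib sum_subtractf algebra_simps power2_eq_square)
    thus "of_real (form a d x) * e x = (\<Sum>j\<in>J. Z j x *\<^sub>R ((a * Z j x + d j) *\<^sub>R e x) - of_real (a * C j j) * e x)"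
      by (simp add: sum_distrib_right scaleR_conv_of_real left_diff_distrib mult.assoc)
  qed
  also have "\<dots> = (\<Sum>j\<in>J. (CLINT x|P. Z j x *\<^sub>R ((a * Z j x + d j) *\<^sub>R e x)) - of_real (a * C j j) * E)"
  proof -
    have "integrable P (\<lambda>x. Z j x *\<^sub>R ((a * Z j x + d j) *\<^sub>R e x))" "integrable P (\<lambda>x. of_real (a * C j j) * e x)" for j
      by (intro int growth e_growth)+
    thus ?thesis unfolding E_def
      by (simp add: Bochner_Integration.integral_sum del: of_real_mult)
  qed
  also have "\<dots> = (\<Sum>j\<in>J. (\<Sum>j'\<in>J. C j j' *\<^sub>R ((if j' = j then of_real a * E else 0) + \<i> * t * H j j')) - of_real (a * C j j) * E)"
    using one by (intro sum.cong refl) (simp add: two)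
  also have "\<dots> = (\<Sum>j\<in>J. \<Sum>j'\<in>J. C j j' *\<^sub>R (\<i> * t * H j j'))"
  proof (intro sum.cong refl)
    fix j assume "j \<in> J"
    have "(\<Sum>j'\<in>J. C j j' *\<^sub>R (if j' = j then of_real a * E else 0)) = of_real (a * C j j) * E"
      unfolding sum_scaleR_delta[OF fin(2) \<open>j \<in> J\<close>] by (simp add: scaleR_conv_of_real mult_ac)
    thus "(\<Sum>j'\<in>J. C j j' *\<^sub>R ((if j' = j then of_real a * E else 0) + \<i> * t * H j j')) - of_real (a * C j j) * E
       = (\<Sum>j'\<in>J. C j j' *\<^sub>R (\<i> * t * H j j'))"
      by (simp add: scaleR_add_right sum.distrib)
  qed
  also have "\<dots> = \<i> * t * (\<Sum>j\<in>J. \<Sum>j'\<in>J. of_real (C j j') * H j j')"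
    by (simp add: sum_distrib_left scaleR_conv_of_real mult_ac)
  also have "(\<Sum>j\<in>J. \<Sum>j'\<in>J. of_real (C j j') * H j j') = (CLINT x|P. energy a d x * e x)"
  proof -
    have i: "integrable P (\<lambda>x. of_real (C j j') * (of_real ((a * Z j x + d j) * (2 * a * Z j' x + d j')) * e x))" for j j'
      by (intro int growth e_growth)
    have "(CLINT x|P. energy a d x * e x) = (CLINT x|P. (\<Sum>j\<in>J. \<Sum>j'\<in>J. of_real (C j j') * (of_real ((a * Z j x + d j) * (2 * a * Z j' x + d j')) * e x)))"
      unfolding energy_def by (simp only: of_real_sum of_real_mult[of "C _ _"] sum_distrib_right mult.assoc)
    also have "\<dots> = (\<Sum>j\<in>J. \<Sum>j'\<in>J. (CLINT x|P. of_real (C j j') * (of_real ((a * Z j x + d j) * (2 * a * Z j' x + d j')) * e x)))"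
      using i by (simp only: Bochner_Integration.integral_sum Bochner_Integration.integrable_sum)
    also have "\<dots> = (\<Sum>j\<in>J. \<Sum>j'\<in>J. of_real (C j j') * H j j')"
      unfolding H_def by (simp only: integral_mult_right_zero)
    finally show ?thesis ..
  qed
  finally show ?thesis unfolding e_def .
qed

text \<open>The integrating factor \<open>exp (v * t\<^sup>2 / 2)\<close> removes the drift: the
  product with \<phi> has derivative at most
  \<open>exp (v * s\<^sup>2 / 2) * (\<bar>s\<bar> * \<delta>)\<close>, which on the segment from
  \<open>0\<close> to \<open>t\<close> is largest at \<open>t\<close>. Undoing the factor cancels
  this exponential, so none survives in the bound.\<close>

lemma char_form_bound:
  assumes v: "v \<ge> 0"
  shows "norm ((CLINT x|P. iexp (t * form a d x)) - exp (- v * t\<^sup>2 / 2)) \<le> t\<^sup>2 * (LINT x|P. \<bar>energy a d x - v\<bar>)"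
proof -
  interpret prob_space P by (rule prob_space_std_gauss)
  let ?T = "form a d"
  have [measurable]: "?T \<in> borel_measurable P" by (rule exp_growth_measurable) auto
  have [measurable]: "energy a d \<in> borel_measurable P" by (rule exp_growth_measurable) auto
  have int: "integrable P f" if "exp_growth I f" for f :: "_ \<Rightarrow> real" using exp_growth_integrable fin that by blast
  have intc: "integrable P f" if "exp_growth I f" for f :: "_ \<Rightarrow> complex" using exp_growth_integrable fin that by blast
  define \<delta> where "\<delta> = (LINT x|P. \<bar>energy a d x - v\<bar>)"
  have \<delta>0: "\<delta> \<ge> 0" unfolding \<delta>_def by simp
  define \<phi> where "\<phi> t = (CLINT x|P. iexp (t * ?T x))" for t
  define \<phi>' where "\<phi>' t = - t * (CLINT x|P. energy a d x * iexp (t * ?T x))" for t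
  have der: "(\<phi> has_vector_derivative \<phi>' t) (at t within S)" for t S
  proof -
    have "(\<phi> has_vector_derivative (CLINT x|P. \<i> * ?T x * iexp (t * ?T x))) (at t)"
      unfolding \<phi>_def by (intro has_vector_derivative_expectation_iexp prob_space_std_gauss int growth form_exp_growth) simp
    also have "(CLINT x|P. \<i> * ?T x * iexp (t * ?T x)) = \<i> * (CLINT x|P. ?T x * iexp (t * ?T x))"
      by (simp only: mult.assoc integral_mult_right_zero)
    also have "\<dots> = \<phi>' t" unfolding expectation_form_iexp \<phi>'_def by (simp add: mult.assoc[symmetric])
    finally show ?thesis by (rule has_vector_derivative_at_within)
  qed
  have bd: "norm (\<phi>' s + v * s * \<phi> s) \<le> \<bar>s\<bar> * \<delta>" for s
  proof -
    have i: "integrable P (\<lambda>x. energy a d x * iexp (s * ?T x))" "integrable P (\<lambda>x. of_real v * iexp (s * ?T x))"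
      by (intro intc growth form_exp_growth energy_exp_growth; simp)+
    have "\<phi>' s + v * s * \<phi> s = - s * ((CLINT x|P. energy a d x * iexp (s * ?T x)) - (CLINT x|P. of_real v * iexp (s * ?T x)))"
      unfolding \<phi>_def \<phi>'_def by (simp add: algebra_simps)
    also have "\<dots> = - s * (CLINT x|P. of_real (energy a d x - v) * iexp (s * ?T x))"
      using Bochner_Integration.integral_diff[OF i] by (simp only: left_diff_distrib[symmetric] of_real_diff)
    also have "norm \<dots> \<le> \<bar>s\<bar> * \<delta>"
    proof -
      have "norm (CLINT x|P. of_real (energy a d x - v) * iexp (s * ?T x)) \<le> \<delta>"
        unfolding \<delta>_def by (intro norm_integral_le int growth energy_exp_growth) (auto simp: norm_mult simp del: of_real_diff)
      thus ?thesis by (simp add: norm_mult mult_left_mono)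
    qed
    finally show ?thesis .
  qed
  define \<psi>' where "\<psi>' s = exp (v * s\<^sup>2 / 2) *\<^sub>R (\<phi>' s + v * s * \<phi> s)" for s
  \<comment> \<open>The mean value bound subtracts a linear term at \<open>0\<close>, which is
    harmless because \<open>\<psi>' 0 = 0\<close>.\<close>
  have "norm (exp (v * t\<^sup>2 / 2) *\<^sub>R \<phi> t - exp (v * 0\<^sup>2 / 2) *\<^sub>R \<phi> 0 - (t - 0) *\<^sub>R \<psi>' 0)
     \<le> norm (t - 0) * (exp (v * t\<^sup>2 / 2) * (\<bar>t\<bar> * \<delta>))"
  proof (rule vector_differentiable_bound_linearization[where S="closed_segment 0 t" and f="\<lambda>s. exp (v * s\<^sup>2 / 2) *\<^sub>R \<phi> s" and f'=\<psi>'])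
    fix s assume s: "s \<in> closed_segment 0 t"
    show "((\<lambda>s. exp (v * s\<^sup>2 / 2) *\<^sub>R \<phi> s) has_vector_derivative \<psi>' s) (at s within closed_segment 0 t)"
      unfolding \<psi>'_def by (rule derivative_eq_intros der refl | simp)+ (simp add: scaleR_conv_of_real algebra_simps)
    have st: "\<bar>s\<bar> \<le> \<bar>t\<bar>" using s by (auto simp: closed_segment_eq_real_ivl split: if_splits)
    hence st2: "s\<^sup>2 \<le> t\<^sup>2" by (simp add: abs_le_square_iff)
    have "norm (\<psi>' s) \<le> exp (v * s\<^sup>2 / 2) * (\<bar>s\<bar> * \<delta>)" unfolding \<psi>'_def using bd[of s] by simp
    also have "\<dots> \<le> exp (v * t\<^sup>2 / 2) * (\<bar>t\<bar> * \<delta>)"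
      using st st2 v \<delta>0 by (intro mult_mono) (auto intro!: mult_left_mono divide_right_mono mult_right_mono)
    finally show "norm (\<psi>' s - \<psi>' 0) \<le> exp (v * t\<^sup>2 / 2) * (\<bar>t\<bar> * \<delta>)" by (simp add: \<psi>'_def \<phi>'_def)
  qed auto
  moreover have "\<phi> 0 = 1" unfolding \<phi>_def by (simp add: prob_space)
  ultimately have *: "norm (exp (v * t\<^sup>2 / 2) *\<^sub>R \<phi> t - 1) \<le> exp (v * t\<^sup>2 / 2) * (t\<^sup>2 * \<delta>)"
    by (simp add: \<psi>'_def \<phi>'_def power2_eq_square mult_ac flip: abs_mult)
  have "\<phi> t - exp (- v * t\<^sup>2 / 2) = exp (- v * t\<^sup>2 / 2) *\<^sub>R (exp (v * t\<^sup>2 / 2) *\<^sub>R \<phi> t - 1)"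
  proof -
    have "exp (- v * t\<^sup>2 / 2) * exp (v * t\<^sup>2 / 2) = 1" by (simp add: exp_add[symmetric])
    thus ?thesis by (simp add: scaleR_diff_right) (simp add: scaleR_conv_of_real)
  qed
  also have "norm \<dots> \<le> exp (- v * t\<^sup>2 / 2) * (exp (v * t\<^sup>2 / 2) * (t\<^sup>2 * \<delta>))"
    using * by simp
  also have "\<dots> = t\<^sup>2 * \<delta>" by (simp add: mult.assoc[symmetric] exp_add[symmetric])
  finally show ?thesis unfolding \<phi>_def \<delta>_def .
qed

text \<open>\<open>v\<close> is the mean of \<open>energy\<close>. What remains is
  \<open>2 * a\<^sup>2 * quad C\<close> and two cross terms, \<open>a\<close> and
  \<open>2 * a\<close> times the linear form with coefficient vector C d; the unequal factors in
  \<open>energy\<close> thus produce the 3.\<close>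

lemma expectation_energy_bound:
  assumes v: "v = 2 * a\<^sup>2 * (\<Sum>j\<in>J. \<Sum>j'\<in>J. (C j j')\<^sup>2) + (\<Sum>j\<in>J. \<Sum>j'\<in>J. d j * d j' * C j j')"
  shows "(LINT x|P. \<bar>energy a d x - v\<bar>) \<le> 2 * a\<^sup>2 * sqrt (LINT x|P. (quad C x)\<^sup>2)
     + 3 * \<bar>a\<bar> * sqrt (LINT x|P. (\<Sum>j\<in>J. (\<Sum>j'\<in>J. C j j' * d j') * Z j x)\<^sup>2)"
proof -
  define \<Lambda> where "\<Lambda> x = (\<Sum>j\<in>J. (\<Sum>j'\<in>J. C j j' * d j') * Z j x)" for x
  have int: "integrable P f" if "exp_growth I f" for f :: "_ \<Rightarrow> real" using exp_growth_integrable fin that by blast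
  have lg[intro]: "exp_growth I \<Lambda>" unfolding \<Lambda>_def by (intro growth)
  have eq: "energy a d x - v = 2 * a\<^sup>2 * quad C x + 3 * a * \<Lambda> x" for x
  proof -
    have s: "(\<Sum>j\<in>J. \<Sum>j'\<in>J. C j j' * (d j * Z j' x)) = \<Lambda> x"
      unfolding \<Lambda>_def by (subst sum.swap) (simp add: sum_distrib_right sum_distrib_left C_commute mult_ac)
    have s': "(\<Sum>j\<in>J. \<Sum>j'\<in>J. C j j' * (d j' * Z j x)) = \<Lambda> x"
      unfolding \<Lambda>_def by (simp add: sum_distrib_right sum_distrib_left mult_ac)
    have "energy a d x = (\<Sum>j\<in>J. \<Sum>j'\<in>J. 2 * a\<^sup>2 * (C j j' * (Z j x * Z j' x - C j j')) + 2 * a\<^sup>2 * (C j j')\<^sup>2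
       + a * (C j j' * (d j' * Z j x)) + 2 * a * (C j j' * (d j * Z j' x)) + d j * d j' * C j j')"
      unfolding energy_def by (simp add: algebra_simps power2_eq_square)
    also have "\<dots> = 2 * a\<^sup>2 * quad C x + 2 * a\<^sup>2 * (\<Sum>j\<in>J. \<Sum>j'\<in>J. (C j j')\<^sup>2) + a * \<Lambda> x + 2 * a * \<Lambda> x + (\<Sum>j\<in>J. \<Sum>j'\<in>J. d j * d j' * C j j')"
      unfolding quad_def by (simp only: sum.distrib sum_distrib_left[symmetric] s s')
    finally show ?thesis unfolding v by simp
  qed
  have "(LINT x|P. \<bar>energy a d x - v\<bar>) \<le> (LINT x|P. 2 * a\<^sup>2 * \<bar>quad C x\<bar> + 3 * \<bar>a\<bar> * \<bar>\<Lambda> x\<bar>)"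
  proof (intro integral_mono int growth lg energy_exp_growth quad_exp_growth)
    show "\<bar>energy a d x - v\<bar> \<le> 2 * a\<^sup>2 * \<bar>quad C x\<bar> + 3 * \<bar>a\<bar> * \<bar>\<Lambda> x\<bar>" for x
      unfolding eq using abs_triangle_ineq[of "2 * a\<^sup>2 * quad C x" "3 * a * \<Lambda> x"] by (simp add: abs_mult)
  qed
  also have "\<dots> = 2 * a\<^sup>2 * (LINT x|P. \<bar>quad C x\<bar>) + 3 * \<bar>a\<bar> * (LINT x|P. \<bar>\<Lambda> x\<bar>)"
  proof -
    have "integrable P (\<lambda>x. \<bar>quad C x\<bar>)" "integrable P (\<lambda>x. \<bar>\<Lambda> x\<bar>)" by (intro int growth lg quad_exp_growth)+
    thus ?thesis by simp
  qed
  also have "\<dots> \<le> 2 * a\<^sup>2 * sqrt (LINT x|P. (quad C x)\<^sup>2) + 3 * \<bar>a\<bar> * sqrt (LINT x|P. (\<Lambda> x)\<^sup>2)"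
    by (intro add_mono mult_left_mono expectation_abs_le_sqrt prob_space_std_gauss int growth lg quad_exp_growth) auto
  finally show ?thesis unfolding \<Lambda>_def .
qed

end

section \<open>The autoregressive covariance matrix\<close>

lemma rpow_commute: "rpow \<rho> k l = rpow \<rho> l k"
  by (auto simp: rpow_def)

lemma rpow_self[simp]: "rpow \<rho> k k = 1"
  by (simp add: rpow_def)

lemma rpow_sq: "(rpow \<rho> k l)\<^sup>2 = rpow (\<rho>\<^sup>2) k l"
  by (simp add: rpow_def power_even_eq flip: power_mult)

lemma abs_rpow: "\<bar>rpow \<rho> k l\<bar> = rpow \<bar>\<rho>\<bar> k l"
  by (simp add: rpow_def power_abs)

lemma rpow_nonneg: "0 \<le> r \<Longrightarrow> 0 \<le> rpow r k l"
  by (simp add: rpow_def)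

lemma rpow_le_1: "0 \<le> r \<Longrightarrow> r \<le> 1 \<Longrightarrow> rpow r k l \<le> 1"
  by (simp add: rpow_def power_le_one)

text \<open>To the left and to the right of \<open>k\<close> the entries are parts of a geometric
  series, so the bound depends on neither \<open>k\<close> nor \<open>p\<close>.\<close>

lemma sum_rpow_le:
  assumes r: "0 \<le> r" "r < 1"
  shows "(\<Sum>l<p. rpow r k l) \<le> 2 / (1 - r)"
proof -
  have *: "(\<Sum>l\<in>A. r ^ h l) \<le> 1 / (1 - r)" if "finite A" "inj_on h A" for A :: "nat set" and h
  proof -
    have "(\<Sum>l\<in>A. r ^ h l) = (\<Sum>m\<in>h ` A. r ^ m)" using that by (simp add: sum.reindex)
    also have "\<dots> \<le> (\<Sum>m. r ^ m)" using that r by (intro sum_le_suminf summable_geometric) auto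
    also have "\<dots> = 1 / (1 - r)" using r by (intro suminf_geometric) auto
    finally show ?thesis .
  qed
  have "(\<Sum>l<p. rpow r k l) = (\<Sum>l\<in>{..<p} \<inter> {k..}. rpow r k l) + (\<Sum>l\<in>{..<p} - {k..}. rpow r k l)"
    by (subst sum.Int_Diff[of _ _ "{k..}"]) auto
  also have "(\<Sum>l\<in>{..<p} \<inter> {k..}. rpow r k l) = (\<Sum>l\<in>{..<p} \<inter> {k..}. r ^ (l - k))"
    by (intro sum.cong) (auto simp: rpow_def)
  also have "(\<Sum>l\<in>{..<p} - {k..}. rpow r k l) = (\<Sum>l\<in>{..<p} - {k..}. r ^ (k - l))"
    by (intro sum.cong) (auto simp: rpow_def)
  also have "(\<Sum>l\<in>{..<p} \<inter> {k..}. r ^ (l - k)) + (\<Sum>l\<in>{..<p} - {k..}. r ^ (k - l)) \<le> 1 / (1 - r) + 1 / (1 - r)"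
    by (intro add_mono *) (auto intro!: inj_onI)
  finally show ?thesis by simp
qed

section \<open>Schur's test\<close>

text \<open>From \<open>2 * \<bar>x k * x l\<bar> \<le> (x k)\<^sup>2 + (x l)\<^sup>2\<close>; by
  symmetry of \<open>R\<close> both halves become the same weighted row sum.\<close>

lemma schur_bilinear_bound:
  fixes R :: "'i \<Rightarrow> 'i \<Rightarrow> real"
  assumes "\<And>k l. R k l = R l k" "\<And>k l. 0 \<le> R k l" "\<And>k. (\<Sum>l\<in>I. R k l) \<le> K"
  shows "(\<Sum>k\<in>I. \<Sum>l\<in>I. R k l * \<bar>x k * x l\<bar>) \<le> K * (\<Sum>l\<in>I. (x l)\<^sup>2)"
proof -
  have "(\<Sum>k\<in>I. \<Sum>l\<in>I. R k l * \<bar>x k * x l\<bar>) \<le> (\<Sum>k\<in>I. \<Sum>l\<in>I. R k l * ((x k)\<^sup>2 / 2) + R k l * ((x l)\<^sup>2 / 2))"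
  proof (intro sum_mono)
    fix k l
    have "0 \<le> (\<bar>x k\<bar> - \<bar>x l\<bar>)\<^sup>2" by simp
    hence "\<bar>x k * x l\<bar> \<le> (x k)\<^sup>2 / 2 + (x l)\<^sup>2 / 2" by (simp add: power2_diff abs_mult)
    from mult_left_mono[OF this assms(2)[of k l]]
    show "R k l * \<bar>x k * x l\<bar> \<le> R k l * ((x k)\<^sup>2 / 2) + R k l * ((x l)\<^sup>2 / 2)" by (simp add: distrib_left)
  qed
  also have "\<dots> = (\<Sum>k\<in>I. \<Sum>l\<in>I. R k l * ((x k)\<^sup>2 / 2)) + (\<Sum>k\<in>I. \<Sum>l\<in>I. R k l * ((x l)\<^sup>2 / 2))"
    by (simp add: sum.distrib)
  also have "(\<Sum>k\<in>I. \<Sum>l\<in>I. R k l * ((x l)\<^sup>2 / 2)) = (\<Sum>k\<in>I. \<Sum>l\<in>I. R k l * ((x k)\<^sup>2 / 2))"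
    by (subst sum.swap) (subst assms(1), simp)
  also have "(\<Sum>k\<in>I. \<Sum>l\<in>I. R k l * ((x k)\<^sup>2 / 2)) + (\<Sum>k\<in>I. \<Sum>l\<in>I. R k l * ((x k)\<^sup>2 / 2)) = (\<Sum>k\<in>I. (\<Sum>l\<in>I. R k l) * (x k)\<^sup>2)"
    by (simp add: sum_distrib_right sum.distrib[symmetric] flip: sum_divide_distrib)
  also have "\<dots> \<le> (\<Sum>k\<in>I. K * (x k)\<^sup>2)" by (intro sum_mono mult_right_mono assms) auto
  finally show ?thesis by (simp add: sum_distrib_left)
qed

text \<open>Cauchy-Schwarz after splitting \<open>R k l\<close> into two square roots yields one row
  sum; exchanging the sums and using symmetry yields a second, hence
  \<open>K\<^sup>2\<close>.\<close>

lemma schur_l2_bound: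
  fixes R :: "'i \<Rightarrow> 'i \<Rightarrow> real"
  assumes "finite I" "\<And>k l. R k l = R l k" "\<And>k l. 0 \<le> R k l" "\<And>k. (\<Sum>l\<in>I. R k l) \<le> K"
  shows "(\<Sum>k\<in>I. (\<Sum>l\<in>I. R k l * \<bar>x l\<bar>)\<^sup>2) \<le> K\<^sup>2 * (\<Sum>l\<in>I. (x l)\<^sup>2)"
proof (cases "I = {}")
  case False
  then obtain i where "i \<in> I" by auto
  have K: "0 \<le> K" using assms(4)[of i] sum_nonneg[of I "R i"] assms(3) by (meson order_trans)
  have "(\<Sum>k\<in>I. (\<Sum>l\<in>I. R k l * \<bar>x l\<bar>)\<^sup>2) \<le> (\<Sum>k\<in>I. K * (\<Sum>l\<in>I. R k l * (x l)\<^sup>2))"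
  proof (intro sum_mono)
    fix k
    have "(\<Sum>l\<in>I. R k l * \<bar>x l\<bar>)\<^sup>2 = (\<Sum>l\<in>I. sqrt (R k l) * (sqrt (R k l) * \<bar>x l\<bar>))\<^sup>2"
      using assms(3) by (simp add: mult.assoc[symmetric])
    also have "\<dots> \<le> (\<Sum>l\<in>I. (sqrt (R k l))\<^sup>2) * (\<Sum>l\<in>I. (sqrt (R k l) * \<bar>x l\<bar>)\<^sup>2)"
      by (rule Cauchy_Schwarz_ineq_sum)
    also have "\<dots> = (\<Sum>l\<in>I. R k l) * (\<Sum>l\<in>I. R k l * (x l)\<^sup>2)"
      using assms(3) by (simp add: power_mult_distrib)
    also have "\<dots> \<le> K * (\<Sum>l\<in>I. R k l * (x l)\<^sup>2)"
      using assms(3,4) by (intro mult_right_mono sum_nonneg) auto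
    finally show "(\<Sum>l\<in>I. R k l * \<bar>x l\<bar>)\<^sup>2 \<le> K * (\<Sum>l\<in>I. R k l * (x l)\<^sup>2)" .
  qed
  also have "\<dots> = K * (\<Sum>l\<in>I. (\<Sum>k\<in>I. R l k) * (x l)\<^sup>2)"
    unfolding sum_distrib_left[symmetric] by (subst sum.swap) (subst assms(2), simp add: sum_distrib_right)
  also have "\<dots> \<le> K * (\<Sum>l\<in>I. K * (x l)\<^sup>2)"
    using K by (intro mult_left_mono sum_mono mult_right_mono assms) auto
  finally show ?thesis by (simp add: sum_distrib_left power2_eq_square mult.assoc)
qed simp

lemma rpow_bilinear_bound:
  assumes "\<bar>\<rho>\<bar> < 1"
  shows "(\<Sum>k<p. \<Sum>l<p. \<bar>x k * x l * rpow \<rho> k l\<bar>) \<le> 2 / (1 - \<bar>\<rho>\<bar>) * (\<Sum>l<p. (x l)\<^sup>2)"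
  using schur_bilinear_bound[of "rpow \<bar>\<rho>\<bar>" "{..<p}" "2 / (1 - \<bar>\<rho>\<bar>)" x, OF rpow_commute rpow_nonneg sum_rpow_le] assms
  by (simp add: abs_mult abs_rpow mult_ac)

lemma rpow_l2_bound:
  assumes "\<bar>\<rho>\<bar> < 1"
  shows "(\<Sum>k<p. (\<Sum>l<p. \<bar>x l * rpow \<rho> k l\<bar>)\<^sup>2) \<le> (2 / (1 - \<bar>\<rho>\<bar>))\<^sup>2 * (\<Sum>l<p. (x l)\<^sup>2)"
  using schur_l2_bound[of "{..<p}" "rpow \<bar>\<rho>\<bar>" "2 / (1 - \<bar>\<rho>\<bar>)" x, OF _ rpow_commute rpow_nonneg sum_rpow_le] assms
  by (simp add: abs_mult abs_rpow mult_ac)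

section \<open>Existence of the limits of the kappa sums\<close>

text \<open>Bounded monotone sums converge for \<open>f + \<bar>f\<bar>\<close> and for
  \<open>\<bar>f\<bar>\<close>, and \<open>f\<close> is the difference. The kappa sums run over
  growing cubes rather than along an enumeration, hence the sets \<open>D p\<close>.\<close>

lemma convergent_sum_incseq:
  fixes f :: "'b \<Rightarrow> real"
  assumes D: "incseq D" "\<And>p. finite (D p)" and B: "\<And>p. (\<Sum>x\<in>D p. \<bar>f x\<bar>) \<le> B"
  shows "convergent (\<lambda>p::nat. \<Sum>x\<in>D p. f x)"
proof -
  have pos: "convergent (\<lambda>p. \<Sum>x\<in>D p. g x)" if g: "\<And>x. 0 \<le> g x" "\<And>x. g x \<le> 2 * \<bar>f x\<bar>" for g :: "'b \<Rightarrow> real"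
  proof -
    have m: "incseq (\<lambda>p. \<Sum>x\<in>D p. g x)"
      using D g by (intro incseq_SucI sum_mono2) (auto simp: incseq_SucD)
    have "(\<Sum>x\<in>D p. g x) \<le> 2 * B" for p
    proof -
      have "(\<Sum>x\<in>D p. g x) \<le> (\<Sum>x\<in>D p. 2 * \<bar>f x\<bar>)" using g by (intro sum_mono)
      thus ?thesis using B[of p] by (simp add: sum_distrib_left[symmetric])
    qed
    with m show ?thesis by (metis convergentI incseq_convergent)
  qed
  have "convergent (\<lambda>p. (\<Sum>x\<in>D p. f x + \<bar>f x\<bar>) - (\<Sum>x\<in>D p. \<bar>f x\<bar>))"
    by (intro convergent_diff pos) auto
  thus ?thesis by (simp add: sum.distrib)
qed

context
  fixes \<rho> :: real and \<beta> :: "nat \<Rightarrow> real"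
  assumes \<rho>: "\<bar>\<rho>\<bar> < 1" and \<beta>: "summable (\<lambda>j. (\<beta> j)\<^sup>2)"
begin

lemma sum_sq_le_suminf: "(\<Sum>l<p. (\<beta> l)\<^sup>2) \<le> (\<Sum>l. (\<beta> l)\<^sup>2)"
  using \<beta> by (intro sum_le_suminf) auto

lemma convergent_kappa1p: "convergent (kappa1p \<rho> \<beta>)"
proof -
  let ?D = "\<lambda>p. {..<p} \<times> {..<p}" and ?f = "\<lambda>(k, l). \<beta> k * \<beta> l * rpow \<rho> k l"
  have "convergent (\<lambda>p::nat. \<Sum>x\<in>?D p. ?f x)"
  proof (rule convergent_sum_incseq)
    show "incseq ?D" by (auto simp: incseq_def)
    fix p
    have "(\<Sum>x\<in>?D p. \<bar>?f x\<bar>) = (\<Sum>k<p. \<Sum>l<p. \<bar>\<beta> k * \<beta> l * rpow \<rho> k l\<bar>)"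
      by (simp add: sum.cartesian_product case_prod_unfold)
    also have "\<dots> \<le> 2 / (1 - \<bar>\<rho>\<bar>) * (\<Sum>l<p. (\<beta> l)\<^sup>2)" by (rule rpow_bilinear_bound[OF \<rho>])
    also have "\<dots> \<le> 2 / (1 - \<bar>\<rho>\<bar>) * (\<Sum>l. (\<beta> l)\<^sup>2)" using \<rho> sum_sq_le_suminf by (intro mult_left_mono) auto
    finally show "(\<Sum>x\<in>?D p. \<bar>?f x\<bar>) \<le> 2 / (1 - \<bar>\<rho>\<bar>) * (\<Sum>l. (\<beta> l)\<^sup>2)" .
  qed auto
  thus ?thesis by (simp add: kappa1p_def[abs_def] sum.cartesian_product)
qed

lemma convergent_kappa2p: "convergent (kappa2p \<rho> \<beta>)"
proof -
  let ?D = "\<lambda>p. {..<p} \<times> {..<p} \<times> {..<p}" and ?f = "\<lambda>(k, l, j). \<beta> l * rpow \<rho> k l * (\<beta> j * rpow \<rho> k j)"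
  have "convergent (\<lambda>p::nat. \<Sum>x\<in>?D p. ?f x)"
  proof (rule convergent_sum_incseq)
    show "incseq ?D" by (auto simp: incseq_def)
    fix p
    have "(\<Sum>x\<in>?D p. \<bar>?f x\<bar>) = (\<Sum>k<p. (\<Sum>l<p. \<bar>\<beta> l * rpow \<rho> k l\<bar>)\<^sup>2)"
      by (simp add: sum.cartesian_product case_prod_unfold power2_eq_square sum_product abs_mult)
    also have "\<dots> \<le> (2 / (1 - \<bar>\<rho>\<bar>))\<^sup>2 * (\<Sum>l<p. (\<beta> l)\<^sup>2)" by (rule rpow_l2_bound[OF \<rho>])
    also have "\<dots> \<le> (2 / (1 - \<bar>\<rho>\<bar>))\<^sup>2 * (\<Sum>l. (\<beta> l)\<^sup>2)" using \<rho> sum_sq_le_suminf by (intro mult_left_mono) auto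
    finally show "(\<Sum>x\<in>?D p. \<bar>?f x\<bar>) \<le> (2 / (1 - \<bar>\<rho>\<bar>))\<^sup>2 * (\<Sum>l. (\<beta> l)\<^sup>2)" .
  qed auto
  thus ?thesis by (simp add: kappa2p_def[abs_def] power2_eq_square sum_product sum.cartesian_product)
qed

lemma convergent_kappa3p: "convergent (kappa3p \<rho> \<beta>)"
proof -
  let ?D = "\<lambda>p. {..<p} \<times> {..<p} \<times> {..<p} \<times> {..<p}"
  let ?f = "\<lambda>(k, l, j, j'). \<beta> j * \<beta> j' * rpow \<rho> k j * rpow \<rho> l j' * rpow \<rho> k l"
  have "convergent (\<lambda>p::nat. \<Sum>x\<in>?D p. ?f x)"
  proof (rule convergent_sum_incseq)
    show "incseq ?D" by (auto simp: incseq_def)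
    fix p
    \<comment> \<open>\<open>y\<close> is the matrix of absolute values applied to the absolute
      values of \<beta>. Through it the fourfold sum becomes a bilinear form, to which the bilinear
      bound and then the l2 bound apply.\<close>
    define y where "y k = (\<Sum>l<p. \<bar>\<beta> l * rpow \<rho> k l\<bar>)" for k
    have y0: "y k \<ge> 0" for k unfolding y_def by (simp add: sum_nonneg)
    have "(\<Sum>x\<in>?D p. \<bar>?f x\<bar>) = (\<Sum>k<p. \<Sum>l<p. \<Sum>j<p. \<Sum>j'<p. \<bar>\<beta> j * \<beta> j' * rpow \<rho> k j * rpow \<rho> l j' * rpow \<rho> k l\<bar>)"
      by (simp add: sum.cartesian_product case_prod_unfold)
    also have "\<dots> = (\<Sum>k<p. \<Sum>l<p. \<bar>y k * y l * rpow \<rho> k l\<bar>)"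
    proof (intro sum.cong refl)
      fix k l
      have "\<bar>y k * y l * rpow \<rho> k l\<bar> = y k * y l * \<bar>rpow \<rho> k l\<bar>" using y0 by (simp add: abs_mult)
      also have "\<dots> = (\<Sum>j<p. \<Sum>j'<p. \<bar>\<beta> j * \<beta> j' * rpow \<rho> k j * rpow \<rho> l j' * rpow \<rho> k l\<bar>)"
      proof -
        have "y k * y l = (\<Sum>j<p. \<Sum>j'<p. \<bar>\<beta> j * rpow \<rho> k j\<bar> * \<bar>\<beta> j' * rpow \<rho> l j'\<bar>)"
          unfolding y_def by (rule sum_product)
        thus ?thesis by (simp only: sum_distrib_right) (simp add: abs_mult mult_ac)
      qed
      finally show "(\<Sum>j<p. \<Sum>j'<p. \<bar>\<beta> j * \<beta> j' * rpow \<rho> k j * rpow \<rho> l j' * rpow \<rho> k l\<bar>) = \<bar>y k * y l * rpow \<rho> k l\<bar>" ..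
    qed
    also have "\<dots> \<le> 2 / (1 - \<bar>\<rho>\<bar>) * (\<Sum>l<p. (y l)\<^sup>2)" by (rule rpow_bilinear_bound[OF \<rho>])
    also have "\<dots> \<le> 2 / (1 - \<bar>\<rho>\<bar>) * ((2 / (1 - \<bar>\<rho>\<bar>))\<^sup>2 * (\<Sum>l<p. (\<beta> l)\<^sup>2))"
      using rpow_l2_bound[OF \<rho>, of \<beta> p] \<rho> unfolding y_def by (intro mult_left_mono) auto
    also have "\<dots> \<le> 2 / (1 - \<bar>\<rho>\<bar>) * ((2 / (1 - \<bar>\<rho>\<bar>))\<^sup>2 * (\<Sum>l. (\<beta> l)\<^sup>2))"
      using \<rho> sum_sq_le_suminf by (intro mult_left_mono) auto
    finally show "(\<Sum>x\<in>?D p. \<bar>?f x\<bar>) \<le> 2 / (1 - \<bar>\<rho>\<bar>) * ((2 / (1 - \<bar>\<rho>\<bar>))\<^sup>2 * (\<Sum>l. (\<beta> l)\<^sup>2))" .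
  qed auto
  thus ?thesis by (simp add: kappa3p_def[abs_def] sum.cartesian_product)
qed

end

section \<open>Trace of the squared covariance matrix\<close>

text \<open>Each induction step adds one diagonal entry and twice a column, itself a geometric sum.
  For q = \<rho>^2 the double sum is tr(\<Sigma>^2).\<close>

lemma sum_rpow_eq:
  assumes "q \<noteq> 1"
  shows "(\<Sum>k<p. \<Sum>l<p. rpow q k l) = p * (1 + q) / (1 - q) - 2 * q * (1 - q ^ p) / (1 - q)\<^sup>2"
proof (induction p)
  case (Suc p)
  have g: "(\<Sum>k<p. rpow q k p) = q * (1 - q ^ p) / (1 - q)"
  proof (induction p)
    case (Suc p)
    have "(\<Sum>k<p. rpow q k (Suc p)) = q * (\<Sum>k<p. rpow q k p)"
      unfolding sum_distrib_left by (intro sum.cong) (auto simp: rpow_def Suc_diff_le)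
    moreover have "rpow q p (Suc p) = q" by (simp add: rpow_def)
    ultimately show ?case using assms by (simp only: sum.lessThan_Suc Suc) (simp add: field_simps)
  qed simp
  have "(\<Sum>k<Suc p. \<Sum>l<Suc p. rpow q k l) = (\<Sum>k<p. \<Sum>l<p. rpow q k l) + 2 * (\<Sum>k<p. rpow q k p) + 1"
    by (simp add: sum.distrib rpow_commute[of q p])
  also have "\<dots> = (p * (1 + q) / (1 - q) - 2 * q * (1 - q ^ p) / (1 - q)\<^sup>2) + 2 * (q * (1 - q ^ p) / (1 - q)) + 1"
    by (simp only: Suc g)
  also have "\<dots> = Suc p * (1 + q) / (1 - q) - 2 * q * (1 - q ^ Suc p) / (1 - q)\<^sup>2"
    using assms by (simp add: divide_simps power2_eq_square) (simp add: algebra_simps)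
  finally show ?case .
qed simp

text \<open>The exact formula has main term \<open>p * (1 + q) / (1 - q)\<close> at
  \<open>q = \<rho>\<^sup>2\<close> and a bounded correction. The fraction in the limiting variance
  originates here.\<close>

lemma sum_rpow_sq_asymptotic:
  assumes "\<bar>\<rho>\<bar> < 1"
  shows "(\<lambda>p. (\<Sum>k<p. \<Sum>l<p. (rpow \<rho> k l)\<^sup>2) / real p) \<longlonglongrightarrow> (1 + \<rho>\<^sup>2) / (1 - \<rho>\<^sup>2)"
proof -
  define q where "q = \<rho>\<^sup>2"
  have q: "0 \<le> q" "q < 1" using assms by (auto simp: q_def abs_square_less_1)
  have "(\<lambda>p. (1 + q) / (1 - q) - 2 * q * (1 - q ^ p) / (1 - q)\<^sup>2 * (1 / real p)) \<longlonglongrightarrow> (1 + q) / (1 - q) - 2 * q * (1 - 0) / (1 - q)\<^sup>2 * 0"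
    using q by (intro tendsto_intros LIMSEQ_power_zero lim_1_over_n) auto
  moreover have "eventually (\<lambda>p. (1 + q) / (1 - q) - 2 * q * (1 - q ^ p) / (1 - q)\<^sup>2 * (1 / real p) = (\<Sum>k<p. \<Sum>l<p. (rpow \<rho> k l)\<^sup>2) / real p) sequentially"
    using eventually_gt_at_top[of 0]
  proof eventually_elim
    case (elim p)
    have "(\<Sum>k<p. \<Sum>l<p. (rpow \<rho> k l)\<^sup>2) = p * (1 + q) / (1 - q) - 2 * q * (1 - q ^ p) / (1 - q)\<^sup>2"
      unfolding rpow_sq q_def[symmetric] using q by (intro sum_rpow_eq) auto
    thus ?case using elim by (simp add: diff_divide_distrib)
  qed
  ultimately show ?thesis by (simp add: q_def tendsto_cong)
qed

text \<open>Column \<open>0\<close> carries the stationary start of the autoregression, the other columns its innovations.\<close>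

definition ar_cholesky :: "real \<Rightarrow> nat \<Rightarrow> nat \<Rightarrow> real" where
  "ar_cholesky \<rho> j k = (if j < k then 0 else if k = 0 then \<rho> ^ j else sqrt (1 - \<rho>\<^sup>2) * \<rho> ^ (j - k))"

text \<open>The factor encodes the recursion x_{j+1} = \<rho> x_j + sqrt(1 - \<rho>^2) times an
  innovation. In the induction the old columns therefore gain \<rho>^2 and the new one adds
  \<open>(1 - \<rho>\<^sup>2) * \<rho> ^ d\<close>, which again total
  \<open>\<rho> ^ d\<close>.\<close>

lemma ar_cholesky_product:
  assumes "\<bar>\<rho>\<bar> < 1" "j < p" "j' < p"
  shows "(\<Sum>k<p. ar_cholesky \<rho> j k * ar_cholesky \<rho> j' k) = rpow \<rho> j j'"
proof -
  have q: "\<rho>\<^sup>2 \<le> 1" using assms by (simp add: abs_square_le_1)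
  have main: "(\<Sum>k\<le>j. ar_cholesky \<rho> j k * ar_cholesky \<rho> (j + d) k) = \<rho> ^ d" for j d
  proof (induction j)
    case 0
    then show ?case by (simp add: ar_cholesky_def)
  next
    case (Suc j)
    have "(\<Sum>k\<le>j. ar_cholesky \<rho> (Suc j) k * ar_cholesky \<rho> (Suc j + d) k)
       = \<rho>\<^sup>2 * (\<Sum>k\<le>j. ar_cholesky \<rho> j k * ar_cholesky \<rho> (j + d) k)"
      unfolding sum_distrib_left
      by (intro sum.cong) (auto simp: ar_cholesky_def Suc_diff_le power2_eq_square)
    moreover have "ar_cholesky \<rho> (Suc j) (Suc j) * ar_cholesky \<rho> (Suc j + d) (Suc j) = (1 - \<rho>\<^sup>2) * \<rho> ^ d"
      using q by (simp add: ar_cholesky_def mult.assoc[symmetric])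
    ultimately show ?case using Suc by (simp add: algebra_simps)
  qed
  have le: "(\<Sum>k<p. ar_cholesky \<rho> j k * ar_cholesky \<rho> j' k) = rpow \<rho> j j'" if "j \<le> j'" "j' < p" for j j'
  proof -
    have "(\<Sum>k<p. ar_cholesky \<rho> j k * ar_cholesky \<rho> j' k) = (\<Sum>k\<le>j. ar_cholesky \<rho> j k * ar_cholesky \<rho> j' k)"
      using that by (intro sum.mono_neutral_right) (auto simp: ar_cholesky_def)
    thus ?thesis using main[of j "j' - j"] that by (simp add: rpow_def)
  qed
  show ?thesis
  proof (cases "j \<le> j'")
    case False
    thus ?thesis using le[of j' j] assms by (simp add: mult.commute rpow_commute)
  qed (use le assms in auto)
qed

section \<open>The characteristic function of X'Y\<close>

lemma char_normal_var:
  assumes "v \<ge> 0" shows "char (normal_var v) t = exp (- v * t\<^sup>2 / 2)"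
proof (cases "v = 0")
  case True
  have "char (return borel (0::real)) t = iexp (t * 0)"
    unfolding char_def by (rule integral_return) auto
  thus ?thesis using True by (simp add: normal_var_def)
next
  case False
  define \<sigma> where "\<sigma> = sqrt v"
  have \<sigma>: "\<sigma> > 0" "v = \<sigma>\<^sup>2" using assms False by (auto simp: \<sigma>_def)
  have "char (normal_var v) t = (CLINT x|density lborel (normal_density 0 \<sigma>). iexp (t * x))"
    using False by (simp add: normal_var_def char_def \<sigma>_def)
  also have "\<dots> = (CLINT x|lborel. normal_density 0 \<sigma> x *\<^sub>R iexp (t * x))"
    by (subst integral_density) auto
  also have "\<dots> = \<bar>\<sigma>\<bar> *\<^sub>R (CLINT x|lborel. normal_density 0 \<sigma> (0 + \<sigma> * x) *\<^sub>R iexp (t * (0 + \<sigma> * x)))"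
    by (rule lborel_integral_real_affine) (use \<sigma> in simp)
  also have "\<dots> = (CLINT x|lborel. std_normal_density x *\<^sub>R iexp (t * \<sigma> * x))"
    unfolding integral_scaleR_right[symmetric]
  proof (intro Bochner_Integration.integral_cong refl)
    fix x :: real
    have "\<bar>\<sigma>\<bar> * normal_density 0 \<sigma> (0 + \<sigma> * x) = std_normal_density x"
      using \<sigma>(1) by (simp add: normal_density_def real_sqrt_mult power_mult_distrib)
    thus "\<bar>\<sigma>\<bar> *\<^sub>R normal_density 0 \<sigma> (0 + \<sigma> * x) *\<^sub>R iexp (t * (0 + \<sigma> * x)) = std_normal_density x *\<^sub>R iexp (t * \<sigma> * x)"
      by (simp only: scaleR_scaleR) (simp add: mult.assoc)
  qed
  also have "\<dots> = char std_normal_distribution (t * \<sigma>)"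
    unfolding char_def by (subst integral_density) auto
  also have "\<dots> = exp (- v * t\<^sup>2 / 2)"
    by (simp add: char_std_normal_distribution \<sigma>(2) power_mult_distrib mult.commute)
  finally show ?thesis .
qed

lemma char_centered_mvnormal:
  assumes "centered_mvnormal M Z I C" "0 \<le> (\<Sum>j\<in>I. \<Sum>k\<in>I. a j * a k * C j k)"
  shows "(CLINT x|M. iexp (\<Sum>j\<in>I. a j * Z j x)) = exp (- (\<Sum>j\<in>I. \<Sum>k\<in>I. a j * a k * C j k) / 2)"
proof -
  have [measurable]: "\<And>j. j \<in> I \<Longrightarrow> Z j \<in> borel_measurable M" using assms by (auto simp: centered_mvnormal_def)
  have "char (distr M borel (\<lambda>x. \<Sum>j\<in>I. a j * Z j x)) 1 = exp (- (\<Sum>j\<in>I. \<Sum>k\<in>I. a j * a k * C j k) / 2)"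
    using assms(1) char_normal_var[OF assms(2), of 1] by (simp add: centered_mvnormal_def)
  thus ?thesis unfolding char_def by (subst (asm) integral_distr) simp_all
qed

lemma char_std_gauss:
  assumes "finite I"
  shows "(CLINT y|std_gauss I. iexp (\<Sum>k\<in>I. c k * y k)) = exp (- (\<Sum>k\<in>I. (c k)\<^sup>2) / 2)"
proof -
  interpret product_sigma_finite "\<lambda>_. std_normal_distribution"
    unfolding product_sigma_finite_def by (intro allI prob_space_imp_sigma_finite prob_space_std_normal)
  interpret N: prob_space std_normal_distribution by (rule prob_space_std_normal)
  have "(CLINT y|std_gauss I. iexp (\<Sum>k\<in>I. c k * y k)) = (CLINT y|std_gauss I. (\<Prod>k\<in>I. iexp (c k * y k)))"
    using assms by (simp add: sum_distrib_left exp_sum)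
  also have "\<dots> = (\<Prod>k\<in>I. CLINT y|std_normal_distribution. iexp (c k * y))"
    using assms by (intro product_integral_prod N.integrable_const_bound[where B=1]) auto
  also have "\<dots> = (\<Prod>k\<in>I. complex_of_real (exp (- (c k)\<^sup>2 / 2)))"
    using char_std_normal_distribution by (simp add: char_def fun_eq_iff)
  also have "\<dots> = complex_of_real (exp (- (\<Sum>k\<in>I. (c k)\<^sup>2) / 2))"
    using assms by (simp add: exp_sum[symmetric] sum_negf sum_divide_distrib flip: of_real_prod)
  finally show ?thesis .
qed

lemma (in gauss_vector) char_linear:
  "(CLINT y|P. iexp (\<Sum>j\<in>J. e j * Z j y)) = exp (- (\<Sum>j\<in>J. \<Sum>j'\<in>J. e j * e j' * C j j') / 2)"
proof -
  have "(\<Sum>j\<in>J. e j * Z j y) = (\<Sum>k\<in>I. (\<Sum>j\<in>J. e j * L j k) * y k)" for y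
    unfolding Z_def sum_distrib_left sum_distrib_right by (subst sum.swap) (simp add: mult.assoc)
  moreover have "(\<Sum>k\<in>I. (\<Sum>j\<in>J. e j * L j k)\<^sup>2) = (\<Sum>j\<in>J. \<Sum>j'\<in>J. e j * e j' * C j j')"
  proof -
    have "(\<Sum>k\<in>I. (\<Sum>j\<in>J. e j * L j k)\<^sup>2) = (\<Sum>k\<in>I. \<Sum>j\<in>J. \<Sum>j'\<in>J. e j * e j' * (L j k * L j' k))"
      by (simp add: power2_eq_square sum_product mult_ac)
    also have "\<dots> = (\<Sum>j\<in>J. \<Sum>j'\<in>J. \<Sum>k\<in>I. e j * e j' * (L j k * L j' k))"
      by (subst sum.swap) (intro sum.cong refl sum.swap)
    finally show ?thesis by (simp add: C_def sum_distrib_left)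
  qed
  ultimately show ?thesis by (simp only: char_std_gauss[OF fin(1)])
qed

lemma expectation_uniqueness:
  fixes f :: "nat \<Rightarrow> 'a \<Rightarrow> real" and f' :: "nat \<Rightarrow> 'b \<Rightarrow> real" and h :: "_ \<Rightarrow> complex"
  assumes "prob_space M" "prob_space M'"
    and m[measurable]: "\<And>j. j < p \<Longrightarrow> f j \<in> borel_measurable M" "\<And>j. j < p \<Longrightarrow> f' j \<in> borel_measurable M'"
    and eq: "\<And>\<theta>. (CLINT x|M. iexp (\<Sum>j<p. \<theta> j * f j x)) = (CLINT x|M'. iexp (\<Sum>j<p. \<theta> j * f' j x))"
    and [measurable]: "h \<in> borel_measurable (Pi\<^sub>M {..<p} (\<lambda>_. borel))"
  shows "(CLINT x|M. h (\<lambda>j\<in>{..<p}. f j x)) = (CLINT x|M'. h (\<lambda>j\<in>{..<p}. f' j x))"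
proof -
  have mv[measurable]: "(\<lambda>x. \<lambda>j\<in>{..<p}. f j x) \<in> measurable M (Pi\<^sub>M {..<p} (\<lambda>_. borel))"
      "(\<lambda>x. \<lambda>j\<in>{..<p}. f' j x) \<in> measurable M' (Pi\<^sub>M {..<p} (\<lambda>_. borel))"
    by (intro measurable_restrict; simp)+
  have "(CLINT x|M. h (\<lambda>j\<in>{..<p}. f j x)) = (CLINT z|distr M (Pi\<^sub>M {..<p} (\<lambda>_. borel)) (\<lambda>x. \<lambda>j\<in>{..<p}. f j x). h z)"
    by (subst integral_distr) auto
  also have "\<dots> = (CLINT z|distr M' (Pi\<^sub>M {..<p} (\<lambda>_. borel)) (\<lambda>x. \<lambda>j\<in>{..<p}. f' j x). h z)"
    by (simp only: joint_char_uniqueness[OF assms(1,2) m eq])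
  also have "\<dots> = (CLINT x|M'. h (\<lambda>j\<in>{..<p}. f' j x))"
    by (subst integral_distr) auto
  finally show ?thesis .
qed

text \<open>The degenerate case \<open>u = 0\<close> forces \<open>r = 0\<close> and needs no separate treatment because \<open>x / 0 = 0\<close>.\<close>

lemma bivariate_gaussian_product:
  fixes U W :: "'a \<Rightarrow> real"
  assumes "prob_space M" and [measurable]: "U \<in> borel_measurable M" "W \<in> borel_measurable M"
    and ch: "\<And>s t. (CLINT x|M. iexp (s * U x + t * W x)) = exp (- (s\<^sup>2 * u + 2 * s * t * r + t\<^sup>2 * w) / 2)"
    and psd: "0 \<le> u" "0 \<le> w" "r\<^sup>2 \<le> u * w" and v: "0 \<le> v"
  shows "(CLINT x|M. iexp (U x * W x) * exp (- v * (U x)\<^sup>2 / 2)) =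
         (CLINT y|std_normal_distribution. exp (y\<^sup>2 * (\<i> * r - (u * (w + v) - r\<^sup>2) / 2)))"
proof -
  \<comment> \<open>Cholesky factor of the covariance matrix of \<open>U\<close> and
    \<open>W\<close>: in law, \<open>U\<close> is \<open>\<alpha> * y 0\<close> and \<open>W\<close>
    is \<open>\<gamma> * y 0 + \<delta> * y 1\<close>.\<close>
  define \<alpha> where "\<alpha> = sqrt u"
  define \<gamma> where "\<gamma> = r / sqrt u"
  define \<delta> where "\<delta> = sqrt (w - r\<^sup>2 / u)"
  have "r\<^sup>2 / u \<le> w"
    using psd by (cases "u = 0") (auto simp: divide_le_eq mult.commute)
  hence d: "\<delta>\<^sup>2 = w - r\<^sup>2 / u" by (simp add: \<delta>_def)
  have r0: "u = 0 \<Longrightarrow> r = 0" using psd by simp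
  have 1: "\<alpha>\<^sup>2 = u" "\<alpha> * \<gamma> = r" "\<gamma>\<^sup>2 + \<delta>\<^sup>2 = w" "u * \<delta>\<^sup>2 = u * w - r\<^sup>2"
    using psd r0 by (auto simp: \<alpha>_def \<gamma>_def d power_divide algebra_simps)
  interpret product_sigma_finite "\<lambda>_. std_normal_distribution"
    unfolding product_sigma_finite_def by (intro allI prob_space_imp_sigma_finite prob_space_std_normal)
  let ?G = "std_gauss {..<2::nat}"
  define f where "f j = (if j = 0 then U else W)" for j :: nat
  define f' where "f' j y = (if j = 0 then \<alpha> * y 0 else \<gamma> * y 0 + \<delta> * y 1)" for j :: nat and y :: "nat \<Rightarrow> real"
  have two: "{..<2::nat} = insert 1 {0}" by auto
  have eq: "(CLINT x|M. iexp (\<Sum>j<2. \<theta> j * f j x)) = (CLINT y|?G. iexp (\<Sum>j<2. \<theta> j * f' j y))" for \<theta> :: "nat \<Rightarrow> real"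
  proof -
    define c where "c k = (if k = 0 then \<theta> 0 * \<alpha> + \<theta> 1 * \<gamma> else \<theta> 1 * \<delta>)" for k :: nat
    have "(CLINT y|?G. iexp (\<Sum>j<2. \<theta> j * f' j y)) = (CLINT y|?G. iexp (\<Sum>k<2. c k * y k))"
      by (intro Bochner_Integration.integral_cong refl arg_cong[where f=iexp])
         (simp add: c_def f'_def numeral_2_eq_2 algebra_simps)
    also have "\<dots> = exp (- (\<Sum>k<2. (c k)\<^sup>2) / 2)" by (rule char_std_gauss) simp
    also have "(\<Sum>k<2. (c k)\<^sup>2) = (\<theta> 0)\<^sup>2 * \<alpha>\<^sup>2 + 2 * \<theta> 0 * \<theta> 1 * (\<alpha> * \<gamma>) + (\<theta> 1)\<^sup>2 * (\<gamma>\<^sup>2 + \<delta>\<^sup>2)"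
      by (simp add: c_def numeral_2_eq_2) (simp add: power2_eq_square algebra_simps)
    also have "complex_of_real (exp (- ((\<theta> 0)\<^sup>2 * \<alpha>\<^sup>2 + 2 * \<theta> 0 * \<theta> 1 * (\<alpha> * \<gamma>) + (\<theta> 1)\<^sup>2 * (\<gamma>\<^sup>2 + \<delta>\<^sup>2)) / 2))
       = (CLINT x|M. iexp (\<theta> 0 * U x + \<theta> 1 * W x))"
      unfolding 1 ch ..
    also have "\<dots> = (CLINT x|M. iexp (\<Sum>j<2. \<theta> j * f j x))" by (simp add: f_def numeral_2_eq_2)
    finally show ?thesis ..
  qed
  define h where "h z = iexp (z 0 * z 1) * complex_of_real (exp (- v * (z 0)\<^sup>2 / 2))" for z :: "nat \<Rightarrow> real"
  have hm[measurable]: "h \<in> borel_measurable (Pi\<^sub>M {..<2} (\<lambda>_. borel))" unfolding h_def by measurable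
  have fm: "f j \<in> borel_measurable M" for j by (simp add: f_def)
  have f'm: "f' j \<in> borel_measurable ?G" for j unfolding f'_def by measurable
  have "(CLINT x|M. h (\<lambda>j\<in>{..<2}. f j x)) = (CLINT y|?G. h (\<lambda>j\<in>{..<2}. f' j y))"
    by (rule expectation_uniqueness[OF assms(1) prob_space_std_gauss fm f'm eq hm])
  hence "(CLINT x|M. iexp (U x * W x) * exp (- v * (U x)\<^sup>2 / 2)) =
     (CLINT y|?G. iexp (\<alpha> * y 0 * (\<gamma> * y 0 + \<delta> * y 1)) * exp (- v * (\<alpha> * y 0)\<^sup>2 / 2))"
    by (simp add: h_def f_def f'_def)
  also have "\<dots> = (CLINT y|?G. exp ((y 0)\<^sup>2 * (\<i> * r - u * v / 2)) * iexp (\<alpha> * \<delta> * y 0 * y 1))"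
  proof (intro Bochner_Integration.integral_cong refl)
    fix y :: "nat \<Rightarrow> real"
    have "\<i> * complex_of_real (\<alpha> * y 0 * (\<gamma> * y 0 + \<delta> * y 1)) + complex_of_real (- v * (\<alpha> * y 0)\<^sup>2 / 2)
      = (y 0)\<^sup>2 * (\<i> * of_real (\<alpha> * \<gamma>) - of_real (\<alpha>\<^sup>2 * v / 2)) + \<i> * of_real (\<alpha> * \<delta> * y 0 * y 1)"
      by (simp add: power2_eq_square algebra_simps)
    thus "iexp (\<alpha> * y 0 * (\<gamma> * y 0 + \<delta> * y 1)) * exp (- v * (\<alpha> * y 0)\<^sup>2 / 2)
      = exp ((y 0)\<^sup>2 * (\<i> * r - u * v / 2)) * iexp (\<alpha> * \<delta> * y 0 * y 1)"
      unfolding 1 by (simp only: exp_of_real[symmetric] exp_add[symmetric] of_real_mult)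
  qed
  finally have step: "(CLINT x|M. iexp (U x * W x) * exp (- v * (U x)\<^sup>2 / 2)) =
     (CLINT y|?G. exp ((y 0)\<^sup>2 * (\<i> * r - u * v / 2)) * iexp (\<alpha> * \<delta> * y 0 * y 1))" .
  have uv: "u * v \<ge> 0" using psd v by simp
  have nm: "norm (exp (complex_of_real (x\<^sup>2) * (\<i> * r - u * v / 2))) \<le> 1" for x :: real
    using uv by (simp add: norm_exp_eq_Re)
  interpret G: prob_space ?G by (rule prob_space_std_gauss)
  have int: "integrable (Pi\<^sub>M (insert 1 {0::nat}) (\<lambda>_. std_normal_distribution))
      (\<lambda>y. exp (complex_of_real ((y 0)\<^sup>2) * (\<i> * r - u * v / 2)) * iexp (\<alpha> * \<delta> * y 0 * y 1))"
    unfolding two[symmetric] using nm by (intro G.integrable_const_bound[where B=1]) (auto simp: norm_mult)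
  \<comment> \<open>Integrating out \<open>y 1\<close> at fixed \<open>y 0 = x\<close> gives the
    factor \<open>exp (- (u * \<delta>\<^sup>2 * x\<^sup>2) / 2)\<close>; since
    \<open>u * \<delta>\<^sup>2 = u * w - r\<^sup>2\<close>, it merges with the \<open>u * v\<close>
    already present.\<close>
  have inner: "(CLINT y|std_normal_distribution. exp (complex_of_real (x\<^sup>2) * (\<i> * r - u * v / 2)) * iexp (\<alpha> * \<delta> * x * y))
     = exp (x\<^sup>2 * (\<i> * r - (u * (w + v) - r\<^sup>2) / 2))" for x :: real
  proof -
    have "(CLINT y|std_normal_distribution. exp (complex_of_real (x\<^sup>2) * (\<i> * r - u * v / 2)) * iexp (\<alpha> * \<delta> * x * y))
      = exp (complex_of_real (x\<^sup>2) * (\<i> * r - u * v / 2)) * char std_normal_distribution (\<alpha> * \<delta> * x)"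
      by (simp only: integral_mult_right_zero char_def)
    also have "\<dots> = exp (complex_of_real (x\<^sup>2) * (\<i> * r - u * v / 2)) * exp (complex_of_real (- (u * \<delta>\<^sup>2 * x\<^sup>2) / 2))"
    proof -
      have "(\<alpha> * \<delta> * x)\<^sup>2 = u * \<delta>\<^sup>2 * x\<^sup>2" by (simp add: power_mult_distrib 1(1))
      thus ?thesis by (simp only: char_std_normal_distribution exp_of_real)
    qed
    also have "\<dots> = exp (x\<^sup>2 * (\<i> * r - (u * (w + v) - r\<^sup>2) / 2))"
      unfolding 1 exp_add[symmetric] by (intro arg_cong[where f=exp]) (simp add: field_simps)
    finally show ?thesis .
  qed
  have "(CLINT y|?G. exp ((y 0)\<^sup>2 * (\<i> * r - u * v / 2)) * iexp (\<alpha> * \<delta> * y 0 * y 1)) =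
    (CLINT x|std_gauss {0::nat}. CLINT y|std_normal_distribution.
       exp (complex_of_real ((x 0)\<^sup>2) * (\<i> * r - u * v / 2)) * iexp (\<alpha> * \<delta> * x 0 * y))"
    unfolding two by (subst product_integral_insert[OF _ _ int]) auto
  also have "\<dots> = (CLINT x|std_gauss {0::nat}. exp ((x 0)\<^sup>2 * (\<i> * r - (u * (w + v) - r\<^sup>2) / 2)))"
    by (simp only: inner) (simp only: of_real_power)
  also have "\<dots> = (CLINT y|std_normal_distribution. exp (y\<^sup>2 * (\<i> * r - (u * (w + v) - r\<^sup>2) / 2)))"
    by (rule product_integral_singleton) simp
  finally show ?thesis unfolding step .
qed

section \<open>Integrating out the noise and factorising over the rows\<close>

text \<open>Independence makes the joint law a product, and Fubini then averages the second argument
  over a fresh \<open>\<omega>'\<close> with the first one frozen. This takes the place of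
  conditioning on the rows.\<close>

lemma (in prob_space) indep_var_expectation:
  fixes h :: "_ \<Rightarrow> complex"
  assumes ind: "indep_var S X T Y" and [measurable]: "h \<in> borel_measurable (S \<Otimes>\<^sub>M T)" and h: "\<And>z. norm (h z) \<le> 1"
  shows "(CLINT \<omega>|M. h (X \<omega>, Y \<omega>)) = (CLINT \<omega>|M. CLINT \<omega>'|M. h (X \<omega>, Y \<omega>'))"
proof -
  have [measurable]: "random_variable S X" "random_variable T Y"
    using ind by (auto simp: indep_var_distribution_eq)
  have eq: "distr M S X \<Otimes>\<^sub>M distr M T Y = distr M (S \<Otimes>\<^sub>M T) (\<lambda>x. (X x, Y x))"
    using ind by (simp add: indep_var_distribution_eq)
  interpret X: prob_space "distr M S X" by (rule prob_space_distr) simp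
  interpret Y: prob_space "distr M T Y" by (rule prob_space_distr) simp
  interpret pair_prob_space "distr M S X" "distr M T Y" ..
  have "(CLINT \<omega>|M. h (X \<omega>, Y \<omega>)) = (CLINT z|distr M (S \<Otimes>\<^sub>M T) (\<lambda>x. (X x, Y x)). h z)"
    by (subst integral_distr) auto
  also have "\<dots> = (CLINT z|distr M S X \<Otimes>\<^sub>M distr M T Y. h z)"
    by (simp only: eq)
  also have "\<dots> = (CLINT x|distr M S X. CLINT y|distr M T Y. h (x, y))"
    using h by (intro integral_fst'[symmetric] P.integrable_const_bound[where B=1]) auto
  also have "\<dots> = (CLINT x|distr M S X. CLINT \<omega>'|M. h (x, Y \<omega>'))"
  proof (intro Bochner_Integration.integral_cong refl)
    fix x assume "x \<in> space (distr M S X)"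
    hence [measurable]: "x \<in> space S" by simp
    show "(CLINT y|distr M T Y. h (x, y)) = (CLINT \<omega>'|M. h (x, Y \<omega>'))"
      by (subst integral_distr) auto
  qed
  also have "\<dots> = (CLINT \<omega>|M. CLINT \<omega>'|M. h (X \<omega>, Y \<omega>'))"
    by (subst integral_distr) auto
  finally show ?thesis .
qed

text \<open>The triangular factor turns the form into a Euclidean inner product of transformed
  vectors, from which its nonnegativity and its Cauchy-Schwarz inequality follow at once.\<close>

lemma rpow_bilinear_eq:
  assumes "\<bar>\<rho>\<bar> < 1"
  shows "(\<Sum>j<p. \<Sum>k<p. a j * b k * rpow \<rho> j k) =
    (\<Sum>m<p. (\<Sum>j<p. a j * ar_cholesky \<rho> j m) * (\<Sum>k<p. b k * ar_cholesky \<rho> k m))"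
proof -
  have "(\<Sum>j<p. \<Sum>k<p. a j * b k * rpow \<rho> j k) =
     (\<Sum>j<p. \<Sum>k<p. \<Sum>m<p. (a j * ar_cholesky \<rho> j m) * (b k * ar_cholesky \<rho> k m))"
  proof (intro sum.cong refl)
    fix j k assume "j \<in> {..<p}" "k \<in> {..<p}"
    hence "rpow \<rho> j k = (\<Sum>m<p. ar_cholesky \<rho> j m * ar_cholesky \<rho> k m)"
      using ar_cholesky_product[OF assms] by simp
    thus "a j * b k * rpow \<rho> j k = (\<Sum>m<p. (a j * ar_cholesky \<rho> j m) * (b k * ar_cholesky \<rho> k m))"
      by (simp add: sum_distrib_left mult_ac)
  qed
  also have "\<dots> = (\<Sum>j<p. \<Sum>m<p. \<Sum>k<p. (a j * ar_cholesky \<rho> j m) * (b k * ar_cholesky \<rho> k m))"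
    by (intro sum.cong refl sum.swap)
  also have "\<dots> = (\<Sum>m<p. \<Sum>j<p. \<Sum>k<p. (a j * ar_cholesky \<rho> j m) * (b k * ar_cholesky \<rho> k m))"
    by (rule sum.swap)
  finally show ?thesis by (simp add: sum_product)
qed

lemma rpow_psd:
  assumes "\<bar>\<rho>\<bar> < 1" shows "0 \<le> (\<Sum>j<p. \<Sum>k<p. a j * a k * rpow \<rho> j k)"
  unfolding rpow_bilinear_eq[OF assms] by (intro sum_nonneg) simp

lemma rpow_cauchy_schwarz:
  assumes "\<bar>\<rho>\<bar> < 1"
  shows "(\<Sum>j<p. \<Sum>k<p. a j * b k * rpow \<rho> j k)\<^sup>2 \<le>
    (\<Sum>j<p. \<Sum>k<p. a j * a k * rpow \<rho> j k) * (\<Sum>j<p. \<Sum>k<p. b j * b k * rpow \<rho> j k)"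
  unfolding rpow_bilinear_eq[OF assms] power2_eq_square[symmetric, of "sum _ _"]
  using Cauchy_Schwarz_ineq_sum[of "\<lambda>m. \<Sum>j<p. a j * ar_cholesky \<rho> j m" "\<lambda>m. \<Sum>k<p. b k * ar_cholesky \<rho> k m" "{..<p}"]
  by (simp add: power2_eq_square)

text \<open>With \<open>U i\<close> and \<open>W i\<close> the scalar products of row
  \<open>i\<close> with \<theta> and \<beta>, the exponent is the sum of the
  \<open>U i * (W i + eps i)\<close>. Averaging the noise at fixed rows leaves factors
  \<open>exp (- \<sigma>2 * (U i)\<^sup>2 / 2)\<close>, and independent rows of equal law give an
  \<open>n\<close>-th power. The integral is left as it stands because \<open>char_V\<close> arrives
  at the same one.\<close>

lemma char_XtY:
  fixes X :: "nat \<Rightarrow> nat \<Rightarrow> 'a \<Rightarrow> real" and eps :: "nat \<Rightarrow> 'a \<Rightarrow> real" and \<theta> \<beta> :: "nat \<Rightarrow> real"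
  assumes prob: "prob_space M" and \<rho>: "\<bar>\<rho>\<bar> < 1" and \<sigma>2: "\<sigma>2 \<ge> 0"
    and rows: "\<And>i. i < n \<Longrightarrow> centered_mvnormal M (X i) {..<p} (rpow \<rho>)"
    and noise: "centered_mvnormal M eps {..<n} (\<lambda>i i'. if i = i' then \<sigma>2 else 0)"
    and indep: "prob_space.indep_vars M
                  (\<lambda>k. Pi\<^sub>M {..<(if k < n then p else n)} (\<lambda>_. borel))
                  (\<lambda>k \<omega>. if k < n then restrict (\<lambda>j. X k j \<omega>) {..<p}
                                 else restrict (\<lambda>i. eps i \<omega>) {..<n})
                  {..n}"
  defines "u \<equiv> (\<Sum>j<p. \<Sum>k<p. \<theta> j * \<theta> k * rpow \<rho> j k)"
    and "r \<equiv> (\<Sum>j<p. \<Sum>k<p. \<theta> j * \<beta> k * rpow \<rho> j k)"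
  shows "(CLINT \<omega>|M. iexp (\<Sum>j<p. \<theta> j * (\<Sum>i<n. X i j \<omega> * ((\<Sum>k<p. X i k \<omega> * \<beta> k) + eps i \<omega>)))) =
     (CLINT y|std_normal_distribution. exp (y\<^sup>2 * (\<i> * r - (u * (kappa1p \<rho> \<beta> p + \<sigma>2) - r\<^sup>2) / 2))) ^ n"
proof -
  interpret prob_space M by fact
  have Xm[measurable]: "X i j \<in> borel_measurable M" if "i < n" "j < p" for i j
    using rows[OF that(1)] that(2) by (auto simp: centered_mvnormal_def)
  have em[measurable]: "eps i \<in> borel_measurable M" if "i < n" for i
    using noise that by (auto simp: centered_mvnormal_def)
  define M' :: "nat \<Rightarrow> (nat \<Rightarrow> real) measure" where "M' k = Pi\<^sub>M {..<(if k < n then p else n)} (\<lambda>_. borel)" for k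
  define D where "D k \<omega> = (if k < n then restrict (\<lambda>j. X k j \<omega>) {..<p} else restrict (\<lambda>i. eps i \<omega>) {..<n})" for k \<omega>
  have ind: "indep_vars M' D {..n}" using indep unfolding M'_def D_def .
  define U where "U i \<omega> = (\<Sum>j<p. \<theta> j * X i j \<omega>)" for i \<omega>
  define W where "W i \<omega> = (\<Sum>j<p. \<beta> j * X i j \<omega>)" for i \<omega>
  have Um[measurable]: "U i \<in> borel_measurable M" "W i \<in> borel_measurable M" if "i < n" for i
    unfolding U_def W_def using that by (auto intro!: borel_measurable_sum borel_measurable_times Xm)
  define h :: "(nat \<Rightarrow> nat \<Rightarrow> real) \<times> (nat \<Rightarrow> nat \<Rightarrow> real) \<Rightarrow> complex" where
    "h z = iexp (\<Sum>i<n. (\<Sum>j<p. \<theta> j * fst z i j) * ((\<Sum>j<p. \<beta> j * fst z i j) + snd z n i))" for z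
  have m1: "(\<lambda>z. fst z i j) \<in> borel_measurable (Pi\<^sub>M {..<n} M' \<Otimes>\<^sub>M Pi\<^sub>M {n} M')" if "i < n" "j < p" for i j
  proof -
    have "(\<lambda>z. fst z i) \<in> measurable (Pi\<^sub>M {..<n} M' \<Otimes>\<^sub>M Pi\<^sub>M {n} M') (M' i)"
      using that by (intro measurable_compose[OF measurable_fst measurable_component_singleton]) auto
    moreover have "(\<lambda>x. x j) \<in> borel_measurable (M' i)"
      using that by (auto simp: M'_def intro!: measurable_component_singleton)
    ultimately show ?thesis by (rule measurable_compose)
  qed
  have m2: "(\<lambda>z. snd z n i) \<in> borel_measurable (Pi\<^sub>M {..<n} M' \<Otimes>\<^sub>M Pi\<^sub>M {n} M')" if "i < n" for i
  proof -
    have "(\<lambda>z. snd z n) \<in> measurable (Pi\<^sub>M {..<n} M' \<Otimes>\<^sub>M Pi\<^sub>M {n} M') (M' n)"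
      by (intro measurable_compose[OF measurable_snd measurable_component_singleton]) auto
    moreover have "(\<lambda>x. x i) \<in> borel_measurable (M' n)"
      using that by (auto simp: M'_def intro!: measurable_component_singleton)
    ultimately show ?thesis by (rule measurable_compose)
  qed
  have "(\<lambda>z. \<Sum>i<n. (\<Sum>j<p. \<theta> j * fst z i j) * ((\<Sum>j<p. \<beta> j * fst z i j) + snd z n i))
      \<in> borel_measurable (Pi\<^sub>M {..<n} M' \<Otimes>\<^sub>M Pi\<^sub>M {n} M')"
    by (intro borel_measurable_sum borel_measurable_times borel_measurable_add m1 m2 borel_measurable_const) auto
  hence hm: "h \<in> borel_measurable (Pi\<^sub>M {..<n} M' \<Otimes>\<^sub>M Pi\<^sub>M {n} M')" unfolding h_def by measurable
  \<comment> \<open>In the independent family the indices below \<open>n\<close> are the rows and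
    index \<open>n\<close> is the noise vector.\<close>
  have iv: "indep_var (Pi\<^sub>M {..<n} M') (\<lambda>\<omega>. restrict (\<lambda>i. D i \<omega>) {..<n}) (Pi\<^sub>M {n} M') (\<lambda>\<omega>. restrict (\<lambda>i. D i \<omega>) {n})"
    by (rule indep_var_restrict[OF ind]) auto
  have hD: "h (restrict (\<lambda>i. D i \<omega>) {..<n}, restrict (\<lambda>i. D i \<omega>') {n}) = iexp (\<Sum>i<n. U i \<omega> * (W i \<omega> + eps i \<omega>'))" for \<omega> \<omega>'
    unfolding h_def U_def W_def by (intro arg_cong[where f=iexp] sum.cong refl) (simp add: D_def)
  have lhs: "(\<Sum>j<p. \<theta> j * (\<Sum>i<n. X i j \<omega> * ((\<Sum>k<p. X i k \<omega> * \<beta> k) + eps i \<omega>))) = (\<Sum>i<n. U i \<omega> * (W i \<omega> + eps i \<omega>))" for \<omega>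
    unfolding U_def W_def sum_distrib_left sum_distrib_right
    by (subst sum.swap) (simp add: mult_ac sum_distrib_left)
  have inner: "(CLINT \<omega>'|M. iexp (\<Sum>i<n. U i \<omega> * (W i \<omega> + eps i \<omega>'))) =
      (\<Prod>i<n. iexp (U i \<omega> * W i \<omega>) * exp (- \<sigma>2 * (U i \<omega>)\<^sup>2 / 2))" for \<omega>
  proof -
    have d: "(\<Sum>j<n. \<Sum>k<n. U j \<omega> * U k \<omega> * (if j = k then \<sigma>2 else 0)) = \<sigma>2 * (\<Sum>i<n. (U i \<omega>)\<^sup>2)"
      by (simp add: if_distrib[of "\<lambda>x. _ * x"] sum_distrib_left power2_eq_square mult_ac cong: if_cong)
    have "(CLINT \<omega>'|M. iexp (\<Sum>i<n. U i \<omega> * (W i \<omega> + eps i \<omega>'))) =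
       (CLINT \<omega>'|M. iexp (\<Sum>i<n. U i \<omega> * W i \<omega>) * iexp (\<Sum>i<n. U i \<omega> * eps i \<omega>'))"
      by (simp only: distrib_left sum.distrib of_real_add exp_add)
    also have "\<dots> = iexp (\<Sum>i<n. U i \<omega> * W i \<omega>) * exp (- (\<sigma>2 * (\<Sum>i<n. (U i \<omega>)\<^sup>2)) / 2)"
      using char_centered_mvnormal[OF noise, of "\<lambda>i. U i \<omega>"] \<sigma>2 unfolding d
      by (simp only: integral_mult_right_zero) (simp add: sum_nonneg)
    also have "iexp (\<Sum>i<n. U i \<omega> * W i \<omega>) = (\<Prod>i<n. iexp (U i \<omega> * W i \<omega>))"
      by (simp add: sum_distrib_left exp_sum)
    also have "exp (- (\<sigma>2 * (\<Sum>i<n. (U i \<omega>)\<^sup>2)) / 2) = (\<Prod>i<n. exp (- \<sigma>2 * (U i \<omega>)\<^sup>2 / 2))"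
      by (simp add: sum_distrib_left exp_sum[symmetric] sum_negf sum_divide_distrib)
    finally show ?thesis by (simp add: prod.distrib)
  qed
  define g :: "(nat \<Rightarrow> real) \<Rightarrow> complex" where
    "g z = iexp ((\<Sum>j<p. \<theta> j * z j) * (\<Sum>j<p. \<beta> j * z j)) * exp (- \<sigma>2 * (\<Sum>j<p. \<theta> j * z j)\<^sup>2 / 2)" for z
  have gm: "g \<in> borel_measurable (M' i)" if "i < n" for i
    unfolding g_def M'_def using that by simp
  have "indep_vars (\<lambda>_. borel) (\<lambda>i \<omega>. g (D i \<omega>)) {..<n}"
    using gm by (intro indep_vars_compose2[OF indep_vars_subset[OF ind]]) auto
  hence ig: "indep_vars (\<lambda>_. borel) (\<lambda>i \<omega>. iexp (U i \<omega> * W i \<omega>) * exp (- \<sigma>2 * (U i \<omega>)\<^sup>2 / 2)) {..<n}"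
    by (rule indep_vars_cong[THEN iffD1, rotated -1]) (auto simp: g_def D_def U_def W_def)
  have row: "(CLINT \<omega>|M. iexp (U i \<omega> * W i \<omega>) * exp (- \<sigma>2 * (U i \<omega>)\<^sup>2 / 2)) =
     (CLINT y|std_normal_distribution. exp (y\<^sup>2 * (\<i> * r - (u * (kappa1p \<rho> \<beta> p + \<sigma>2) - r\<^sup>2) / 2)))" if "i < n" for i
  proof (rule bivariate_gaussian_product)
    fix s t :: real
    define a where "a j = s * \<theta> j + t * \<beta> j" for j
    have sym: "(\<Sum>j<p. \<Sum>k<p. \<beta> j * \<theta> k * rpow \<rho> j k) = r"
      unfolding r_def by (subst sum.swap) (simp add: rpow_commute mult_ac)
    have "(\<Sum>j<p. \<Sum>k<p. a j * a k * rpow \<rho> j k) =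
      (\<Sum>j<p. \<Sum>k<p. s\<^sup>2 * (\<theta> j * \<theta> k * rpow \<rho> j k) + s * t * (\<theta> j * \<beta> k * rpow \<rho> j k)
        + s * t * (\<beta> j * \<theta> k * rpow \<rho> j k) + t\<^sup>2 * (\<beta> j * \<beta> k * rpow \<rho> j k))"
      unfolding a_def by (simp add: algebra_simps power2_eq_square)
    also have "\<dots> = s\<^sup>2 * u + s * t * r + s * t * r + t\<^sup>2 * kappa1p \<rho> \<beta> p"
      unfolding u_def r_def[symmetric] kappa1p_def by (simp only: sum.distrib sum_distrib_left[symmetric] sym r_def[symmetric])
    finally have a: "(\<Sum>j<p. \<Sum>k<p. a j * a k * rpow \<rho> j k) = s\<^sup>2 * u + 2 * s * t * r + t\<^sup>2 * kappa1p \<rho> \<beta> p" by simp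
    have "s * U i \<omega> + t * W i \<omega> = (\<Sum>j<p. a j * X i j \<omega>)" for \<omega>
      unfolding U_def W_def a_def by (simp add: sum_distrib_left sum.distrib[symmetric] algebra_simps)
    thus "(CLINT x|M. iexp (s * U i x + t * W i x)) = exp (- (s\<^sup>2 * u + 2 * s * t * r + t\<^sup>2 * kappa1p \<rho> \<beta> p) / 2)"
      using char_centered_mvnormal[OF rows[OF that] rpow_psd[OF \<rho>], of a] by (simp only: a)
  qed (use that prob Um \<sigma>2 rpow_psd[OF \<rho>] rpow_cauchy_schwarz[OF \<rho>] in \<open>auto simp: u_def r_def kappa1p_def\<close>)
  have "(CLINT \<omega>|M. iexp (\<Sum>i<n. U i \<omega> * (W i \<omega> + eps i \<omega>))) =
     (CLINT \<omega>|M. h (restrict (\<lambda>i. D i \<omega>) {..<n}, restrict (\<lambda>i. D i \<omega>) {n}))" by (simp only: hD)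
  also have "\<dots> = (CLINT \<omega>|M. CLINT \<omega>'|M. h (restrict (\<lambda>i. D i \<omega>) {..<n}, restrict (\<lambda>i. D i \<omega>') {n}))"
    by (rule indep_var_expectation[OF iv hm]) (simp add: h_def)
  also have "\<dots> = (CLINT \<omega>|M. (\<Prod>i<n. iexp (U i \<omega> * W i \<omega>) * exp (- \<sigma>2 * (U i \<omega>)\<^sup>2 / 2)))"
    by (simp only: hD inner)
  also have "\<dots> = (\<Prod>i<n. CLINT \<omega>|M. iexp (U i \<omega> * W i \<omega>) * exp (- \<sigma>2 * (U i \<omega>)\<^sup>2 / 2))"
  proof (intro indep_vars_lebesgue_integral ig)
    fix i assume "i \<in> {..<n}"
    thus "integrable M (\<lambda>\<omega>. iexp (U i \<omega> * W i \<omega>) * exp (- \<sigma>2 * (U i \<omega>)\<^sup>2 / 2))"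
      using \<sigma>2 by (intro integrable_const_bound[where B=1]) (auto simp: norm_mult)
  qed simp
  also have "\<dots> = (CLINT y|std_normal_distribution. exp (y\<^sup>2 * (\<i> * r - (u * (kappa1p \<rho> \<beta> p + \<sigma>2) - r\<^sup>2) / 2))) ^ n"
    using row by simp
  finally show ?thesis unfolding lhs .
qed

section \<open>The canonical representation\<close>

lemma pair_prob_integral_prod:
  fixes f :: "'a \<Rightarrow> 'c::{real_normed_field, banach, second_countable_topology}" and g :: "'b \<Rightarrow> 'c"
  assumes "prob_space M1" "prob_space M2" and f: "integrable M1 f" and g: "integrable M2 g"
  shows "integrable (M1 \<Otimes>\<^sub>M M2) (\<lambda>z. f (fst z) * g (snd z))" (is ?i)
    and "(LINT z|(M1 \<Otimes>\<^sub>M M2). f (fst z) * g (snd z)) = (LINT x|M1. f x) * (LINT y|M2. g y)" (is ?e)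
proof -
  interpret M1: prob_space M1 by fact
  interpret M2: prob_space M2 by fact
  interpret pair_prob_space M1 M2 ..
  have [measurable]: "f \<in> borel_measurable M1" "g \<in> borel_measurable M2" using f g by auto
  show i: ?i
  proof (rule Fubini_integrable)
    show "integrable M1 (\<lambda>x. LINT y|M2. norm (f (fst (x, y)) * g (snd (x, y))))"
      using f g by (simp add: norm_mult)
    show "AE x in M1. integrable M2 (\<lambda>y. f (fst (x, y)) * g (snd (x, y)))"
      using g by simp
  qed measurable
  have "(LINT z|(M1 \<Otimes>\<^sub>M M2). f (fst z) * g (snd z)) = (LINT x|M1. LINT y|M2. f (fst (x, y)) * g (snd (x, y)))"
    by (rule integral_fst'[OF i, symmetric])
  thus ?e using f g by simp
qed

text \<open>The model lives on a product space: \<open>A\<close> supplies \<open>n\<close> standard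
  normals whose squares sum to \<open>Q\<close>, \<open>B\<close> supplies a vector with covariance
  \<Sigma>. The sizes \<open>n\<close> and \<open>p\<close> are fixed, so every estimate inside is
  non-asymptotic.\<close>

locale canonical_model =
  fixes \<rho> \<sigma>2 :: real and \<beta> :: "nat \<Rightarrow> real" and n p :: nat
  assumes \<rho>: "\<bar>\<rho>\<bar> < 1" and \<sigma>2: "0 < \<sigma>2" and n: "0 < n"
begin

sublocale A: gauss_vector "{..<n}" "{..<n}" "\<lambda>j k. if j = k then 1 else 0"
  by unfold_locales auto

sublocale B: gauss_vector "{..<p}" "{..<p}" "ar_cholesky \<rho>"
  by unfold_locales auto

abbreviation R where "R \<equiv> A.P \<Otimes>\<^sub>M B.P"

definition \<kappa>1 where "\<kappa>1 = kappa1p \<rho> \<beta> p"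
definition \<kappa>2 where "\<kappa>2 = kappa2p \<rho> \<beta> p"
definition \<kappa>3 where "\<kappa>3 = kappa3p \<rho> \<beta> p"
definition \<tau> where "\<tau> = sqrt (\<kappa>1 + \<sigma>2)"
text \<open>\<open>\<mu>\<close> solves \<open>2 \<mu> - \<mu>\<^sup>2 \<kappa>1 = 1 / \<tau>\<^sup>2\<close>, which gives the vector \<open>G\<close> below the covariance
  \<open>\<Sigma> - b b\<^sup>T / \<tau>\<^sup>2\<close> without an additional source of randomness.\<close>

definition \<mu> where "\<mu> = 1 / (\<tau> * (\<tau> + sqrt \<sigma>2))"
definition b where "b k = (\<Sum>l<p. \<beta> l * rpow \<rho> k l)"
definition trace2 where "trace2 = (\<Sum>k<p. \<Sum>l<p. (rpow \<rho> k l)\<^sup>2)"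

definition Q :: "(nat \<Rightarrow> real) \<Rightarrow> real" where "Q x = (\<Sum>i<n. (x i)\<^sup>2)"
definition W where "W y = (\<Sum>j<p. \<beta> j * B.Z j y)"
definition Wb where "Wb y = (\<Sum>j<p. b j * B.Z j y)"
definition G where "G j y = B.Z j y - \<mu> * b j * W y"
definition V where "V j z = b j * Q (fst z) + \<tau> * sqrt (Q (fst z)) * G j (snd z)"

lemma A_Z: "j < n \<Longrightarrow> A.Z j x = x j"
  by (simp add: A.Z_def if_distrib[of "\<lambda>c. c * _"] cong: if_cong)

lemma A_C: "j < n \<Longrightarrow> k < n \<Longrightarrow> A.C j k = (if j = k then 1 else 0)"
  by (simp add: A.C_def if_distrib[of "\<lambda>c. c * _"] cong: if_cong)

lemma B_C: "j < p \<Longrightarrow> k < p \<Longrightarrow> B.C j k = rpow \<rho> j k"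
  by (simp add: B.C_def ar_cholesky_product \<rho>)

lemma \<kappa>1_nonneg: "0 \<le> \<kappa>1"
  unfolding \<kappa>1_def kappa1p_def by (rule rpow_psd[OF \<rho>])

lemma \<kappa>2_eq: "\<kappa>2 = (\<Sum>j<p. (b j)\<^sup>2)"
  by (simp add: \<kappa>2_def kappa2p_def b_def)

lemma \<kappa>2_nonneg: "0 \<le> \<kappa>2"
  unfolding \<kappa>2_eq by (simp add: sum_nonneg)

lemma \<tau>_sq: "\<tau>\<^sup>2 = \<kappa>1 + \<sigma>2" and \<tau>_pos: "0 < \<tau>"
  using \<kappa>1_nonneg \<sigma>2 by (auto simp: \<tau>_def)

lemma \<mu>_nonneg: "0 \<le> \<mu>"
  using \<tau>_pos \<sigma>2 by (simp add: \<mu>_def)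

text \<open>With s = sqrt \<sigma>2 one has \<kappa>1 = \<tau>^2 - s^2, and \<mu> is the root
  (\<tau> - s) / (\<tau> \<kappa>1) of the quadratic equation, rationalised so that it also makes
  sense for \<kappa>1 = 0.\<close>

lemma \<mu>_eq: "2 * \<mu> - \<mu>\<^sup>2 * \<kappa>1 = 1 / \<tau>\<^sup>2"
proof -
  define s where "s = sqrt \<sigma>2"
  have s: "s > 0" "\<sigma>2 = s\<^sup>2" using \<sigma>2 by (auto simp: s_def)
  have k: "\<kappa>1 = (\<tau> - s) * (\<tau> + s)" using \<tau>_sq s by (simp add: power2_eq_square algebra_simps)
  have "\<mu> * \<kappa>1 = (\<tau> - s) / \<tau>"
  proof -
    have "\<mu> * \<kappa>1 = ((\<tau> - s) * (\<tau> + s)) / (\<tau> * (\<tau> + s))" unfolding k \<mu>_def s_def[symmetric] by simp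
    also have "\<dots> = (\<tau> - s) / \<tau>" using \<tau>_pos s(1) by (intro nonzero_mult_divide_mult_cancel_right) auto
    finally show ?thesis .
  qed
  moreover have "2 * \<mu> - \<mu>\<^sup>2 * \<kappa>1 = \<mu> * (2 - \<mu> * \<kappa>1)" by (simp add: power2_eq_square algebra_simps)
  ultimately have "2 * \<mu> - \<mu>\<^sup>2 * \<kappa>1 = \<mu> * (2 - (\<tau> - s) / \<tau>)" by simp
  also have "\<dots> = \<mu> * ((\<tau> + s) / \<tau>)" using \<tau>_pos by (simp add: field_simps)
  also have "\<dots> = 1 / \<tau>\<^sup>2" unfolding \<mu>_def s_def[symmetric] using \<tau>_pos s(1) by (simp add: power2_eq_square)
  finally show ?thesis .
qed

lemma b_bilinear: "(\<Sum>j<p. \<Sum>k<p. a j * \<beta> k * rpow \<rho> j k) = (\<Sum>j<p. a j * b j)"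
  by (simp add: b_def sum_distrib_left mult_ac)

lemma bb_bilinear: "(\<Sum>j<p. \<Sum>k<p. b j * b k * rpow \<rho> j k) = \<kappa>3"
proof -
  have "b j * b k * rpow \<rho> j k = (\<Sum>i<p. \<Sum>i'<p. \<beta> i * \<beta> i' * rpow \<rho> j i * rpow \<rho> k i' * rpow \<rho> j k)" for j k
    unfolding b_def sum_product unfolding sum_distrib_right by (simp add: mult_ac)
  thus ?thesis by (simp add: \<kappa>3_def kappa3p_def)
qed

text \<open>The covariance of a \<cdot> Z and \<beta> \<cdot> Z is a \<cdot> b, because b =
  \<Sigma>\<beta>. Both the vector \<open>e\<close> in \<open>char_V\<close> and the coefficients
  \<open>d\<close> of the linear term below have this shape.\<close>

lemma linear_combination_variance:
  "(\<Sum>j<p. \<Sum>k<p. (s * a j + t * \<beta> j) * (s * a k + t * \<beta> k) * rpow \<rho> j k) =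
     s\<^sup>2 * (\<Sum>j<p. \<Sum>k<p. a j * a k * rpow \<rho> j k) + 2 * s * t * (\<Sum>j<p. a j * b j) + t\<^sup>2 * \<kappa>1"
proof -
  have sym: "(\<Sum>j<p. \<Sum>k<p. \<beta> j * a k * rpow \<rho> j k) = (\<Sum>j<p. a j * b j)"
    unfolding b_bilinear[symmetric] by (subst sum.swap) (simp add: rpow_commute mult_ac)
  have "(\<Sum>j<p. \<Sum>k<p. (s * a j + t * \<beta> j) * (s * a k + t * \<beta> k) * rpow \<rho> j k) =
      (\<Sum>j<p. \<Sum>k<p. s\<^sup>2 * (a j * a k * rpow \<rho> j k) + s * t * (a j * \<beta> k * rpow \<rho> j k)
        + s * t * (\<beta> j * a k * rpow \<rho> j k) + t\<^sup>2 * (\<beta> j * \<beta> k * rpow \<rho> j k))"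
    by (simp add: algebra_simps power2_eq_square)
  also have "\<dots> = s\<^sup>2 * (\<Sum>j<p. \<Sum>k<p. a j * a k * rpow \<rho> j k) + s * t * (\<Sum>j<p. a j * b j)
      + s * t * (\<Sum>j<p. a j * b j) + t\<^sup>2 * \<kappa>1"
    unfolding \<kappa>1_def kappa1p_def by (simp only: sum.distrib sum_distrib_left[symmetric] sym b_bilinear)
  finally show ?thesis by simp
qed

lemma Q_nonneg: "0 \<le> Q x" by (simp add: Q_def sum_nonneg)

lemma B_eg: "exp_growth {..<p} W" "exp_growth {..<p} Wb" "exp_growth {..<p} (G j)"
  unfolding W_def Wb_def G_def by (intro B.growth)+

lemma Q_eg: "exp_growth {..<n} Q"
  unfolding Q_def by (intro exp_growth_intros) auto

lemma measurable_B[measurable]: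
  "W \<in> borel_measurable B.P" "Wb \<in> borel_measurable B.P" "G j \<in> borel_measurable B.P" "Q \<in> borel_measurable A.P"
  using B_eg Q_eg by (auto dest: exp_growth_measurable)

lemma V_measurable[measurable]: "V j \<in> borel_measurable R"
  unfolding V_def by measurable

text \<open>At fixed \<open>x\<close> the linear combination is Gaussian with mean
  \<open>r * Q x\<close> and variance
  \<open>Q x * (u * (\<kappa>1 + \<sigma>2) - r\<^sup>2)\<close>. Both are multiples of
  \<open>Q x\<close>, a sum of squares, so the exponential splits into \<open>n\<close> equal
  one-dimensional integrals, those of \<open>char_XtY\<close>.\<close>

lemma char_V:
  fixes \<theta> :: "nat \<Rightarrow> real"
  defines "u \<equiv> (\<Sum>j<p. \<Sum>k<p. \<theta> j * \<theta> k * rpow \<rho> j k)"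
    and "r \<equiv> (\<Sum>j<p. \<Sum>k<p. \<theta> j * \<beta> k * rpow \<rho> j k)"
  shows "(CLINT z|R. iexp (\<Sum>j<p. \<theta> j * V j z)) =
     (CLINT y|std_normal_distribution. exp (y\<^sup>2 * (\<i> * r - (u * (kappa1p \<rho> \<beta> p + \<sigma>2) - r\<^sup>2) / 2))) ^ n"
proof -
  interpret pA: prob_space A.P by (rule prob_space_std_gauss)
  interpret pB: prob_space B.P by (rule prob_space_std_gauss)
  interpret R: pair_prob_space A.P B.P ..
  interpret product_sigma_finite "\<lambda>_. std_normal_distribution"
    unfolding product_sigma_finite_def by (intro allI prob_space_imp_sigma_finite prob_space_std_normal)
  interpret N: prob_space std_normal_distribution by (rule prob_space_std_normal)
  have r: "r = (\<Sum>j<p. \<theta> j * b j)" unfolding r_def by (rule b_bilinear)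
  \<comment> \<open>The transpose of the map from \<open>Z\<close> to \<open>G\<close>, applied to
    \<theta>: combining the \<open>G j\<close> with weights \<theta> is combining the
    \<open>Z j\<close> with weights \<open>e\<close>.\<close>
  define e where "e j = 1 * \<theta> j + (- \<mu> * r) * \<beta> j" for j
  have vv: "\<tau>\<^sup>2 * (\<Sum>j<p. \<Sum>k<p. e j * e k * rpow \<rho> j k) = u * (\<kappa>1 + \<sigma>2) - r\<^sup>2"
  proof -
    have "(\<Sum>j<p. \<Sum>k<p. e j * e k * rpow \<rho> j k) = u - r\<^sup>2 * (2 * \<mu> - \<mu>\<^sup>2 * \<kappa>1)"
      unfolding e_def linear_combination_variance u_def[symmetric] r[symmetric]
      by (simp add: power2_eq_square algebra_simps)
    thus ?thesis unfolding \<mu>_eq \<tau>_sq[symmetric] using \<tau>_pos by (simp add: field_simps)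
  qed
  have vv0: "0 \<le> u * (\<kappa>1 + \<sigma>2) - r\<^sup>2"
    unfolding vv[symmetric] using rpow_psd[OF \<rho>, of e p] by simp
  have sumV: "(\<Sum>j<p. \<theta> j * V j (x, y)) = r * Q x + (\<Sum>j<p. (\<tau> * sqrt (Q x) * e j) * B.Z j y)" for x y
  proof -
    have "(\<Sum>j<p. \<theta> j * G j y) = (\<Sum>j<p. \<theta> j * B.Z j y) - \<mu> * r * W y"
      unfolding G_def r by (simp add: right_diff_distrib sum_subtractf sum_distrib_left sum_distrib_right mult_ac)
    also have "\<dots> = (\<Sum>j<p. e j * B.Z j y)"
      unfolding W_def e_def by (simp add: algebra_simps sum_distrib_left sum_subtractf)
    finally have g: "(\<Sum>j<p. \<theta> j * G j y) = (\<Sum>j<p. e j * B.Z j y)" .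
    have "(\<Sum>j<p. \<theta> j * V j (x, y)) = Q x * r + \<tau> * sqrt (Q x) * (\<Sum>j<p. \<theta> j * G j y)"
      unfolding V_def r sum_distrib_left by (simp add: sum.distrib[symmetric] algebra_simps)
    thus ?thesis unfolding g by (simp add: sum_distrib_left mult_ac)
  qed
  have inner: "(CLINT y|B.P. iexp (\<Sum>j<p. \<theta> j * V j (x, y))) = (\<Prod>i<n. exp (complex_of_real ((x i)\<^sup>2) * (\<i> * r - (u * (\<kappa>1 + \<sigma>2) - r\<^sup>2) / 2)))" for x
  proof -
    have c: "(\<Sum>j<p. \<Sum>k<p. (\<tau> * sqrt (Q x) * e j) * (\<tau> * sqrt (Q x) * e k) * B.C j k) = Q x * (u * (\<kappa>1 + \<sigma>2) - r\<^sup>2)"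
    proof -
      have "(\<Sum>j<p. \<Sum>k<p. (\<tau> * sqrt (Q x) * e j) * (\<tau> * sqrt (Q x) * e k) * B.C j k)
        = (\<Sum>j<p. \<Sum>k<p. (\<tau>\<^sup>2 * (sqrt (Q x))\<^sup>2) * (e j * e k * rpow \<rho> j k))"
        by (intro sum.cong refl) (simp add: B_C power2_eq_square mult_ac)
      thus ?thesis unfolding sum_distrib_left[symmetric] vv[symmetric] using Q_nonneg[of x] by simp
    qed
    have "(CLINT y|B.P. iexp (\<Sum>j<p. \<theta> j * V j (x, y))) = (CLINT y|B.P. iexp (r * Q x) * iexp (\<Sum>j<p. (\<tau> * sqrt (Q x) * e j) * B.Z j y))"
      by (simp only: sumV of_real_add distrib_left exp_add)
    also have "\<dots> = iexp (r * Q x) * exp (- (Q x * (u * (\<kappa>1 + \<sigma>2) - r\<^sup>2)) / 2)"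
      using B.char_linear[of "\<lambda>j. \<tau> * sqrt (Q x) * e j"] unfolding c by (simp only: integral_mult_right_zero)
    also have "\<dots> = exp (complex_of_real (Q x) * (\<i> * r - (u * (\<kappa>1 + \<sigma>2) - r\<^sup>2) / 2))"
      unfolding exp_of_real[symmetric] exp_add[symmetric] by (intro arg_cong[where f=exp]) (simp add: field_simps)
    also have "\<dots> = (\<Prod>i<n. exp (complex_of_real ((x i)\<^sup>2) * (\<i> * r - (u * (\<kappa>1 + \<sigma>2) - r\<^sup>2) / 2)))"
      unfolding Q_def of_real_sum sum_distrib_right by (rule exp_sum) simp
    finally show ?thesis .
  qed
  have "(CLINT z|R. iexp (\<Sum>j<p. \<theta> j * V j z)) = (CLINT x|A.P. CLINT y|B.P. iexp (\<Sum>j<p. \<theta> j * V j (x, y)))"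
    by (rule R.integral_fst'[symmetric]) (intro R.P.integrable_const_bound[where B=1]; auto)
  also have "\<dots> = (\<Prod>i<n. CLINT y|std_normal_distribution. exp (complex_of_real (y\<^sup>2) * (\<i> * r - (u * (\<kappa>1 + \<sigma>2) - r\<^sup>2) / 2)))"
    unfolding inner
  proof (intro product_integral_prod N.integrable_const_bound[where B=1] AE_I2)
    fix y :: real
    show "norm (exp (complex_of_real (y\<^sup>2) * (\<i> * r - (u * (\<kappa>1 + \<sigma>2) - r\<^sup>2) / 2))) \<le> 1"
      using vv0 by (simp add: norm_exp_eq_Re)
  qed auto
  finally show ?thesis by (simp add: \<kappa>1_def)
qed

section \<open>Linearisation of the statistic\<close>

definition stat :: "(nat \<Rightarrow> real) \<Rightarrow> real" where
  "stat v = ((\<Sum>j<p. (v j)\<^sup>2) - (real n)\<^sup>2 * \<kappa>2 - real p * real n * (\<kappa>1 + \<sigma>2)) / real n powr (3/2)"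

text \<open>First-order expansion of \<kappa>2 Q^2 + \<tau>^2 Q |Z|^2 at Q = n and |Z|^2 = p: the
  coefficient of Q - n is 2 \<kappa>2 n + \<tau>^2 p, that of |Z|^2 - p is \<tau>^2 n. Division by
  n^(3/2) gives \<open>a0\<close> and \<open>b0\<close>. The vector \<open>d\<close> is made so that
  d \<cdot> Z = 2 \<tau> b \<cdot> G, using b \<cdot> b = \<kappa>2.\<close>

definition a0 where "a0 = (2 * \<kappa>2 + \<tau>\<^sup>2 * p / n) / sqrt n"
definition b0 where "b0 = \<tau>\<^sup>2 / sqrt n"
definition d where "d j = 2 * \<tau> * b j + (- 2 * \<tau> * \<mu> * \<kappa>2) * \<beta> j"
definition S where "S z = stat (\<lambda>j. V j z)"
definition Slin where "Slin z = A.form a0 (\<lambda>_. 0) (fst z) + B.form b0 d (snd z)"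

text \<open>As \<open>G\<close> has covariance \<Sigma> - b b^T / \<tau>^2, the variance of 2 \<tau>
  b \<cdot> G is 4 \<tau>^2 (\<kappa>3 - \<kappa>2^2 / \<tau>^2).\<close>

lemma d_variance: "(\<Sum>j<p. \<Sum>k<p. d j * d k * rpow \<rho> j k) = 4 * \<tau>\<^sup>2 * \<kappa>3 - 4 * \<kappa>2\<^sup>2"
proof -
  have "(\<Sum>j<p. \<Sum>k<p. d j * d k * rpow \<rho> j k) = 4 * \<tau>\<^sup>2 * \<kappa>3 - 4 * \<kappa>2\<^sup>2 * (\<tau>\<^sup>2 * (2 * \<mu> - \<mu>\<^sup>2 * \<kappa>1))"
    unfolding d_def linear_combination_variance bb_bilinear
    by (simp add: \<kappa>2_eq[symmetric] power2_eq_square[symmetric]) (simp add: power2_eq_square algebra_simps)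
  thus ?thesis unfolding \<mu>_eq using \<tau>_pos by simp
qed

definition Zsq where "Zsq y = (\<Sum>j<p. (B.Z j y)\<^sup>2)"

lemma A_form: "A.form a (\<lambda>_. 0) x = a * (Q x - n)"
  by (simp add: A.form_def A_Z A_C Q_def)

lemma B_form: "B.form a e y = a * (Zsq y - p) + (\<Sum>j<p. e j * B.Z j y)"
  by (simp add: B.form_def B_C Zsq_def)

lemma d_linear: "(\<Sum>j<p. d j * B.Z j y) = 2 * \<tau> * (Wb y - \<mu> * \<kappa>2 * W y)"
  unfolding d_def Wb_def W_def by (simp add: algebra_simps sum_distrib_left sum.distrib sum_subtractf)

text \<open>The exact remainder of the expansion: the square of \<open>Q - n\<close>, the rank-one
  terms by which |G|^2 differs from |Z|^2, the product of two independent deviations, and the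
  replacement of Q^(3/2) by n^(3/2) in the linear term. While \<open>p / n\<close> and the kappas
  stay bounded, each has mean absolute value of order \<open>n\<close>, against the normalisation
  \<open>n * sqrt n\<close>.\<close>

lemma S_minus_Slin:
  "real n * sqrt n * (S z - Slin z) = \<kappa>2 * (Q (fst z) - n)\<^sup>2
     + \<tau>\<^sup>2 * (Q (fst z) * (\<mu>\<^sup>2 * \<kappa>2 * (W (snd z))\<^sup>2 - 2 * \<mu> * W (snd z) * Wb (snd z)) + (Q (fst z) - n) * (Zsq (snd z) - p))
     + (\<Sum>j<p. d j * B.Z j (snd z)) * (Q (fst z) * sqrt (Q (fst z)) - n * sqrt n)"
proof -
  define q where "q = Q (fst z)"
  define y where "y = snd z"
  define s where "s = sqrt q"
  have s: "s\<^sup>2 = q" using Q_nonneg by (simp add: s_def q_def)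
  define D where "D = (\<Sum>j<p. d j * B.Z j y)"
  define m where "m = sqrt n"
  have m: "m > 0" "m\<^sup>2 = n" using n by (auto simp: m_def)
  have bG: "(\<Sum>j<p. b j * G j y) = D / (2 * \<tau>)"
  proof -
    have "(\<Sum>j<p. b j * G j y) = Wb y - \<mu> * \<kappa>2 * W y"
      unfolding G_def Wb_def \<kappa>2_eq
      by (simp add: right_diff_distrib sum_subtractf sum_distrib_left sum_distrib_right power2_eq_square mult_ac)
    thus ?thesis unfolding D_def d_linear using \<tau>_pos by simp
  qed
  have GG: "(\<Sum>j<p. (G j y)\<^sup>2) = Zsq y - 2 * \<mu> * W y * Wb y + \<mu>\<^sup>2 * \<kappa>2 * (W y)\<^sup>2"
    unfolding G_def power2_diff Zsq_def Wb_def \<kappa>2_eq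
    by (simp add: sum.distrib sum_subtractf sum_distrib_left sum_distrib_right power2_eq_square mult_ac)
  have "(\<Sum>j<p. (V j z)\<^sup>2) = q\<^sup>2 * (\<Sum>j<p. (b j)\<^sup>2) + 2 * q * \<tau> * s * (\<Sum>j<p. b j * G j y) + \<tau>\<^sup>2 * s\<^sup>2 * (\<Sum>j<p. (G j y)\<^sup>2)"
    unfolding V_def q_def[symmetric] s_def[symmetric] y_def[symmetric]
    by (simp add: power2_sum power_mult_distrib sum.distrib sum_distrib_left mult_ac)
  also have "\<dots> = q\<^sup>2 * \<kappa>2 + q * s * D + \<tau>\<^sup>2 * q * (Zsq y - 2 * \<mu> * W y * Wb y + \<mu>\<^sup>2 * \<kappa>2 * (W y)\<^sup>2)"
    unfolding bG GG s \<kappa>2_eq[symmetric] using \<tau>_pos by simp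
  finally have V2: "(\<Sum>j<p. (V j z)\<^sup>2) = q\<^sup>2 * \<kappa>2 + q * s * D + \<tau>\<^sup>2 * q * (Zsq y - 2 * \<mu> * W y * Wb y + \<mu>\<^sup>2 * \<kappa>2 * (W y)\<^sup>2)" .
  have pw: "real n powr (3/2) = real n * m"
  proof -
    have "real n powr (3/2) = real n powr (1 + 1/2)" by simp
    also have "\<dots> = real n * m" unfolding powr_add m_def using n by (simp add: powr_half_sqrt)
    finally show ?thesis .
  qed
  have 1: "real n * m * S z = (\<Sum>j<p. (V j z)\<^sup>2) - (real n)\<^sup>2 * \<kappa>2 - real p * real n * \<tau>\<^sup>2"
    unfolding S_def stat_def pw \<tau>_sq using m n by simp
  have 2: "real n * m * Slin z = real n * (2 * \<kappa>2 + \<tau>\<^sup>2 * p / n) * (q - n) + n * \<tau>\<^sup>2 * (Zsq y - p) + n * m * D"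
    unfolding Slin_def A_form B_form a0_def b0_def q_def[symmetric] y_def[symmetric] D_def[symmetric] m_def[symmetric]
    using m(1) by (simp add: field_simps)
  have 3: "real n * (2 * \<kappa>2 + \<tau>\<^sup>2 * p / n) = 2 * \<kappa>2 * n + \<tau>\<^sup>2 * p" using n by (simp add: field_simps)
  show ?thesis
    unfolding q_def[symmetric] y_def[symmetric] s_def[symmetric] D_def[symmetric] m_def[symmetric]
      right_diff_distrib[of _ "S z"] 1 2 3 V2
    by (simp add: algebra_simps power2_eq_square)
qed

end

section \<open>Mean absolute error of the linearisation\<close>

context gauss_vector begin

text \<open>\<open>quad\<close> with the identity matrix \<open>\<delta>\<close> is the centred
  squared norm, and the variance formula reduces to 2 tr(C^2).\<close>

lemma expectation_sq_norm_variance: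
  "(LINT x|P. ((\<Sum>j\<in>J. (Z j x)\<^sup>2) - (\<Sum>j\<in>J. C j j))\<^sup>2) = 2 * (\<Sum>j\<in>J. \<Sum>j'\<in>J. (C j j')\<^sup>2)"
proof -
  define \<delta> :: "'j \<Rightarrow> 'j \<Rightarrow> real" where "\<delta> j j' = (if j' = j then 1 else 0)" for j j'
  have \<delta>: "(\<Sum>j'\<in>J. \<delta> j j' * f j') = f j" if "j \<in> J" for j and f :: "'j \<Rightarrow> real"
  proof -
    have "(\<Sum>j'\<in>J. \<delta> j j' * f j') = (\<Sum>j'\<in>J. f j' *\<^sub>R \<delta> j j')" by (simp add: mult.commute)
    also have "\<dots> = f j"
      unfolding \<delta>_def sum_scaleR_delta[OF fin(2) that] by simp
    finally show ?thesis .
  qed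
  have "quad \<delta> x = (\<Sum>j\<in>J. (Z j x)\<^sup>2) - (\<Sum>j\<in>J. C j j)" for x
    unfolding quad_def by (simp add: \<delta> power2_eq_square sum_subtractf)
  moreover have "(\<Sum>i\<in>J. \<Sum>i'\<in>J. \<delta> j i * \<delta> j' i' * C i i') = C j j'" if "j \<in> J" "j' \<in> J" for j j'
    using that by (simp add: mult.assoc sum_distrib_left[symmetric] \<delta>)
  moreover have "\<delta> i j = \<delta> j i" for i j by (simp add: \<delta>_def)
  ultimately show ?thesis
    using expectation_quad_sq[of \<delta>] by (simp add: power2_eq_square)
qed

lemma expectation_abs_linear_le:
  "(LINT x|P. \<bar>\<Sum>j\<in>J. e j * Z j x\<bar>) \<le> sqrt (\<Sum>j\<in>J. \<Sum>j'\<in>J. e j * e j' * C j j')"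
  unfolding expectation_linear_sq[symmetric]
  by (intro expectation_abs_le_sqrt prob_space_std_gauss exp_growth_integrable fin growth)

end

lemma norm_iexp_diff_le: "norm (iexp x - iexp y) \<le> \<bar>x - y\<bar>"
proof -
  have "iexp x - iexp y = iexp y * (iexp (x - y) - 1)"
    by (simp add: right_diff_distrib exp_add[symmetric])
  also have "norm \<dots> = norm (iexp (x - y) - 1)" by (simp add: norm_mult)
  also have "\<dots> \<le> \<bar>x - y\<bar>" using iexp_approx1[of "x - y" 0] by simp
  finally show ?thesis .
qed

text \<open>With x = sqrt q and y = sqrt m the difference is
  \<open>(x - y) * (x\<^sup>2 + x * y + y\<^sup>2)\<close>, and the second factor is at most
  \<open>(x + y) * (y + x\<^sup>2 / y)\<close>. Only \<open>\<bar>q - m\<bar>\<close> and its square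
  appear on the right, so that the variance of \<open>Q\<close> suffices later.\<close>

lemma abs_sqrt_cube_diff_le:
  fixes q m :: real
  assumes "0 \<le> q" "0 < m"
  shows "\<bar>q * sqrt q - m * sqrt m\<bar> \<le> sqrt m * (2 * \<bar>q - m\<bar> + (q - m)\<^sup>2 / m)"
proof -
  define x where "x = sqrt q"
  define y where "y = sqrt m"
  have x: "0 \<le> x" "q = x\<^sup>2" and y: "0 < y" "m = y\<^sup>2" using assms by (auto simp: x_def y_def)
  have f: "q * x - m * y = (x - y) * (x\<^sup>2 + x * y + y\<^sup>2)" by (simp add: x y power2_eq_square algebra_simps)
  have g: "\<bar>q - m\<bar> = \<bar>x - y\<bar> * (x + y)"
  proof -
    have "q - m = (x - y) * (x + y)" by (simp add: x y power2_eq_square algebra_simps)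
    thus ?thesis using x y by (simp add: abs_mult)
  qed
  have "x\<^sup>2 + x * y + y\<^sup>2 \<le> (x + y) * (y + x\<^sup>2 / y)"
    using x y by (simp add: field_simps power2_eq_square)
  hence "\<bar>q * x - m * y\<bar> \<le> \<bar>x - y\<bar> * ((x + y) * (y + x\<^sup>2 / y))"
    unfolding f abs_mult using x y by (intro mult_left_mono) auto
  also have "\<dots> = \<bar>q - m\<bar> * (y * (1 + q / m))" unfolding g using y x by (simp add: field_simps power2_eq_square)
  also have "\<dots> \<le> \<bar>q - m\<bar> * (y * (2 + \<bar>q - m\<bar> / m))"
  proof (intro mult_left_mono)
    have "q / m \<le> (m + \<bar>q - m\<bar>) / m" using assms by (intro divide_right_mono) auto
    thus "1 + q / m \<le> 2 + \<bar>q - m\<bar> / m" using assms by (simp add: add_divide_distrib)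
  qed (use y in auto)
  also have "\<dots> = y * (2 * \<bar>q - m\<bar> + (q - m)\<^sup>2 / m)"
    by (simp add: algebra_simps power2_eq_square flip: abs_mult_self_eq[of "q - m"])
  finally show ?thesis unfolding x_def y_def .
qed

context canonical_model begin

lemma Q_variance: "(LINT x|A.P. (Q x - n)\<^sup>2) = 2 * n"
proof -
  have "(LINT x|A.P. (Q x - n)\<^sup>2) = (LINT x|A.P. ((\<Sum>j<n. (A.Z j x)\<^sup>2) - (\<Sum>j<n. A.C j j))\<^sup>2)"
    by (simp add: A_Z A_C Q_def)
  also have "\<dots> = 2 * n"
    unfolding A.expectation_sq_norm_variance by (simp add: A_C if_distrib[of "\<lambda>x. x\<^sup>2"] cong: if_cong)
  finally show ?thesis .
qed

lemma A_integrable: "exp_growth {..<n} f \<Longrightarrow> integrable A.P f" for f :: "_ \<Rightarrow> real"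
  by (rule exp_growth_integrable) auto

lemma B_integrable: "exp_growth {..<p} f \<Longrightarrow> integrable B.P f" for f :: "_ \<Rightarrow> real"
  by (rule exp_growth_integrable) auto

lemma Q_abs_deviation: "(LINT x|A.P. \<bar>Q x - n\<bar>) \<le> sqrt (2 * n)"
  unfolding Q_variance[symmetric]
  by (intro expectation_abs_le_sqrt prob_space_std_gauss A_integrable exp_growth_intros Q_eg)

lemma Q_mean: "(LINT x|A.P. Q x) = n"
proof -
  have "(LINT x|A.P. Q x) = (LINT x|A.P. (\<Sum>j<n. A.Z j x * A.Z j x))"
    by (simp add: Q_def A_Z power2_eq_square)
  also have "\<dots> = (\<Sum>j<n. A.C j j)"
    by (subst Bochner_Integration.integral_sum) (auto intro!: A_integrable exp_growth_intros A.Z_exp_growth simp: A.expectation_ZZ)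
  finally show ?thesis by (simp add: A_C)
qed

lemma W_second_moment: "(LINT y|B.P. (W y)\<^sup>2) = \<kappa>1"
  unfolding W_def B.expectation_linear_sq by (simp add: \<kappa>1_def kappa1p_def B_C)

lemma Wb_second_moment: "(LINT y|B.P. (Wb y)\<^sup>2) = \<kappa>3"
  unfolding Wb_def B.expectation_linear_sq bb_bilinear[symmetric] by (simp add: B_C)

lemma Zsq_eg: "exp_growth {..<p} Zsq"
  unfolding Zsq_def by (intro B.growth)

lemma Zsq_abs_deviation: "(LINT y|B.P. \<bar>Zsq y - p\<bar>) \<le> sqrt (2 * trace2)"
proof -
  have "(LINT y|B.P. (Zsq y - p)\<^sup>2) = (LINT x|B.P. ((\<Sum>j<p. (B.Z j x)\<^sup>2) - (\<Sum>j<p. B.C j j))\<^sup>2)"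
    by (simp add: B_C Zsq_def)
  also have "\<dots> = 2 * trace2"
    unfolding B.expectation_sq_norm_variance by (simp add: B_C trace2_def)
  finally show ?thesis
    using expectation_abs_le_sqrt[OF prob_space_std_gauss, of "{..<p}" "\<lambda>y. Zsq y - p"]
    by (simp add: B_integrable exp_growth_intros Zsq_eg)
qed

definition Dlin where "Dlin y = (\<Sum>j<p. d j * B.Z j y)"

lemma Dlin_eg: "exp_growth {..<p} Dlin"
  unfolding Dlin_def by (intro B.growth)

lemma Dlin_abs: "(LINT y|B.P. \<bar>Dlin y\<bar>) \<le> sqrt (4 * \<tau>\<^sup>2 * \<kappa>3 - 4 * \<kappa>2\<^sup>2)"
  using B.expectation_abs_linear_le[of d] unfolding Dlin_def d_variance[symmetric] by (simp add: B_C)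

text \<open>One summand for each remainder term of \<open>S_minus_Slin\<close>, in the same order,
  from E Q = n, E (Q - n)^2 = 2 n, the independence of the two components, and first absolute
  moments bounded by roots of second moments.\<close>

definition \<delta>0 where "\<delta>0 = (\<kappa>2 * (2 * n) + \<tau>\<^sup>2 * (n * (\<mu>\<^sup>2 * \<kappa>2 * \<kappa>1 + \<mu> * (\<kappa>1 + \<kappa>3))) + \<tau>\<^sup>2 * (sqrt (2 * n) * sqrt (2 * trace2))
    + (sqrt n * (2 * sqrt (2 * n) + 2)) * sqrt (4 * \<tau>\<^sup>2 * \<kappa>3 - 4 * \<kappa>2\<^sup>2)) / (n * sqrt n)"

lemma S_measurable[measurable]: "S \<in> borel_measurable R"
  unfolding S_def stat_def by measurable

lemma Slin_measurable[measurable]: "Slin \<in> borel_measurable R"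
proof -
  have [measurable]: "A.form a e \<in> borel_measurable A.P" "B.form a e \<in> borel_measurable B.P" for a e
    by (intro exp_growth_measurable A.form_exp_growth B.form_exp_growth)+
  show ?thesis unfolding Slin_def by measurable
qed

lemma expectation_S_minus_Slin:
  shows "integrable R (\<lambda>z. \<bar>S z - Slin z\<bar>)" and "(LINT z|R. \<bar>S z - Slin z\<bar>) \<le> \<delta>0"
proof -
  define f1 where "f1 x = \<kappa>2 * (Q x - n)\<^sup>2" for x
  define f2 where "f2 x = \<tau>\<^sup>2 * Q x" for x
  define g2 where "g2 y = \<mu>\<^sup>2 * \<kappa>2 * (W y)\<^sup>2 + \<mu> * ((W y)\<^sup>2 + (Wb y)\<^sup>2)" for y
  define f3 where "f3 x = \<tau>\<^sup>2 * \<bar>Q x - n\<bar>" for x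
  define g3 where "g3 y = \<bar>Zsq y - p\<bar>" for y
  define f4 where "f4 x = sqrt n * (2 * \<bar>Q x - n\<bar> + (Q x - n)\<^sup>2 / n)" for x
  define g4 where "g4 y = \<bar>Dlin y\<bar>" for y
  have f4': "f4 x = sqrt n * (2 * \<bar>Q x - n\<bar> + (Q x - n)\<^sup>2 * (1 / n))" for x by (simp add: f4_def)
  have if1: "integrable A.P f1" "integrable A.P f2" "integrable A.P f3" "integrable A.P f4"
    unfolding f1_def f2_def f3_def f4' by (intro A_integrable exp_growth_intros Q_eg)+
  have ig: "integrable B.P (\<lambda>_. 1 :: real)" "integrable B.P g2" "integrable B.P g3" "integrable B.P g4"
    unfolding g2_def g3_def g4_def by (intro B_integrable exp_growth_intros B_eg Zsq_eg Dlin_eg)+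
  \<comment> \<open>\<open>H\<close> dominates the remainder and is a sum of products of a function
    of the first component and one of the second, so its integral factorises.\<close>
  define H where "H z = f1 (fst z) * 1 + f2 (fst z) * g2 (snd z) + f3 (fst z) * g3 (snd z) + f4 (fst z) * g4 (snd z)" for z
  note prd = pair_prob_integral_prod[OF prob_space_std_gauss prob_space_std_gauss]
  note pi = prd(1)[OF if1(1) ig(1)] prd(1)[OF if1(2) ig(2)] prd(1)[OF if1(3) ig(3)] prd(1)[OF if1(4) ig(4)]
  note pe = prd(2)[OF if1(1) ig(1)] prd(2)[OF if1(2) ig(2)] prd(2)[OF if1(3) ig(3)] prd(2)[OF if1(4) ig(4)]
  have iH: "integrable R H" unfolding H_def by (intro Bochner_Integration.integrable_add pi)
  have N: "0 < real n * sqrt n" using n by simp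
  have pw: "\<bar>S z - Slin z\<bar> \<le> H z / (n * sqrt n)" for z
  proof -
    define q where "q = Q (fst z)"
    define y where "y = snd z"
    have q: "0 \<le> q" by (simp add: q_def Q_nonneg)
    have w: "\<bar>\<mu>\<^sup>2 * \<kappa>2 * (W y)\<^sup>2 - 2 * \<mu> * W y * Wb y\<bar> \<le> g2 y"
    proof -
      have "0 \<le> (\<bar>W y\<bar> - \<bar>Wb y\<bar>)\<^sup>2" by simp
      hence "2 * (\<bar>W y\<bar> * \<bar>Wb y\<bar>) \<le> (W y)\<^sup>2 + (Wb y)\<^sup>2" by (simp add: power2_diff)
      hence "\<mu> * (2 * (\<bar>W y\<bar> * \<bar>Wb y\<bar>)) \<le> \<mu> * ((W y)\<^sup>2 + (Wb y)\<^sup>2)" by (intro mult_left_mono \<mu>_nonneg)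
      moreover have "\<bar>2 * \<mu> * W y * Wb y\<bar> = \<mu> * (2 * (\<bar>W y\<bar> * \<bar>Wb y\<bar>))" using \<mu>_nonneg by (simp add: abs_mult)
      moreover have "\<bar>\<mu>\<^sup>2 * \<kappa>2 * (W y)\<^sup>2\<bar> = \<mu>\<^sup>2 * \<kappa>2 * (W y)\<^sup>2" using \<kappa>2_nonneg by simp
      ultimately show ?thesis unfolding g2_def
        using abs_triangle_ineq4[of "\<mu>\<^sup>2 * \<kappa>2 * (W y)\<^sup>2" "2 * \<mu> * W y * Wb y"] by linarith
    qed
    have "real n * sqrt n * \<bar>S z - Slin z\<bar> = \<bar>real n * sqrt n * (S z - Slin z)\<bar>" using N by (simp add: abs_mult)
    also have "\<dots> = \<bar>\<kappa>2 * (q - n)\<^sup>2 + \<tau>\<^sup>2 * q * (\<mu>\<^sup>2 * \<kappa>2 * (W y)\<^sup>2 - 2 * \<mu> * W y * Wb y) + \<tau>\<^sup>2 * (q - n) * (Zsq y - p)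
        + (q * sqrt q - n * sqrt n) * Dlin y\<bar>"
      unfolding S_minus_Slin q_def[symmetric] y_def[symmetric] Dlin_def[symmetric] by (simp add: distrib_left mult_ac)
    also have "\<dots> \<le> \<bar>\<kappa>2 * (q - n)\<^sup>2\<bar> + \<bar>\<tau>\<^sup>2 * q * (\<mu>\<^sup>2 * \<kappa>2 * (W y)\<^sup>2 - 2 * \<mu> * W y * Wb y)\<bar> + \<bar>\<tau>\<^sup>2 * (q - n) * (Zsq y - p)\<bar>
        + \<bar>(q * sqrt q - n * sqrt n) * Dlin y\<bar>" by linarith
    also have "\<dots> \<le> H z"
      unfolding H_def q_def[symmetric] y_def[symmetric] f1_def f2_def f3_def f4_def g3_def g4_def
    proof (intro add_mono)
      show "\<bar>\<kappa>2 * (q - n)\<^sup>2\<bar> \<le> \<kappa>2 * (q - n)\<^sup>2 * 1" using \<kappa>2_nonneg by simp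
      show "\<bar>\<tau>\<^sup>2 * q * (\<mu>\<^sup>2 * \<kappa>2 * (W y)\<^sup>2 - 2 * \<mu> * W y * Wb y)\<bar> \<le> \<tau>\<^sup>2 * q * g2 y"
        unfolding abs_mult[of "\<tau>\<^sup>2 * q"] using w q by (simp add: mult_left_mono)
      show "\<bar>\<tau>\<^sup>2 * (q - n) * (Zsq y - p)\<bar> \<le> \<tau>\<^sup>2 * \<bar>q - n\<bar> * \<bar>Zsq y - p\<bar>" by (simp add: abs_mult)
      show "\<bar>(q * sqrt q - n * sqrt n) * Dlin y\<bar> \<le> sqrt n * (2 * \<bar>q - n\<bar> + (q - n)\<^sup>2 / n) * \<bar>Dlin y\<bar>"
        unfolding abs_mult using abs_sqrt_cube_diff_le[of q n] q n by (intro mult_right_mono) auto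
    qed
    finally show ?thesis using N by (simp add: le_divide_eq mult.commute)
  qed
  have iHN: "integrable R (\<lambda>z. H z / (n * sqrt n))" using iH by simp
  show int: "integrable R (\<lambda>z. \<bar>S z - Slin z\<bar>)"
    by (rule Bochner_Integration.integrable_bound[OF iHN]) (use N in \<open>auto intro!: AE_I2 order_trans[OF pw] divide_right_mono\<close>)
  have "(LINT z|R. \<bar>S z - Slin z\<bar>) \<le> (LINT z|R. H z / (n * sqrt n))"
    by (intro integral_mono int iHN pw)
  also have "\<dots> = (LINT z|R. H z) / (n * sqrt n)" by simp
  also have "(LINT z|R. H z) = (LINT x|A.P. f1 x) * (LINT y|B.P. 1) + (LINT x|A.P. f2 x) * (LINT y|B.P. g2 y)
      + (LINT x|A.P. f3 x) * (LINT y|B.P. g3 y) + (LINT x|A.P. f4 x) * (LINT y|B.P. g4 y)"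
    unfolding H_def pe[symmetric] by (simp only: Bochner_Integration.integral_add Bochner_Integration.integrable_add pi)
  also have "\<dots> \<le> \<kappa>2 * (2 * n) + \<tau>\<^sup>2 * (n * (\<mu>\<^sup>2 * \<kappa>2 * \<kappa>1 + \<mu> * (\<kappa>1 + \<kappa>3))) + \<tau>\<^sup>2 * (sqrt (2 * n) * sqrt (2 * trace2))
    + (sqrt n * (2 * sqrt (2 * n) + 2)) * sqrt (4 * \<tau>\<^sup>2 * \<kappa>3 - 4 * \<kappa>2\<^sup>2)"
  proof (intro add_mono)
    interpret pB: prob_space B.P by (rule prob_space_std_gauss)
    show "(LINT x|A.P. f1 x) * (LINT y|B.P. 1) \<le> \<kappa>2 * (2 * n)"
      unfolding f1_def by (simp add: Q_variance pB.prob_space)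
    have "integrable B.P (\<lambda>y. (W y)\<^sup>2)" "integrable B.P (\<lambda>y. (Wb y)\<^sup>2)"
      by (intro B_integrable exp_growth_intros B_eg)+
    hence "(LINT y|B.P. g2 y) = \<mu>\<^sup>2 * \<kappa>2 * \<kappa>1 + \<mu> * (\<kappa>1 + \<kappa>3)"
      unfolding g2_def by (simp add: W_second_moment Wb_second_moment)
    thus "(LINT x|A.P. f2 x) * (LINT y|B.P. g2 y) \<le> \<tau>\<^sup>2 * (n * (\<mu>\<^sup>2 * \<kappa>2 * \<kappa>1 + \<mu> * (\<kappa>1 + \<kappa>3)))"
      unfolding f2_def by (simp add: Q_mean)
    have "(LINT x|A.P. \<bar>Q x - n\<bar>) * (LINT y|B.P. g3 y) \<le> sqrt (2 * n) * sqrt (2 * trace2)"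
      unfolding g3_def by (intro mult_mono Q_abs_deviation Zsq_abs_deviation) auto
    thus "(LINT x|A.P. f3 x) * (LINT y|B.P. g3 y) \<le> \<tau>\<^sup>2 * (sqrt (2 * n) * sqrt (2 * trace2))"
      unfolding f3_def by (simp add: mult.assoc mult_left_mono)
    have i: "integrable A.P (\<lambda>x. \<bar>Q x - n\<bar>)" "integrable A.P (\<lambda>x. (Q x - n)\<^sup>2)"
      by (intro A_integrable exp_growth_intros Q_eg)+
    have "(LINT x|A.P. f4 x) = sqrt n * (2 * (LINT x|A.P. \<bar>Q x - n\<bar>) + (LINT x|A.P. (Q x - n)\<^sup>2) / n)"
      unfolding f4_def using i by simp
    also have "\<dots> \<le> sqrt n * (2 * sqrt (2 * n) + 2)"
      unfolding Q_variance using Q_abs_deviation n by (intro mult_left_mono) auto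
    finally show "(LINT x|A.P. f4 x) * (LINT y|B.P. g4 y) \<le> (sqrt n * (2 * sqrt (2 * n) + 2)) * sqrt (4 * \<tau>\<^sup>2 * \<kappa>3 - 4 * \<kappa>2\<^sup>2)"
      unfolding g4_def by (intro mult_mono Dlin_abs) auto
  qed
  finally show "(LINT z|R. \<bar>S z - Slin z\<bar>) \<le> \<delta>0"
    unfolding \<delta>0_def using N by (simp add: divide_right_mono)
qed

section \<open>Bounds for the fluctuations of \<open>energy\<close>\<close>

definition K where "K = 2 / (1 - \<bar>\<rho>\<bar>)"

lemma K_nonneg: "0 \<le> K" using \<rho> by (simp add: K_def)

lemma row_sum_le: "(\<Sum>l<p. rpow \<bar>\<rho>\<bar> k l) \<le> K"
  unfolding K_def using \<rho> by (intro sum_rpow_le) auto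

text \<open>The fourfold sum is tr(\<Sigma>^4), a closed cycle of four entries. Bounding one entry
  by \<open>1\<close> opens the cycle to a path, whose vertices are summed away in turn at the cost
  of \<open>K\<close> each; only the starting vertex costs \<open>p\<close>.\<close>

lemma B_quad_variance_le: "(LINT y|B.P. (B.quad B.C y)\<^sup>2) \<le> 2 * (p * K ^ 3)"
proof -
  let ?r = "rpow \<bar>\<rho>\<bar>"
  have r: "0 \<le> ?r i j" "?r i j \<le> 1" for i j using \<rho> by (auto intro: rpow_nonneg rpow_le_1)
  have "(\<Sum>j<p. \<Sum>j'<p. B.C j j' * (\<Sum>i<p. \<Sum>i'<p. B.C j i * B.C j' i' * B.C i i'))
     = (\<Sum>j<p. \<Sum>j'<p. \<Sum>i<p. \<Sum>i'<p. rpow \<rho> j j' * (rpow \<rho> j i * rpow \<rho> j' i' * rpow \<rho> i i'))"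
    by (simp add: B_C sum_distrib_left)
  also have "\<dots> \<le> (\<Sum>j<p. \<Sum>j'<p. \<Sum>i<p. \<Sum>i'<p. ?r j i * (?r i i' * ?r i' j'))"
  proof (intro sum_mono)
    fix j j' i i'
    have "rpow \<rho> j j' * (rpow \<rho> j i * rpow \<rho> j' i' * rpow \<rho> i i') \<le> \<bar>rpow \<rho> j j' * (rpow \<rho> j i * rpow \<rho> j' i' * rpow \<rho> i i')\<bar>" by simp
    also have "\<dots> = ?r j j' * (?r j i * ?r j' i' * ?r i i')" by (simp add: abs_mult abs_rpow)
    also have "\<dots> \<le> 1 * (?r j i * ?r j' i' * ?r i i')" using r by (intro mult_right_mono) auto
    finally show "rpow \<rho> j j' * (rpow \<rho> j i * rpow \<rho> j' i' * rpow \<rho> i i') \<le> ?r j i * (?r i i' * ?r i' j')"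
      by (simp add: mult_ac rpow_commute[of _ j' i'])
  qed
  also have "\<dots> = (\<Sum>j<p. \<Sum>i<p. ?r j i * (\<Sum>i'<p. ?r i i' * (\<Sum>j'<p. ?r i' j')))"
  proof (rule sum.cong[OF refl])
    fix j
    have "(\<Sum>j'<p. \<Sum>i<p. \<Sum>i'<p. ?r j i * (?r i i' * ?r i' j')) = (\<Sum>i<p. \<Sum>j'<p. \<Sum>i'<p. ?r j i * (?r i i' * ?r i' j'))"
      by (rule sum.swap)
    also have "\<dots> = (\<Sum>i<p. \<Sum>i'<p. \<Sum>j'<p. ?r j i * (?r i i' * ?r i' j'))"
      by (rule sum.cong[OF refl], rule sum.swap)
    finally show "(\<Sum>j'<p. \<Sum>i<p. \<Sum>i'<p. ?r j i * (?r i i' * ?r i' j')) = (\<Sum>i<p. ?r j i * (\<Sum>i'<p. ?r i i' * (\<Sum>j'<p. ?r i' j')))"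
      by (simp add: sum_distrib_left)
  qed
  also have "\<dots> \<le> (\<Sum>j<p. K * (K * K))"
  proof (intro sum_mono)
    fix j
    have 1: "(\<Sum>i'<p. ?r i i' * (\<Sum>j'<p. ?r i' j')) \<le> K * K" for i
    proof -
      have "(\<Sum>i'<p. ?r i i' * (\<Sum>j'<p. ?r i' j')) \<le> (\<Sum>i'<p. ?r i i' * K)"
        by (intro sum_mono mult_left_mono row_sum_le r)
      also have "\<dots> = (\<Sum>i'<p. ?r i i') * K" by (simp add: sum_distrib_right)
      also have "\<dots> \<le> K * K" by (intro mult_right_mono row_sum_le K_nonneg)
      finally show ?thesis .
    qed
    have "(\<Sum>i<p. ?r j i * (\<Sum>i'<p. ?r i i' * (\<Sum>j'<p. ?r i' j'))) \<le> (\<Sum>i<p. ?r j i * (K * K))"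
      by (intro sum_mono mult_left_mono 1 r)
    also have "\<dots> = (\<Sum>i<p. ?r j i) * (K * K)" by (simp add: sum_distrib_right)
    also have "\<dots> \<le> K * (K * K)" using K_nonneg by (intro mult_right_mono row_sum_le) auto
    finally show "(\<Sum>i<p. ?r j i * (\<Sum>i'<p. ?r i i' * (\<Sum>j'<p. ?r i' j'))) \<le> K * (K * K)" .
  qed
  finally have "(\<Sum>j<p. \<Sum>j'<p. B.C j j' * (\<Sum>i<p. \<Sum>i'<p. B.C j i * B.C j' i' * B.C i i')) \<le> p * K ^ 3"
    by (simp add: power3_eq_cube)
  thus ?thesis using B.expectation_quad_sq[of B.C] B.C_commute by simp
qed

text \<open>Bound for the squared norm of \<open>d\<close>. Each 8 is \<open>2 * 2\<^sup>2\<close>,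
  from \<open>(x + y)\<^sup>2 \<le> 2 * x\<^sup>2 + 2 * y\<^sup>2\<close> and the factor
  \<open>2\<close> in \<open>d\<close>.\<close>

definition d2 where "d2 = 8 * \<tau>\<^sup>2 * \<kappa>2 + 8 * \<tau>\<^sup>2 * \<mu>\<^sup>2 * \<kappa>2\<^sup>2 * (\<Sum>j<p. (\<beta> j)\<^sup>2)"

lemma d_norm_le: "(\<Sum>j<p. (d j)\<^sup>2) \<le> d2"
proof -
  have "(d j)\<^sup>2 \<le> 8 * \<tau>\<^sup>2 * (b j)\<^sup>2 + 8 * \<tau>\<^sup>2 * \<mu>\<^sup>2 * \<kappa>2\<^sup>2 * (\<beta> j)\<^sup>2" for j
  proof -
    have "(x + y)\<^sup>2 \<le> 2 * x\<^sup>2 + 2 * y\<^sup>2" for x y :: real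
      using zero_le_power2[of "x - y"] by (simp add: power2_sum power2_diff)
    from this[of "2 * \<tau> * b j" "(- 2 * \<tau> * \<mu> * \<kappa>2) * \<beta> j"]
    show ?thesis unfolding d_def by (simp add: power_mult_distrib)
  qed
  hence "(\<Sum>j<p. (d j)\<^sup>2) \<le> (\<Sum>j<p. 8 * \<tau>\<^sup>2 * (b j)\<^sup>2 + 8 * \<tau>\<^sup>2 * \<mu>\<^sup>2 * \<kappa>2\<^sup>2 * (\<beta> j)\<^sup>2)" by (intro sum_mono)
  thus ?thesis unfolding d2_def \<kappa>2_eq[symmetric] by (simp add: sum.distrib sum_distrib_left[symmetric] \<kappa>2_eq[symmetric])
qed

text \<open>The variance is the form of \<Sigma> at the vector \<Sigma>d: the bilinear bound costs
  one \<open>K\<close>, the l2 bound for \<Sigma>d two more. There is no factor \<open>p\<close>, so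
  the prefactor \<open>b0\<close>, of order 1 / sqrt n, makes this contribution vanish.\<close>

lemma B_linear_variance_le:
  "(LINT y|B.P. (\<Sum>j<p. (\<Sum>j'<p. B.C j j' * d j') * B.Z j y)\<^sup>2) \<le> K * (K\<^sup>2 * d2)"
proof -
  define e where "e j = (\<Sum>l<p. d l * rpow \<rho> j l)" for j
  have "(LINT y|B.P. (\<Sum>j<p. (\<Sum>j'<p. B.C j j' * d j') * B.Z j y)\<^sup>2) = (LINT y|B.P. (\<Sum>j<p. e j * B.Z j y)\<^sup>2)"
    by (simp add: B_C e_def mult.commute)
  also have "\<dots> = (\<Sum>j<p. \<Sum>k<p. e j * e k * rpow \<rho> j k)"
    unfolding B.expectation_linear_sq by (simp add: B_C)
  also have "\<dots> \<le> (\<Sum>j<p. \<Sum>k<p. \<bar>e j * e k * rpow \<rho> j k\<bar>)" by (intro sum_mono) simp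
  also have "\<dots> \<le> K * (\<Sum>j<p. (e j)\<^sup>2)" unfolding K_def by (rule rpow_bilinear_bound[OF \<rho>])
  also have "\<dots> \<le> K * (\<Sum>j<p. (\<Sum>l<p. \<bar>d l * rpow \<rho> j l\<bar>)\<^sup>2)"
  proof (intro mult_left_mono sum_mono K_nonneg)
    fix j
    have "\<bar>e j\<bar> \<le> (\<Sum>l<p. \<bar>d l * rpow \<rho> j l\<bar>)" unfolding e_def by (rule sum_abs)
    thus "(e j)\<^sup>2 \<le> (\<Sum>l<p. \<bar>d l * rpow \<rho> j l\<bar>)\<^sup>2" by (metis abs_ge_zero power2_abs power_mono)
  qed
  also have "\<dots> \<le> K * (K\<^sup>2 * (\<Sum>l<p. (d l)\<^sup>2))"
    unfolding K_def using rpow_l2_bound[OF \<rho>] \<rho> by (intro mult_left_mono) auto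
  also have "\<dots> \<le> K * (K\<^sup>2 * d2)" by (intro mult_left_mono d_norm_le K_nonneg) simp
  finally show ?thesis .
qed

section \<open>Rate for the characteristic function\<close>

text \<open>The variance of \<open>Slin\<close>: the share of \<open>Q\<close>, then those of the
  squared norm of \<open>Z\<close> and of the linear term.\<close>

definition v where "v = 2 * a0\<^sup>2 * n + (2 * b0\<^sup>2 * trace2 + (4 * \<tau>\<^sup>2 * \<kappa>3 - 4 * \<kappa>2\<^sup>2))"

text \<open>Three errors add up: \<bar>t\<bar> times the mean linearisation error, as
  \<open>iexp\<close> is 1-Lipschitz, and the Gaussian approximation errors of the two independent
  pieces, whose characteristic functions multiply and are bounded by \<open>1\<close>.\<close>

lemma char_S_bound:
  "norm ((CLINT z|R. iexp (t * S z)) - exp (- v * t\<^sup>2 / 2)) \<le>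
     \<bar>t\<bar> * \<delta>0 + t\<^sup>2 * (2 * a0\<^sup>2 * sqrt (2 * n) + (2 * b0\<^sup>2 * sqrt (2 * (p * K ^ 3)) + 3 * \<bar>b0\<bar> * sqrt (K * (K\<^sup>2 * d2))))"
proof -
  interpret pA: prob_space A.P by (rule prob_space_std_gauss)
  interpret pB: prob_space B.P by (rule prob_space_std_gauss)
  interpret R: pair_prob_space A.P B.P ..
  define FA where "FA = A.form a0 (\<lambda>_. 0)"
  define FB where "FB = B.form b0 d"
  have [measurable]: "FA \<in> borel_measurable A.P" "FB \<in> borel_measurable B.P"
    unfolding FA_def FB_def by (intro exp_growth_measurable A.form_exp_growth B.form_exp_growth)+
  define vA where "vA = 2 * a0\<^sup>2 * n"
  define vB where "vB = 2 * b0\<^sup>2 * trace2 + (4 * \<tau>\<^sup>2 * \<kappa>3 - 4 * \<kappa>2\<^sup>2)"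
  define \<phi>A where "\<phi>A = (CLINT x|A.P. iexp (t * FA x))"
  define \<phi>B where "\<phi>B = (CLINT x|B.P. iexp (t * FB x))"
  have vA0: "vA \<ge> 0" by (simp add: vA_def)
  have vB0: "vB \<ge> 0" unfolding vB_def d_variance[symmetric] trace2_def
    using rpow_psd[OF \<rho>, of d p] by (simp add: sum_nonneg)
  have vA: "vA = 2 * a0\<^sup>2 * (\<Sum>j<n. \<Sum>j'<n. (A.C j j')\<^sup>2) + (\<Sum>j<n. \<Sum>j'<n. 0 * 0 * A.C j j')"
    by (simp add: vA_def A_C if_distrib[of "\<lambda>x. x\<^sup>2"] cong: if_cong)
  have vB: "vB = 2 * b0\<^sup>2 * (\<Sum>j<p. \<Sum>j'<p. (B.C j j')\<^sup>2) + (\<Sum>j<p. \<Sum>j'<p. d j * d j' * B.C j j')"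
    unfolding vB_def d_variance[symmetric] trace2_def by (simp add: B_C)
  have qA: "A.quad A.C x = Q x - n" for x
    by (simp add: A.quad_def A_C A_Z Q_def if_distrib[of "\<lambda>c. c * _"] sum_subtractf power2_eq_square cong: if_cong)
  have "(LINT x|A.P. \<bar>A.energy a0 (\<lambda>_. 0) x - vA\<bar>) \<le> 2 * a0\<^sup>2 * sqrt (2 * n)"
    using A.expectation_energy_bound[OF vA] by (simp add: qA Q_variance)
  hence bA: "norm (\<phi>A - exp (- vA * t\<^sup>2 / 2)) \<le> t\<^sup>2 * (2 * a0\<^sup>2 * sqrt (2 * n))"
    unfolding \<phi>A_def FA_def by (intro order_trans[OF A.char_form_bound[OF vA0]] mult_left_mono) auto
  have "(LINT x|B.P. \<bar>B.energy b0 d x - vB\<bar>) \<le> 2 * b0\<^sup>2 * sqrt (2 * (p * K ^ 3)) + 3 * \<bar>b0\<bar> * sqrt (K * (K\<^sup>2 * d2))"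
    by (rule order_trans[OF B.expectation_energy_bound[OF vB]])
       (intro add_mono mult_left_mono real_sqrt_le_mono B_quad_variance_le B_linear_variance_le; simp)
  hence bB: "norm (\<phi>B - exp (- vB * t\<^sup>2 / 2)) \<le> t\<^sup>2 * (2 * b0\<^sup>2 * sqrt (2 * (p * K ^ 3)) + 3 * \<bar>b0\<bar> * sqrt (K * (K\<^sup>2 * d2)))"
    unfolding \<phi>B_def FB_def by (intro order_trans[OF B.char_form_bound[OF vB0]] mult_left_mono) auto
  have iA: "integrable A.P (\<lambda>x. iexp (t * FA x))" by (intro pA.integrable_const_bound[where B=1]) auto
  have iB: "integrable B.P (\<lambda>x. iexp (t * FB x))" by (intro pB.integrable_const_bound[where B=1]) auto
  have lin: "(CLINT z|R. iexp (t * Slin z)) = \<phi>A * \<phi>B"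
    unfolding \<phi>A_def \<phi>B_def pair_prob_integral_prod(2)[OF prob_space_std_gauss prob_space_std_gauss iA iB, symmetric]
    unfolding Slin_def FA_def[symmetric] FB_def[symmetric]
    by (simp only: distrib_left of_real_add exp_add)
  have n\<phi>B: "norm \<phi>B \<le> 1"
    unfolding \<phi>B_def using norm_integral_le[of B.P "\<lambda>_. 1" "\<lambda>x. iexp (t * FB x)"] by (simp add: pB.prob_space)
  have eA: "exp (- vA * t\<^sup>2 / 2) \<le> 1" using vA0 by simp
  have prod: "norm (\<phi>A * \<phi>B - exp (- v * t\<^sup>2 / 2)) \<le> norm (\<phi>A - exp (- vA * t\<^sup>2 / 2)) + norm (\<phi>B - exp (- vB * t\<^sup>2 / 2))"
  proof -
    have "v = vA + vB" by (simp add: v_def vA_def vB_def)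
    hence ex: "exp (- v * t\<^sup>2 / 2) = exp (- vA * t\<^sup>2 / 2) * exp (- vB * t\<^sup>2 / 2)"
      by (simp add: exp_add[symmetric] field_simps)
    have "\<phi>A * \<phi>B - exp (- v * t\<^sup>2 / 2) = (\<phi>A - exp (- vA * t\<^sup>2 / 2)) * \<phi>B + exp (- vA * t\<^sup>2 / 2) * (\<phi>B - exp (- vB * t\<^sup>2 / 2))"
      unfolding ex by (simp add: algebra_simps)
    also have "norm \<dots> \<le> norm (\<phi>A - exp (- vA * t\<^sup>2 / 2)) * norm \<phi>B + exp (- vA * t\<^sup>2 / 2) * norm (\<phi>B - exp (- vB * t\<^sup>2 / 2))"
      by (rule order_trans[OF norm_triangle_ineq]) (simp add: norm_mult)
    also have "\<dots> \<le> norm (\<phi>A - exp (- vA * t\<^sup>2 / 2)) * 1 + 1 * norm (\<phi>B - exp (- vB * t\<^sup>2 / 2))"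
      using n\<phi>B eA by (intro add_mono mult_left_mono mult_right_mono) auto
    finally show ?thesis by simp
  qed
  have "norm ((CLINT z|R. iexp (t * S z)) - \<phi>A * \<phi>B) \<le> \<bar>t\<bar> * \<delta>0"
  proof -
    have i: "integrable R (\<lambda>z. iexp (t * S z))" "integrable R (\<lambda>z. iexp (t * Slin z))"
      by (intro R.P.integrable_const_bound[where B=1]; auto)+
    have "norm ((CLINT z|R. iexp (t * S z)) - \<phi>A * \<phi>B) = norm (CLINT z|R. iexp (t * S z) - iexp (t * Slin z))"
      unfolding lin[symmetric] Bochner_Integration.integral_diff[OF i] ..
    also have "\<dots> \<le> (LINT z|R. \<bar>t\<bar> * \<bar>S z - Slin z\<bar>)"
    proof (rule norm_integral_le)
      show "norm (iexp (t * S z) - iexp (t * Slin z)) \<le> \<bar>t\<bar> * \<bar>S z - Slin z\<bar>" for z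
        using norm_iexp_diff_le[of "t * S z" "t * Slin z"] by (simp add: right_diff_distrib[symmetric] abs_mult del: of_real_mult)
    qed (use expectation_S_minus_Slin(1) in simp)
    also have "\<dots> \<le> \<bar>t\<bar> * \<delta>0" using expectation_S_minus_Slin(2) by (simp add: mult_left_mono)
    finally show ?thesis .
  qed
  thus ?thesis using prod bA bB
    norm_triangle_ineq[of "(CLINT z|R. iexp (t * S z)) - \<phi>A * \<phi>B" "\<phi>A * \<phi>B - exp (- v * t\<^sup>2 / 2)"]
    by (simp add: distrib_left)
qed

end

context canonical_model begin

lemma v_nonneg: "0 \<le> v"
  unfolding v_def d_variance[symmetric] trace2_def using rpow_psd[OF \<rho>, of d p] by (simp add: sum_nonneg)

lemma v_eq: "v = 2 * (2 * \<kappa>2 + \<tau>\<^sup>2 * (p / n))\<^sup>2 + 2 * (\<tau>\<^sup>2)\<^sup>2 * (trace2 / n) + 4 * \<tau>\<^sup>2 * \<kappa>3 - 4 * \<kappa>2\<^sup>2"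
  unfolding v_def a0_def b0_def using n by (simp add: power_divide)

text \<open>\<open>m\<close>, \<open>w\<close>, \<open>h\<close> and \<open>z\<close> stand for the
  roots of \<open>n\<close>, of 2, of \<open>trace2\<close> and of the variance of the linear term.
  With the roots abstracted, simplifying \<open>\<delta>0\<close> is pure field arithmetic.\<close>

lemma linearization_error_algebra:
  fixes m w k :: real
  assumes "m > 0" and w: "w * w = 2"
  shows "(k * (2 * m\<^sup>2) + t * (m\<^sup>2 * a) + t * (w * m * (w * h)) + (m * (2 * (w * m) + 2)) * z) / (m\<^sup>2 * m)
    = 1 / m * (2 * k + t * a + 2 * t * (h / m) + (2 * w + 2 / m) * z)"
proof -
  have "t * (w * m * (w * h)) = t * (m * (w * w) * h)" by (simp add: mult_ac)
  hence 1: "t * (w * m * (w * h)) = t * (m * 2 * h)" unfolding w .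
  show ?thesis unfolding 1 using assms(1) by (simp add: field_simps power2_eq_square)
qed

text \<open>The bound is rearranged so that \<open>1 / sqrt n\<close> multiplies an expression in
  quantities that converge along the sequence, such as the kappas, \<open>\<mu>\<close>,
  \<open>p / n\<close> and \<open>trace2 / n\<close>.\<close>

lemma char_S_rate:
  "norm ((CLINT z|R. iexp (t * S z)) - exp (- v * t\<^sup>2 / 2)) \<le> 1 / sqrt n *
     (\<bar>t\<bar> * (2 * \<kappa>2 + \<tau>\<^sup>2 * (\<mu>\<^sup>2 * \<kappa>2 * \<kappa>1 + \<mu> * (\<kappa>1 + \<kappa>3)) + 2 * \<tau>\<^sup>2 * sqrt (trace2 / n)
        + (2 * sqrt 2 + 2) * sqrt (4 * \<tau>\<^sup>2 * \<kappa>3 - 4 * \<kappa>2\<^sup>2))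
      + t\<^sup>2 * (2 * sqrt 2 * (2 * \<kappa>2 + \<tau>\<^sup>2 * (p / n))\<^sup>2 + 2 * (\<tau>\<^sup>2)\<^sup>2 * sqrt (2 * K ^ 3 * (p / n)) + 3 * \<tau>\<^sup>2 * sqrt (K ^ 3 * d2)))"
    (is "_ \<le> _ * (_ * ?A + _ * (?B + ?C + ?D))")
proof -
  define m where "m = sqrt n"
  have m: "m > 0" "real n = m\<^sup>2" using n by (auto simp: m_def)
  have m1: "1 \<le> m" using n by (simp add: m_def)
  have sn: "sqrt (m\<^sup>2) = m" using m by simp
  have D0: "\<delta>0 \<le> 1 / m * ?A"
  proof -
    define a where "a = \<mu>\<^sup>2 * \<kappa>2 * \<kappa>1 + \<mu> * (\<kappa>1 + \<kappa>3)"
    define z where "z = sqrt (4 * \<tau>\<^sup>2 * \<kappa>3 - 4 * \<kappa>2\<^sup>2)"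
    define h where "h = sqrt trace2"
    have z: "0 \<le> z" unfolding z_def d_variance[symmetric] using rpow_psd[OF \<rho>, of d p] by simp
    have s2: "sqrt 2 * sqrt 2 = 2" by simp
    have "\<delta>0 = (\<kappa>2 * (2 * m\<^sup>2) + \<tau>\<^sup>2 * (m\<^sup>2 * a) + \<tau>\<^sup>2 * (sqrt 2 * m * (sqrt 2 * h)) + (m * (2 * (sqrt 2 * m) + 2)) * z) / (m\<^sup>2 * m)"
      unfolding \<delta>0_def m_def[symmetric] a_def[symmetric] z_def[symmetric] h_def using m
      by (simp add: m_def[symmetric] real_sqrt_mult sn)
    also have "\<dots> = 1 / m * (2 * \<kappa>2 + \<tau>\<^sup>2 * a + 2 * \<tau>\<^sup>2 * (h / m) + (2 * sqrt 2 + 2 / m) * z)"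
      by (rule linearization_error_algebra[OF m(1) s2])
    also have "\<dots> \<le> 1 / m * (2 * \<kappa>2 + \<tau>\<^sup>2 * a + 2 * \<tau>\<^sup>2 * (h / m) + (2 * sqrt 2 + 2) * z)"
    proof -
      have "2 / m \<le> 2" using m1 by (simp add: divide_le_eq)
      hence "(2 * sqrt 2 + 2 / m) * z \<le> (2 * sqrt 2 + 2) * z" using z by (intro mult_right_mono) auto
      thus ?thesis using m(1) by (intro mult_left_mono) auto
    qed
    finally show ?thesis unfolding a_def z_def h_def m_def real_sqrt_divide .
  qed
  have D1: "2 * a0\<^sup>2 * sqrt (2 * n) = 1 / m * ?B"
    unfolding a0_def m_def[symmetric] using m by (simp add: real_sqrt_mult m_def[symmetric] power_divide) (simp add: power2_eq_square)
  have D2: "2 * b0\<^sup>2 * sqrt (2 * (p * K ^ 3)) = 1 / m * ?C"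
  proof -
    have "sqrt (2 * K ^ 3 * (p / n)) = sqrt (2 * (p * K ^ 3)) / m"
      unfolding m_def real_sqrt_divide[symmetric] by (simp add: mult_ac)
    thus ?thesis unfolding b0_def m_def[symmetric] using m(1) by (simp add: power_divide) (simp add: power2_eq_square)
  qed
  have D3: "3 * \<bar>b0\<bar> * sqrt (K * (K\<^sup>2 * d2)) = 1 / m * ?D"
    unfolding b0_def m_def[symmetric] using m(1) by (simp add: power2_eq_square power3_eq_cube mult_ac abs_mult)
  have *: "\<bar>t\<bar> * \<delta>0 + t\<^sup>2 * (2 * a0\<^sup>2 * sqrt (2 * n) + (2 * b0\<^sup>2 * sqrt (2 * (p * K ^ 3)) + 3 * \<bar>b0\<bar> * sqrt (K * (K\<^sup>2 * d2))))
    \<le> \<bar>t\<bar> * (1 / m * ?A) + t\<^sup>2 * (1 / m * ?B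
        + (1 / m * ?C + 1 / m * ?D))"
    unfolding D1 D2 D3 using m(1) by (intro add_mono mult_left_mono D0) auto
  have gen: "x * (1 / m * a) + y * (1 / m * b + (1 / m * c + 1 / m * e)) = 1 / m * (x * a + y * (b + c + e))" for x y a b c e :: real
    by (simp add: algebra_simps add_divide_distrib)
  show ?thesis using order_trans[OF char_S_bound *] unfolding gen unfolding m_def .
qed

end


section \<open>The central limit theorem\<close>

lemma real_distribution_normal_var:
  assumes "0 \<le> v" shows "real_distribution (normal_var v)"
proof -
  have "prob_space (normal_var v)"
    using assms prob_space_normal_density[of "sqrt v" 0] prob_space_return[of "0::real" borel]
    by (cases "v = 0") (simp_all add: normal_var_def)
  thus ?thesis
    by (simp add: real_distribution_def real_distribution_axioms_def normal_var_def)
qed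

text \<open>\<open>X'Y\<close> and \<open>V\<close> live on unrelated probability spaces but share
  their joint characteristic function, and \<open>stat\<close> is a measurable function of the first
  \<open>p\<close> coordinates.\<close>

lemma char_XtY_statistic:
  fixes X :: "nat \<Rightarrow> nat \<Rightarrow> 'a \<Rightarrow> real" and eps :: "nat \<Rightarrow> 'a \<Rightarrow> real" and \<beta> :: "nat \<Rightarrow> real"
  assumes prob: "prob_space M" and \<rho>: "\<bar>\<rho>\<bar> < 1" and \<sigma>2: "\<sigma>2 > 0" and n: "n > 0"
    and rows: "\<And>i. i < n \<Longrightarrow> centered_mvnormal M (X i) {..<p} (rpow \<rho>)"
    and noise: "centered_mvnormal M eps {..<n} (\<lambda>i i'. if i = i' then \<sigma>2 else 0)"
    and indep: "prob_space.indep_vars M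
                  (\<lambda>k. Pi\<^sub>M {..<(if k < n then p else n)} (\<lambda>_. borel))
                  (\<lambda>k \<omega>. if k < n then restrict (\<lambda>j. X k j \<omega>) {..<p}
                                 else restrict (\<lambda>i. eps i \<omega>) {..<n})
                  {..n}"
  shows "(CLINT \<omega>|M. iexp (t * canonical_model.stat \<rho> \<sigma>2 \<beta> n p (\<lambda>j. \<Sum>i<n. X i j \<omega> * ((\<Sum>k<p. X i k \<omega> * \<beta> k) + eps i \<omega>))))
     = (CLINT z|(std_gauss {..<n} \<Otimes>\<^sub>M std_gauss {..<p}). iexp (t * canonical_model.S \<rho> \<sigma>2 \<beta> n p z))"
proof -
  interpret canonical_model \<rho> \<sigma>2 \<beta> n p by unfold_locales (fact \<rho> \<sigma>2 n)+
  interpret pA: prob_space A.P by (rule prob_space_std_gauss)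
  interpret pB: prob_space B.P by (rule prob_space_std_gauss)
  interpret R: pair_prob_space A.P B.P ..
  have Xm[measurable]: "X i j \<in> borel_measurable M" if "i < n" "j < p" for i j
    using rows[OF that(1)] that(2) by (auto simp: centered_mvnormal_def)
  have em[measurable]: "eps i \<in> borel_measurable M" if "i < n" for i
    using noise that by (auto simp: centered_mvnormal_def)
  define E where "E j \<omega> = (\<Sum>i<n. X i j \<omega> * ((\<Sum>k<p. X i k \<omega> * \<beta> k) + eps i \<omega>))" for j \<omega>
  have Em: "E j \<in> borel_measurable M" if "j < p" for j
    unfolding E_def using that
    by (intro borel_measurable_sum borel_measurable_times borel_measurable_add borel_measurable_const Xm em) auto
  have ch: "(CLINT \<omega>|M. iexp (\<Sum>j<p. \<theta> j * E j \<omega>)) = (CLINT z|R. iexp (\<Sum>j<p. \<theta> j * V j z))" for \<theta>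
    unfolding E_def char_V using \<sigma>2 by (intro char_XtY prob \<rho> rows noise indep) auto
  have st: "stat (restrict f {..<p}) = stat f" for f by (simp add: stat_def)
  have hm: "(\<lambda>u. iexp (t * stat u)) \<in> borel_measurable (Pi\<^sub>M {..<p} (\<lambda>_. borel))"
    unfolding stat_def by measurable
  have "(CLINT \<omega>|M. iexp (t * stat (\<lambda>j\<in>{..<p}. E j \<omega>))) = (CLINT z|R. iexp (t * stat (\<lambda>j\<in>{..<p}. V j z)))"
    by (rule expectation_uniqueness[OF prob R.P.prob_space_axioms Em V_measurable ch hm])
  thus ?thesis by (simp only: st S_def E_def)
qed

theorem theorem1:
  fixes M :: "nat \<Rightarrow> 'a measure"
    and X :: "nat \<Rightarrow> nat \<Rightarrow> nat \<Rightarrow> 'a \<Rightarrow> real"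
    and eps :: "nat \<Rightarrow> nat \<Rightarrow> 'a \<Rightarrow> real"
    and p :: "nat \<Rightarrow> nat"
    and \<beta> :: "nat \<Rightarrow> real"
    and \<rho> \<sigma>2 c :: real
  assumes rho: "-1 < \<rho>" "\<rho> < 1"
    and sigma: "\<sigma>2 > 0"
    and c: "c > 0"
    and p_inf: "filterlim p at_top sequentially"
    and p_ratio: "(\<lambda>n. real (p n) / real n) \<longlonglongrightarrow> c"
    and beta_sq: "summable (\<lambda>j. (\<beta> j)\<^sup>2)"
    and prob: "\<And>n. prob_space (M n)"
    and rows: "\<And>n i. i < n \<Longrightarrow> centered_mvnormal (M n) (X n i) {..<p n} (rpow \<rho>)"
    and noise: "\<And>n. centered_mvnormal (M n) (eps n) {..<n} (\<lambda>i i'. if i = i' then \<sigma>2 else 0)"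
    and indep: "\<And>n. prob_space.indep_vars (M n)
                  (\<lambda>k. Pi\<^sub>M {..<(if k < n then p n else n)} (\<lambda>_. borel))
                  (\<lambda>k \<omega>. if k < n then restrict (\<lambda>j. X n k j \<omega>) {..<p n}
                                 else restrict (\<lambda>i. eps n i \<omega>) {..<n})
                  {..n}"
  shows "weak_conv_m
     (\<lambda>n. distr (M n) borel
        (\<lambda>\<omega>. let Y = (\<lambda>i. (\<Sum>j<p n. X n i j \<omega> * \<beta> j) + eps n i \<omega>) in
              ((\<Sum>j<p n. (\<Sum>i<n. X n i j \<omega> * Y i)\<^sup>2)
                - (real n)\<^sup>2 * kappa2p \<rho> \<beta> (p n)
                - real (p n) * real n * (kappa1p \<rho> \<beta> (p n) + \<sigma>2))
              / real n powr (3/2)))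
     (normal_var
        (let \<kappa>1 = lim (kappa1p \<rho> \<beta>); \<kappa>2 = lim (kappa2p \<rho> \<beta>); \<kappa>3 = lim (kappa3p \<rho> \<beta>) in
         4 * \<kappa>2\<^sup>2 + 4 * (\<kappa>1 + \<sigma>2) * (2 * \<kappa>2 * c + \<kappa>3)
         + 2 * c * (\<kappa>1 + \<sigma>2)\<^sup>2 * (c + (1 + \<rho>\<^sup>2) / (1 - \<rho>\<^sup>2))))"
proof -
  have \<rho>: "\<bar>\<rho>\<bar> < 1" using rho by auto
  define T where "T n \<omega> = ((\<Sum>j<p n. (\<Sum>i<n. X n i j \<omega> * ((\<Sum>j<p n. X n i j \<omega> * \<beta> j) + eps n i \<omega>))\<^sup>2)
                - (real n)\<^sup>2 * kappa2p \<rho> \<beta> (p n)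
                - real (p n) * real n * (kappa1p \<rho> \<beta> (p n) + \<sigma>2))
              / real n powr (3/2)" for n \<omega>
  define k1 where "k1 = lim (kappa1p \<rho> \<beta>)"
  define k2 where "k2 = lim (kappa2p \<rho> \<beta>)"
  define k3 where "k3 = lim (kappa3p \<rho> \<beta>)"
  define r where "r = (1 + \<rho>\<^sup>2) / (1 - \<rho>\<^sup>2)"
  define s2 where "s2 = 4 * k2\<^sup>2 + 4 * (k1 + \<sigma>2) * (2 * k2 * c + k3) + 2 * c * (k1 + \<sigma>2)\<^sup>2 * (c + r)"
  define K1 where "K1 n = kappa1p \<rho> \<beta> (p n)" for n
  define K2 where "K2 n = kappa2p \<rho> \<beta> (p n)" for n
  define K3 where "K3 n = kappa3p \<rho> \<beta> (p n)" for n
  define tr where "tr n = (\<Sum>k<p n. \<Sum>l<p n. (rpow \<rho> k l)\<^sup>2) / real n" for n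
  define B where "B n = (\<Sum>j<p n. (\<beta> j)\<^sup>2)" for n
  define T2 where "T2 n = K1 n + \<sigma>2" for n
  define m where "m n = 1 / (sqrt (T2 n) * (sqrt (T2 n) + sqrt \<sigma>2))" for n
  define KK where "KK = 2 / (1 - \<bar>\<rho>\<bar>)"
  define pn where "pn n = real (p n) / real n" for n
  have L1: "K1 \<longlonglongrightarrow> k1"
    using filterlim_compose[OF convergent_kappa1p[OF \<rho> beta_sq, unfolded convergent_LIMSEQ_iff] p_inf] by (simp add: K1_def[abs_def] k1_def)
  have L2: "K2 \<longlonglongrightarrow> k2"
    using filterlim_compose[OF convergent_kappa2p[OF \<rho> beta_sq, unfolded convergent_LIMSEQ_iff] p_inf] by (simp add: K2_def[abs_def] k2_def)
  have L3: "K3 \<longlonglongrightarrow> k3"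
    using filterlim_compose[OF convergent_kappa3p[OF \<rho> beta_sq, unfolded convergent_LIMSEQ_iff] p_inf] by (simp add: K3_def[abs_def] k3_def)
  have LB: "B \<longlonglongrightarrow> (\<Sum>j. (\<beta> j)\<^sup>2)"
    using filterlim_compose[OF summable_LIMSEQ[OF beta_sq] p_inf] by (simp add: B_def[abs_def])
  have Lp: "pn \<longlonglongrightarrow> c" using p_ratio by (simp add: pn_def[abs_def])
  \<comment> \<open>tr(\<Sigma>^2) / n is tr(\<Sigma>^2) / p times p / n.\<close>
  have Ltr: "tr \<longlonglongrightarrow> r * c"
  proof -
    have "(\<lambda>n. (\<Sum>k<p n. \<Sum>l<p n. (rpow \<rho> k l)\<^sup>2) / real (p n) * pn n) \<longlonglongrightarrow> r * c"
      unfolding r_def by (intro tendsto_mult Lp filterlim_compose[OF sum_rpow_sq_asymptotic[OF \<rho>] p_inf])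
    moreover have "(\<Sum>k<p n. \<Sum>l<p n. (rpow \<rho> k l)\<^sup>2) / real (p n) * pn n = tr n" for n
      by (cases "p n = 0") (auto simp: pn_def tr_def)
    ultimately show ?thesis by simp
  qed
  have k10: "0 \<le> k1"
    using LIMSEQ_le_const[OF L1, of 0] rpow_psd[OF \<rho>, of \<beta>] by (auto simp: K1_def kappa1p_def)
  have LT: "T2 \<longlonglongrightarrow> k1 + \<sigma>2" unfolding T2_def[abs_def] by (intro tendsto_intros L1)
  have Lm: "m \<longlonglongrightarrow> 1 / (sqrt (k1 + \<sigma>2) * (sqrt (k1 + \<sigma>2) + sqrt \<sigma>2))"
  proof -
    have "0 < sqrt (k1 + \<sigma>2) * (sqrt (k1 + \<sigma>2) + sqrt \<sigma>2)"
      using k10 sigma by (intro mult_pos_pos add_pos_pos) auto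
    thus ?thesis unfolding m_def[abs_def]
      by (intro tendsto_divide tendsto_mult tendsto_add tendsto_const tendsto_real_sqrt LT) linarith
  qed
  \<comment> \<open>\<open>vn\<close> and \<open>err\<close> copy the variance and the bound of
    \<open>canonical_model\<close> with its constants replaced by sequences: the locale is
    interpreted for one \<open>n\<close> at a time, while the limits need functions of
    \<open>n\<close>.\<close>
  define vn where "vn n = 2 * (2 * K2 n + T2 n * pn n)\<^sup>2 + 2 * (T2 n)\<^sup>2 * tr n + 4 * T2 n * K3 n - 4 * (K2 n)\<^sup>2" for n
  define err where "err t n = 1 / sqrt n *
     (\<bar>t\<bar> * (2 * K2 n + T2 n * ((m n)\<^sup>2 * K2 n * K1 n + m n * (K1 n + K3 n)) + 2 * T2 n * sqrt (tr n)
        + (2 * sqrt 2 + 2) * sqrt (4 * T2 n * K3 n - 4 * (K2 n)\<^sup>2))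
      + t\<^sup>2 * (2 * sqrt 2 * (2 * K2 n + T2 n * pn n)\<^sup>2 + 2 * (T2 n)\<^sup>2 * sqrt (2 * KK ^ 3 * pn n)
        + 3 * T2 n * sqrt (KK ^ 3 * (8 * T2 n * K2 n + 8 * T2 n * (m n)\<^sup>2 * (K2 n)\<^sup>2 * B n))))" for t n
  have Lerr: "err t \<longlonglongrightarrow> 0" for t
  proof -
    have z: "(\<lambda>n. 1 / sqrt (real n)) \<longlonglongrightarrow> 0"
      by (intro real_tendsto_divide_at_top[OF tendsto_const] filterlim_compose[OF sqrt_at_top filterlim_real_sequentially])
    have *: "(\<lambda>n. 1 / sqrt (real n) * f n) \<longlonglongrightarrow> 0" if "f \<longlonglongrightarrow> L" for f L
      using tendsto_mult[OF z that] by simp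
    show ?thesis unfolding err_def[abs_def]
      by (rule *, (rule tendsto_add tendsto_diff tendsto_mult tendsto_power tendsto_real_sqrt tendsto_const
          L1 L2 L3 LB Lp Ltr LT Lm)+)
  qed
  have Lv: "vn \<longlonglongrightarrow> s2"
  proof -
    have "vn \<longlonglongrightarrow> 2 * (2 * k2 + (k1 + \<sigma>2) * c)\<^sup>2 + 2 * (k1 + \<sigma>2)\<^sup>2 * (r * c) + 4 * (k1 + \<sigma>2) * k3 - 4 * k2\<^sup>2"
      unfolding vn_def[abs_def] by (intro tendsto_add tendsto_diff tendsto_mult tendsto_power tendsto_const L1 L2 L3 Lp Ltr LT)
    also have "2 * (2 * k2 + (k1 + \<sigma>2) * c)\<^sup>2 + 2 * (k1 + \<sigma>2)\<^sup>2 * (r * c) + 4 * (k1 + \<sigma>2) * k3 - 4 * k2\<^sup>2 = s2"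
      unfolding s2_def by (simp add: power2_eq_square algebra_simps)
    finally show ?thesis .
  qed
  have Xm: "X n i j \<in> borel_measurable (M n)" if "i < n" "j < p n" for n i j
    using rows[OF that(1)] that(2) by (auto simp: centered_mvnormal_def)
  have em: "eps n i \<in> borel_measurable (M n)" if "i < n" for n i
    using noise[of n] that by (auto simp: centered_mvnormal_def)
  have Tm[measurable]: "T n \<in> borel_measurable (M n)" for n
    unfolding T_def
    by (intro borel_measurable_divide borel_measurable_diff borel_measurable_power borel_measurable_sum
        borel_measurable_times borel_measurable_add borel_measurable_const Xm em) auto
  have rate: "norm (char (distr (M n) borel (T n)) t - exp (- vn n * t\<^sup>2 / 2)) \<le> err t n" and vn0: "0 \<le> vn n" if n: "0 < n" for n t
  proof -
    interpret c: canonical_model \<rho> \<sigma>2 \<beta> n "p n" by unfold_locales (fact \<rho> sigma n)+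
    have t2: "c.\<tau>\<^sup>2 = T2 n" unfolding c.\<tau>_sq c.\<kappa>1_def T2_def K1_def ..
    have d: "c.\<kappa>1 = K1 n" "c.\<kappa>2 = K2 n" "c.\<kappa>3 = K3 n" "c.\<mu> = m n" "c.trace2 / n = tr n" "c.K = KK"
      by (simp_all add: c.\<kappa>1_def c.\<kappa>2_def c.\<kappa>3_def c.\<tau>_def c.\<mu>_def c.trace2_def c.K_def K1_def K2_def K3_def T2_def m_def tr_def KK_def)
    have d2: "c.d2 = 8 * T2 n * K2 n + 8 * T2 n * (m n)\<^sup>2 * (K2 n)\<^sup>2 * B n"
      unfolding c.d2_def t2 d B_def ..
    have v: "c.v = vn n" unfolding c.v_eq t2 d vn_def pn_def by simp
    show "0 \<le> vn n" using c.v_nonneg v by simp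
    have "char (distr (M n) borel (T n)) t = (CLINT \<omega>|M n. iexp (t * T n \<omega>))"
      unfolding char_def by (subst integral_distr) auto
    also have "\<dots> = (CLINT \<omega>|M n. iexp (t * c.stat (\<lambda>j. \<Sum>i<n. X n i j \<omega> * ((\<Sum>k<p n. X n i k \<omega> * \<beta> k) + eps n i \<omega>))))"
      unfolding T_def c.stat_def d K1_def K2_def ..
    also have "\<dots> = (CLINT z|c.R. iexp (t * c.S z))"
      by (rule char_XtY_statistic[OF prob \<rho> sigma n rows noise indep])
    finally show "norm (char (distr (M n) borel (T n)) t - exp (- vn n * t\<^sup>2 / 2)) \<le> err t n"
      using c.char_S_rate[of t] unfolding t2 d d2 v err_def pn_def by simp
  qed
  \<comment> \<open>Nonnegativity passes to the limit from the variances \<open>vn\<close>; the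
    formula for the characteristic function of \<open>normal_var\<close> asks for it.\<close>
  have s20: "0 \<le> s2"
    using vn0 by (intro LIMSEQ_le_const[OF Lv]) (auto intro!: exI[of _ 1])
  have "weak_conv_m (\<lambda>n. distr (M n) borel (T n)) (normal_var s2)"
  proof (rule levy_continuity)
    fix n
    interpret prob_space "M n" by (rule prob)
    show "real_distribution (distr (M n) borel (T n))" by (intro real_distribution_distr) simp
  next
    show "real_distribution (normal_var s2)" by (rule real_distribution_normal_var[OF s20])
  next
    fix t
    \<comment> \<open>The variance moves with \<open>n\<close>, so the comparison is made with
      \<open>exp (- vn n * t\<^sup>2 / 2)\<close> and the limit of the latter is taken
      separately.\<close>
    have "(\<lambda>n. char (distr (M n) borel (T n)) t - exp (- vn n * t\<^sup>2 / 2)) \<longlonglongrightarrow> 0"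
    proof (rule Lim_null_comparison[OF _ Lerr])
      show "\<forall>\<^sub>F n in sequentially. norm (char (distr (M n) borel (T n)) t - exp (- vn n * t\<^sup>2 / 2)) \<le> err t n"
        using eventually_gt_at_top[of 0] by eventually_elim (rule rate)
    qed
    moreover have "(\<lambda>n. complex_of_real (exp (- vn n * t\<^sup>2 / 2))) \<longlonglongrightarrow> exp (- s2 * t\<^sup>2 / 2)"
      by (intro tendsto_intros Lv) auto
    ultimately have "(\<lambda>n. (char (distr (M n) borel (T n)) t - exp (- vn n * t\<^sup>2 / 2)) + exp (- vn n * t\<^sup>2 / 2)) \<longlonglongrightarrow> 0 + complex_of_real (exp (- s2 * t\<^sup>2 / 2))"
      by (rule tendsto_add)
    thus "(\<lambda>n. char (distr (M n) borel (T n)) t) \<longlonglongrightarrow> char (normal_var s2) t"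
      by (simp add: char_normal_var[OF s20])
  qed
  thus ?thesis
    unfolding Let_def T_def[abs_def] s2_def k1_def k2_def k3_def r_def .
qed

end
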